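(* Let $q,r\ge 2$, let $G=G_\alpha$ be the Green kernel of the random walk $P_\alpha$ on the Diestel-Leader graph $\mathrm{DL}(q,r)$, and for $x=x_1x_2,\,y=y_1y_2\in \mathrm{DL}(q,r)$ write $\mathfrak u_i=\mathfrak u(x_i,y_i)$, $\mathfrak d_i=\mathfrak d(x_i,y_i)$ ($i=1,2$) and $\mathfrak s=\mathfrak s(x,y)=\mathfrak u_1+\mathfrak u_2=\mathfrak d_1+\mathfrak d_2$. Suppose that $d(x,y)\to\infty$ (graph distance in $\mathrm{DL}(q,r)$), and hence $\mathfrak s\to\infty$. Then the following holds. (a) If $\alpha<1/2$ and $\beta=(1-\alpha)/\alpha$, then $$G(x,y)\sim \frac{A_\beta}{(q\beta)^{\mathfrak d_1}\,r^{\mathfrak d_2}}\left(B_\beta\,\frac{\beta^{\mathfrak s}-\beta^{\mathfrak u_1}}{\beta^{\mathfrak s}-1}\,\frac{\beta^{\mathfrak s}-\beta^{\mathfrak d_1}}{\beta^{\mathfrak s}-1}\,\frac{1}{\beta^{\mathfrak s}}+\frac{\beta^{\mathfrak s}-\beta^{\mathfrak u_1}}{\beta^{\mathfrak s}-1}\,\frac{\beta^{\mathfrak d_1}-1}{\beta^{\mathfrak s}-1}+\frac{\beta^{\mathfrak u_1}-1}{\beta^{\mathfrak s}-1}\,\frac{\beta^{\mathfrak s}-\beta^{\mathfrak d_1}}{\beta^{\mathfrak s}-1}+B_\beta^*\,\frac{\beta^{\mathfrak u_1}-1}{\beta^{\mathfrak s}-1}\,\frac{\beta^{\mathfrak d_1}-1}{\beta^{\mathfrak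 s}-1}\right),$$ where $$A_\beta=\frac{G_1(o_1,o_1)\,G_2(o_2,o_2)}{\widetilde G(0,0)}=\frac{q\,r\,(\beta^2-1)}{(q\beta-1)(r\beta-1)},\qquad B_\beta=\frac{(\beta-1)(q\beta+1)}{q\beta^2-1},\qquad B_\beta^*=\frac{(\beta-1)(r\beta+1)}{r\beta^2-1}.$$ (b) If $\alpha=1/2$, then $$G(x,y)\sim\frac{A_1}{\mathfrak s^4\,q^{\mathfrak d_1}\,r^{\mathfrak d_2}}\left(\frac{q+1}{q-1}\,\mathfrak u_2\mathfrak d_2+\mathfrak s\,\mathfrak u_2\mathfrak d_1+\mathfrak s\,\mathfrak u_1\mathfrak d_2+\frac{r+1}{r-1}\,\mathfrak u_1\mathfrak d_1\right),$$ where $$A_1=\frac{G_1(o_1,o_1)\,G_2(o_2,o_2)}{2}=\frac{2qr}{(q-1)(r-1)}.$$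
   Context: Trees. For an integer $p\ge2$, $\mathbb T_p$ is the homogeneous tree in which every vertex has $p+1$ neighbours. An end is an equivalence class of one-sided infinite geodesic rays, two rays being equivalent if their symmetric difference is finite. Fix a root $o$ and a reference end $\omega$; for a vertex $x$, $\overline{x\,\omega}$ is the unique ray starting at $x$ representing $\omega$. For vertices $x,y$, the confluent $x\curlywedge y$ is the vertex $b$ with $\overline{x\,\omega}\cap\overline{y\,\omega}=\overline{b\,\omega}$. Put $\mathfrak u(x,y)=d(x,x\curlywedge y)$, $\mathfrak d(x,y)=d(y,x\curlywedge y)$, and let $\mathfrak h(x)=\mathfrak d(o,x)-\mathfrak u(o,x)$ be the Busemann function. Each vertex $x$ has exactly one neighbour $x^-$ (predecessor) with $\mathfrak h(x^-)=\mathfrak h(x)-1$; its other $p$ neighbours $y$ (successors) satisfy $y^-=x$. Diestel-Leader graph. Let $\mathbb T_q,\mathbb T_r$ ($q,r\ge2$) have roots $o_1,o_2$ and reference ends $\omega_1,\omega_2$. The vertex set is $\mathrm{DL}(q,r)=\{x_1x_2\in\mathbb T_q\times\mathbb T_r:\mathfrak h(x_1)+\mathfrak h(x_2)=0\}$, and $x_1x_2\sim y_1y_2$ iff $x_1\sim y_1$ and $x_2\sim y_2$. Random walks. For $\alpha\in(0,1)$, $P_\alpha$ on $\mathrm{DL}(q,r)$ has transition probabilities $p_\alpha(x,y)=\alpha/q$ if $y_1^-=x_1$ and $y_2=x_2^-$; $p_\alpha(x,y)=(1-\alpha)/r$ if $y_1=x_1^-$ and $y_2^-=x_2$; and $0$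 otherwise. For $a\in(0,1)$, $P_{a,p}$ on $\mathbb T_p$ moves from $v$ to each of its $p$ successors with probability $a/p$ and to $v^-$ with probability $1-a$. The projections of $P_\alpha$ are $P_1=P_{\alpha,q}$ on $\mathbb T_q$, $P_2=P_{1-\alpha,r}$ on $\mathbb T_r$, and $\widetilde P=\widetilde P_\alpha$ on $\mathbb Z$, which moves from $k$ to $k+1$ with probability $\alpha$ and to $k-1$ with probability $1-\alpha$. The Green kernel of a transition matrix $P$ is $\sum_{n\ge0}p^{(n)}(x,y)$; $G,G_1,G_2,\widetilde G$ denote the Green kernels of $P_\alpha,P_1,P_2,\widetilde P$ ($\widetilde G$ is finite if $\alpha\ne1/2$). Convention. "$\sim$ as $d(x,y)\to\infty$" means that the quotient of the two sides tends to $1$ along every sequence of pairs $(x,y)$ with $d(x,y)\to\infty$. *)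

theory Defs
  imports "HOL-Analysis.Analysis"
begin

subsection \<open>Graphs, trees and ends\<close>

text \<open>A graph is given by its adjacency relation. The vertex set of a tree is the whole
  underlying type.\<close>

definition graph_dist :: "('a \<Rightarrow> 'a \<Rightarrow> bool) \<Rightarrow> 'a \<Rightarrow> 'a \<Rightarrow> nat" where
  "graph_dist E x y = (LEAST n. (E ^^ n) x y)"

definition is_tree :: "('a \<Rightarrow> 'a \<Rightarrow> bool) \<Rightarrow> bool" where
  "is_tree E \<longleftrightarrow> symp E \<and> irreflp E \<and> (\<forall>x y. E\<^sup>*\<^sup>* x y) \<and>
     \<not> (\<exists>c. 3 \<le> length c \<and> distinct c \<and> successively E c \<and> E (last c) (hd c))"

definition homogeneous_tree :: "nat \<Rightarrow> ('a \<Rightarrow> 'a \<Rightarrow> bool) \<Rightarrow> bool" where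
  "homogeneous_tree p E \<longleftrightarrow> 2 \<le> p \<and> is_tree E \<and> (\<forall>x. card {y. E x y} = p + 1)"

definition geodesic_ray :: "('a \<Rightarrow> 'a \<Rightarrow> bool) \<Rightarrow> (nat \<Rightarrow> 'a) \<Rightarrow> bool" where
  "geodesic_ray E f \<longleftrightarrow> (\<forall>m n. m \<le> n \<longrightarrow> graph_dist E (f m) (f n) = n - m)"

definition ray_equiv :: "('a \<Rightarrow> 'a \<Rightarrow> bool) \<Rightarrow> ((nat \<Rightarrow> 'a) \<times> (nat \<Rightarrow> 'a)) set" where
  "ray_equiv E = {(f, g). geodesic_ray E f \<and> geodesic_ray E g \<and>
     finite ((range f - range g) \<union> (range g - range f))}"

definition ends :: "('a \<Rightarrow> 'a \<Rightarrow> bool) \<Rightarrow> (nat \<Rightarrow> 'a) set set" where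
  "ends E = {f. geodesic_ray E f} // ray_equiv E"

subsection \<open>Trees with a root and a reference end\<close>

record 'a pointed_tree =
  adj :: "'a \<Rightarrow> 'a \<Rightarrow> bool"
  base :: 'a
  ref_end :: "(nat \<Rightarrow> 'a) set"

definition pointed_homogeneous_tree :: "nat \<Rightarrow> 'a pointed_tree \<Rightarrow> bool" where
  "pointed_homogeneous_tree p T \<longleftrightarrow> homogeneous_tree p (adj T) \<and> ref_end T \<in> ends (adj T)"

definition ray_to_end :: "'a pointed_tree \<Rightarrow> 'a \<Rightarrow> nat \<Rightarrow> 'a" where
  "ray_to_end T x = (THE f. f \<in> ref_end T \<and> f 0 = x)"

definition confluent :: "'a pointed_tree \<Rightarrow> 'a \<Rightarrow> 'a \<Rightarrow> 'a" where
  "confluent T x y =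
     (THE b. range (ray_to_end T x) \<inter> range (ray_to_end T y) = range (ray_to_end T b))"

definition up :: "'a pointed_tree \<Rightarrow> 'a \<Rightarrow> 'a \<Rightarrow> nat" where
  "up T x y = graph_dist (adj T) x (confluent T x y)"

definition down :: "'a pointed_tree \<Rightarrow> 'a \<Rightarrow> 'a \<Rightarrow> nat" where
  "down T x y = graph_dist (adj T) y (confluent T x y)"

definition busemann :: "'a pointed_tree \<Rightarrow> 'a \<Rightarrow> int" where
  "busemann T x = int (down T (base T) x) - int (up T (base T) x)"

definition predecessor :: "'a pointed_tree \<Rightarrow> 'a \<Rightarrow> 'a" where
  "predecessor T x = (THE y. adj T x y \<and> busemann T y = busemann T x - 1)"

subsection \<open>The Diestel-Leader graph\<close>

definition DL :: "'a pointed_tree \<Rightarrow> 'b pointed_tree \<Rightarrow> ('a \<times> 'b) set" where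
  "DL T1 T2 = {(x1, x2). busemann T1 x1 + busemann T2 x2 = 0}"

definition DL_adj ::
    "'a pointed_tree \<Rightarrow> 'b pointed_tree \<Rightarrow> 'a \<times> 'b \<Rightarrow> 'a \<times> 'b \<Rightarrow> bool" where
  "DL_adj T1 T2 x y \<longleftrightarrow> x \<in> DL T1 T2 \<and> y \<in> DL T1 T2 \<and>
     adj T1 (fst x) (fst y) \<and> adj T2 (snd x) (snd y)"

subsection \<open>Random walks and Green kernels\<close>

text \<open>Transition matrices over a state space \<open>S\<close>. The matrices below have only finitely many
  nonzero entries in each row, so the sums in \<open>nstep\<close> are finite sums. The Green kernel takes
  values in \<open>[0, \<infinity>]\<close>.\<close>

primrec nstep :: "'s set \<Rightarrow> ('s \<Rightarrow> 's \<Rightarrow> real) \<Rightarrow> nat \<Rightarrow> 's \<Rightarrow> 's \<Rightarrow> real" where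
  "nstep S P 0 x y = (if x = y then 1 else 0)"
| "nstep S P (Suc n) x y = (\<Sum>\<^sub>\<infinity>z\<in>S. P x z * nstep S P n z y)"

definition green :: "'s set \<Rightarrow> ('s \<Rightarrow> 's \<Rightarrow> real) \<Rightarrow> 's \<Rightarrow> 's \<Rightarrow> ennreal" where
  "green S P x y = (\<Sum>n. ennreal (nstep S P n x y))"

definition DL_walk ::
    "nat \<Rightarrow> nat \<Rightarrow> 'a pointed_tree \<Rightarrow> 'b pointed_tree \<Rightarrow> real
      \<Rightarrow> 'a \<times> 'b \<Rightarrow> 'a \<times> 'b \<Rightarrow> real" where
  "DL_walk q r T1 T2 \<alpha> x y =
     (if predecessor T1 (fst y) = fst x \<and> snd y = predecessor T2 (snd x) then \<alpha> / q
      else if fst y = predecessor T1 (fst x) \<and> predecessor T2 (snd y) = snd x then (1 - \<alpha>) / r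
      else 0)"

definition tree_walk :: "nat \<Rightarrow> 'a pointed_tree \<Rightarrow> real \<Rightarrow> 'a \<Rightarrow> 'a \<Rightarrow> real" where
  "tree_walk p T a v w =
     (if predecessor T w = v then a / p else if w = predecessor T v then 1 - a else 0)"

definition int_walk :: "real \<Rightarrow> int \<Rightarrow> int \<Rightarrow> real" where
  "int_walk \<alpha> k l = (if l = k + 1 then \<alpha> else if l = k - 1 then 1 - \<alpha> else 0)"

subsection \<open>Asymptotics\<close>

definition far_sequences ::
    "'v set \<Rightarrow> ('v \<Rightarrow> 'v \<Rightarrow> bool) \<Rightarrow> (nat \<Rightarrow> 'v) \<Rightarrow> (nat \<Rightarrow> 'v) \<Rightarrow> bool" where
  "far_sequences V E X Y \<longleftrightarrow> (\<forall>n. X n \<in> V \<and> Y n \<in> V) \<and>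
     filterlim (\<lambda>n. graph_dist E (X n) (Y n)) at_top sequentially"

text \<open>\<open>f x y \<sim> g x y\<close> as \<open>d(x, y) \<rightarrow> \<infinity>\<close>. The quotient is formed in \<open>ennreal\<close>, so its convergence
  to 1 entails that \<open>f\<close> is finite and \<open>g\<close> positive along the sequences from some index on.\<close>

definition asymp_far ::
    "'v set \<Rightarrow> ('v \<Rightarrow> 'v \<Rightarrow> bool) \<Rightarrow> ('v \<Rightarrow> 'v \<Rightarrow> ennreal) \<Rightarrow> ('v \<Rightarrow> 'v \<Rightarrow> real) \<Rightarrow> bool" where
  "asymp_far V E f g \<longleftrightarrow> (\<forall>X Y. far_sequences V E X Y \<longrightarrow>
     (\<lambda>n. f (X n) (Y n) / ennreal (g (X n) (Y n))) \<longlonglongrightarrow> 1)"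

end

theory Submission
  imports Defs
begin

text \<open>
  The heights of the walk form a nearest neighbour walk on the integers. Given the path of heights from \<open>0\<close> to
  \<open>d\<^sub>1 - u\<^sub>1\<close>, the walk can be at \<open>y\<close> only if the path goes down to \<open>- u\<^sub>1\<close> and up to \<open>u\<^sub>2\<close>, and if its minimum
  and maximum are \<open>- u\<^sub>1 - i\<close> and \<open>u\<^sub>2 + j\<close>, the conditional probability is \<open>q ^ (- d\<^sub>1 - i) r ^ (- d\<^sub>2 - j)\<close>. So \<open>G(x, y)\<close>
  is a double series over \<open>i\<close> and \<open>j\<close> of the expected numbers of visits along paths with prescribed minimum and
  maximum, for which there is a closed formula in terms of the numbers \<open>[n] = 1 + \<beta> + \<dots> + \<beta> ^ (n - 1)\<close>.
  This is proved without paths: the double series solves the equation of the Green kernel and tends to \<open>0\<close> at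
  infinity, hence it is the Green kernel.

  Up to the factor \<open>\<beta> ^ (- d\<^sub>1)\<close>, the double series is affine in \<open>[u\<^sub>1]\<close> and in \<open>[d\<^sub>1]\<close>, and so are the right-hand sides
  of the theorem. It suffices therefore to compare their values for \<open>u\<^sub>1, d\<^sub>1 \<in> {0, s}\<close>, which depend on \<open>s\<close> only,
  as \<open>s \<rightarrow> \<infinity>\<close>; this also treats \<open>\<alpha> < 1/2\<close> and \<open>\<alpha> = 1/2\<close> alike.
\<close>

subsection \<open>Trees and Busemann functions\<close>

text \<open>The power of \<open>q\<close> has the following source. At its minimum the walk sits in
  the first tree at an ancestor of \<open>y1\<close>, \<open>d1 + i\<close> levels above it. On each
  of these levels the last step upwards in height picks one of \<open>q\<close> successors
  uniformly, and all these picks have to lead to \<open>y1\<close>. The second tree is the same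
  picture upside down; its picks belong to the steps in the other direction and are independent of
  the first ones. Paths can be avoided because the counts with prescribed extrema obey first-step
  equations. Their form depends on whether the start is inside its range, at the bottom or at the
  top; summed over the overshoots, these cases become the cases in which \<open>x1\<close> is or is
  not an ancestor of \<open>y1\<close>, and likewise for \<open>x2\<close>. Decay at infinity
  identifies the Green kernel on the Diestel-Leader graph, but not those on the trees and on the
  integers: where the walk is sure to reach the predecessor, their Green functions do not decay
  along successors. There a discount is introduced, boundedness suffices, and the discount is
  removed by a limit.\<close>

lemma graph_dist_le: "(E ^^ n) x y \<Longrightarrow> graph_dist E x y \<le> n"
  unfolding graph_dist_def by (rule Least_le)

section \<open>Distances in a tree\<close>

locale tree =
  fixes E :: "'a \<Rightarrow> 'a \<Rightarrow> bool"
  assumes tree: "is_tree E"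
begin

abbreviation "gd \<equiv> graph_dist E"

lemma sym: "E x y \<Longrightarrow> E y x"
  using tree by (auto simp: is_tree_def dest: sympD)

lemma irrefl: "\<not> E x x"
  using tree by (auto simp: is_tree_def irreflp_def)

lemma no_cycle: "\<not> (3 \<le> length c \<and> distinct c \<and> successively E c \<and> E (last c) (hd c))"
  using tree by (auto simp: is_tree_def)

lemma gd_walk: "(E ^^ gd x y) x y"
proof -
  have "E\<^sup>*\<^sup>* x y" using tree by (auto simp: is_tree_def)
  then obtain n where "(E ^^ n) x y" using rtranclp_imp_relpowp by metis
  then show ?thesis unfolding graph_dist_def by (rule LeastI)
qed

lemma walk_rev: "(E ^^ n) x y \<Longrightarrow> (E ^^ n) y x"
proof (induction n arbitrary: y)
  case (Suc n)
  then obtain z where "(E ^^ n) x z" "E z y" by (meson relpowp_Suc_E)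
  then show ?case using Suc.IH sym by (meson relpowp_Suc_I2)
qed auto

lemma gd_sym: "gd x y = gd y x"
  by (meson antisym graph_dist_le gd_walk walk_rev)

lemma gd_self [simp]: "gd x x = 0"
  using graph_dist_le[of 0 E x x] by simp

lemma gd_eq_0 [simp]: "gd x y = 0 \<longleftrightarrow> x = y"
  by (metis gd_self gd_walk relpowp_0_E)

lemma gd_triangle: "gd x z \<le> gd x y + gd y z"
  by (meson graph_dist_le gd_walk relpowp_trans)

lemma gd_adj: "E x y \<Longrightarrow> gd x y = 1"
  by (metis One_nat_def antisym gd_eq_0 graph_dist_le irrefl less_one linorder_not_less relpowp_1)

lemma gd_adj_le: "E x y \<Longrightarrow> gd x v \<le> gd y v + 1"
  using gd_triangle[of x v y] by (simp add: gd_adj)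

lemma closer_neighbour: "gd x v = Suc k \<Longrightarrow> \<exists>y. E x y \<and> gd y v = k"
proof -
  assume k: "gd x v = Suc k"
  then have "(E ^^ Suc k) x v" using gd_walk[of x v] by simp
  then obtain y where y: "E x y" "(E ^^ k) y v" by (meson relpowp_Suc_D2)
  then have "gd y v \<le> k" by (simp add: graph_dist_le)
  with y gd_adj_le[OF y(1), of v] k show ?thesis by auto
qed

text \<open>Both ends move one step closer to \<open>v\<close> until they meet. The old ends are
  farther from \<open>v\<close> than everything on the inner path, so they do not lie on it. With
  three or more vertices, the path becomes a cycle once its ends are adjacent or have a common
  neighbour off the path.\<close>

lemma level_path:
  assumes "a \<noteq> b" "gd a v = k" "gd b v = k"
  shows "\<exists>c. 3 \<le> length c \<and> distinct c \<and> successively E c \<and> hd c = a \<and> last c = b \<and> (\<forall>w\<in>set c. gd w v \<le> k)"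
  using assms
proof (induction k arbitrary: a b)
  case (Suc k)
  obtain a' where a': "E a a'" "gd a' v = k"
    using closer_neighbour[OF Suc.prems(2)] by blast
  obtain b' where b': "E b b'" "gd b' v = k"
    using closer_neighbour[OF Suc.prems(3)] by blast
  show ?case
  proof (cases "a' = b'")
    case True
    have "a \<noteq> a'" "b \<noteq> a'" using a'(2) Suc.prems(2,3) by (metis n_not_Suc_n)+
    then show ?thesis
      using a' sym[OF b'(1)] True Suc.prems by (intro exI[of _ "[a, a', b]"]) auto
  next
    case False
    then obtain c where c: "3 \<le> length c" "distinct c" "successively E c" "hd c = a'" "last c = b'"
      "\<And>w. w \<in> set c \<Longrightarrow> gd w v \<le> k"
      using Suc.IH[OF False a'(2) b'(2)] by blast
    have "a \<notin> set c" "b \<notin> set c" using c(6)[of a] c(6)[of b] Suc.prems by auto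
    moreover have "c \<noteq> []" using c(1) by auto
    moreover have "gd w v \<le> Suc k" if "w \<in> set c" for w using c(6)[OF that] by simp
    ultimately show ?thesis
      using c(1-5) a'(1) sym[OF b'(1)] Suc.prems
      by (intro exI[of _ "a # c @ [b]"]) (auto simp: successively_Cons successively_append_iff)
  qed
qed auto

text \<open>An edge between two vertices at equal distance from \<open>v\<close> would close the
  path between them to a cycle: trees are bipartite.\<close>

lemma gd_adj_neq: 
  assumes "E x y" shows "gd x v \<noteq> gd y v"
proof
  assume "gd x v = gd y v"
  moreover have "x \<noteq> y" using assms irrefl by auto
  ultimately show False using level_path[of x y v] no_cycle assms sym by metis
qed

text \<open>Both neighbours are at the same distance from \<open>v\<close>, and the path joining
  them stays below the level of \<open>x\<close>; hence \<open>x\<close> would close it to a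
  cycle.\<close>

lemma closer_neighbour_unique:
  assumes "E x a" "E x b" "gd a v < gd x v" "gd b v < gd x v"
  shows "a = b"
proof (rule ccontr)
  assume ne: "a \<noteq> b"
  have "gd b v = gd a v" using gd_adj_le[OF assms(1), of v] gd_adj_le[OF assms(2), of v] assms by simp
  then obtain c where c: "3 \<le> length c" "distinct c" "successively E c" "hd c = a" "last c = b"
      "\<And>w. w \<in> set c \<Longrightarrow> gd w v \<le> gd a v"
    using level_path[OF ne refl] by metis
  have "x \<notin> set c" using c(6) assms(3) by (meson linorder_not_le)
  moreover have "c \<noteq> []" using c by auto
  ultimately show False
    using no_cycle[of "x # c"] c(1-5) assms(1) sym[OF assms(2)] by (auto simp: successively_Cons)
qed

end

section \<open>The Busemann function of a ray and the predecessor map\<close>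

locale tree_ray = tree E for E :: "'a \<Rightarrow> 'a \<Rightarrow> bool" +
  fixes f :: "nat \<Rightarrow> 'a"
  assumes ray: "geodesic_ray E f"
begin

lemma ray_adj: "E (f n) (f (Suc n))"
proof -
  have "gd (f n) (f (Suc n)) = 1" using ray by (auto simp: geodesic_ray_def)
  then show ?thesis using gd_walk[of "f n" "f (Suc n)"] by (metis relpowp_1)
qed

text \<open>Along the ray \<open>gd x (f n) - n\<close> does not increase and stays above
  \<open>- gd x (f 0)\<close>, so it is eventually constant. Adding \<open>gd x (f 0)\<close> makes
  it a natural number, for which a least value exists.\<close>

lemma horo_exists: "\<exists>k::int. \<exists>N. \<forall>n\<ge>N. int (gd x (f n)) = int n + k"
proof -
  define m where "m n = gd x (f n) + gd x (f 0) - n" for n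
  have ge: "n \<le> gd x (f n) + gd x (f 0)" for n
    using ray gd_triangle[of "f 0" "f n" x] gd_sym[of x "f 0"] by (simp add: geodesic_ray_def)
  have dec: "m (Suc n) \<le> m n" for n
    using gd_adj_le[OF ray_adj[THEN sym], of n x] ge[of n] by (simp add: m_def gd_sym)
  then have anti: "m j \<le> m i" if "i \<le> j" for i j using that by (rule lift_Suc_antimono_le)
  obtain N where N: "\<And>n. m N \<le> m n" using ex_has_least_nat[of "\<lambda>_. True" 0 m] by auto
  have "int (gd x (f n)) = int n + (int (m N) - int (gd x (f 0)))" if "n \<ge> N" for n
    using anti[OF that] N[of n] ge[of n] by (simp add: m_def)
  then show ?thesis by blast
qed

text \<open>The Busemann function of the ray, normalized to be \<open>0\<close> at
  \<open>f 0\<close>. It decreases towards the end, in accordance with predecessors having the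
  smaller value.\<close>

definition horo :: "'a \<Rightarrow> int" where
  "horo x = (SOME k. \<exists>N. \<forall>n\<ge>N. int (gd x (f n)) = int n + k)"

lemma horo: "\<exists>N. \<forall>n\<ge>N. int (gd x (f n)) = int n + horo x"
  unfolding horo_def by (rule someI_ex[OF horo_exists])

lemma horoI: "(\<And>n. n \<ge> N \<Longrightarrow> int (gd x (f n)) = int n + k) \<Longrightarrow> horo x = k"
proof -
  assume a: "\<And>n. n \<ge> N \<Longrightarrow> int (gd x (f n)) = int n + k"
  obtain M where "\<And>n. n \<ge> M \<Longrightarrow> int (gd x (f n)) = int n + horo x" using horo by blast
  from this[of "max M N"] a[of "max M N"] show ?thesis by simp
qed

lemma horo_ray: "horo (f m) = - int m"
  by (rule horoI[of m]) (use ray in \<open>simp add: geodesic_ray_def of_nat_diff\<close>)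

lemma horo_adj: 
  assumes "E x y" shows "horo y = horo x - 1 \<or> horo y = horo x + 1"
proof -
  obtain M where M: "\<And>n. n \<ge> M \<Longrightarrow> int (gd x (f n)) = int n + horo x" using horo by blast
  obtain N where N: "\<And>n. n \<ge> N \<Longrightarrow> int (gd y (f n)) = int n + horo y" using horo by blast
  from M[OF max.cobounded1, of N] N[OF max.cobounded2, of M]
    gd_adj_neq[OF assms, of "f (max M N)"] gd_adj_le[OF assms, of "f (max M N)"] gd_adj_le[OF sym[OF assms], of "f (max M N)"]
  show ?thesis by linarith
qed

text \<open>From \<open>f n\<close> to \<open>f (Suc n)\<close> the distance to \<open>x\<close>
  grows by exactly one and the distance to \<open>y\<close> by at most one; as \<open>x\<close> and
  \<open>y\<close> are adjacent, the lead of one step is neither lost nor enlarged.\<close>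

lemma closer_on_ray:
  assumes "\<And>n. n \<ge> N \<Longrightarrow> int (gd x (f n)) = int n + k" "E x y" "gd y (f N) < gd x (f N)" "n \<ge> N"
  shows "int (gd y (f n)) = int n + (k - 1)"
  using \<open>n \<ge> N\<close>
proof (induction n rule: dec_induct)
  case base
  show ?case using assms(1)[OF order_refl] assms(3) gd_adj_le[OF assms(2), of "f N"] by linarith
next
  case (step n)
  have "gd y (f (Suc n)) \<le> gd y (f n) + 1"
    using gd_adj_le[OF ray_adj[THEN sym], of n y] by (simp add: gd_sym)
  then show ?case
    using step.IH assms(1)[OF le_SucI[OF step.hyps(1)]] gd_adj_le[OF assms(2), of "f (Suc n)"] by linarith
qed

lemma lower_neighbour: "\<exists>!y. E x y \<and> horo y = horo x - 1"
proof -
  obtain N0 where N0: "\<And>n. n \<ge> N0 \<Longrightarrow> int (gd x (f n)) = int n + horo x" using horo by blast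
  \<comment> \<open>The second entry of the maximum makes \<open>gd x (f N) = N + horo x\<close>
    positive, so that \<open>x\<close> has a neighbour closer to \<open>f N\<close>.\<close>
  define N where "N = max N0 (nat (1 - horo x))"
  have N: "\<And>n. n \<ge> N \<Longrightarrow> int (gd x (f n)) = int n + horo x" using N0 by (simp add: N_def)
  have "gd x (f N) \<noteq> 0" using N[of N] by (auto simp: N_def)
  then obtain y where y: "E x y" "gd y (f N) < gd x (f N)"
    using closer_neighbour by (metis lessI not0_implies_Suc)
  have "horo y = horo x - 1" by (rule horoI[OF closer_on_ray[OF N y]])
  moreover have "z = y" if z: "E x z" "horo z = horo x - 1" for z
  proof -
    obtain M where "\<And>n. n \<ge> M \<Longrightarrow> int (gd z (f n)) = int n + horo z" using horo by blast
    from this[OF max.cobounded1, of N] N[OF max.cobounded2, of M] z(2) closer_on_ray[OF N y max.cobounded2, of M]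
    have "gd z (f (max M N)) < gd x (f (max M N))" "gd y (f (max M N)) < gd x (f (max M N))" by linarith+
    then show ?thesis by (rule closer_neighbour_unique[OF z(1) y(1)])
  qed
  ultimately show ?thesis using y by blast
qed

definition par :: "'a \<Rightarrow> 'a" where "par x = (THE y. E x y \<and> horo y = horo x - 1)"

lemma par: "E x (par x)" "horo (par x) = horo x - 1"
  using theI'[OF lower_neighbour[of x]] by (simp_all add: par_def)

lemma parI: "E x y \<Longrightarrow> horo y = horo x - 1 \<Longrightarrow> par x = y"
  using par[of x] lower_neighbour[of x] by blast

lemma adj_iff: "E x y \<longleftrightarrow> par x = y \<or> par y = x"
proof
  assume "E x y"
  then show "par x = y \<or> par y = x" using horo_adj[of x y] parI[of x y] parI[of y x] sym by fastforce
qed (use par sym in blast)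

lemma horo_par_pow: "horo ((par ^^ n) x) = horo x - int n"
  by (induction n) (auto simp: par)

text \<open>Going to the predecessor \<open>n\<close> times is a walk of length \<open>n\<close>,
  and none is shorter because \<open>horo\<close> changes by one along each edge.\<close>

lemma gd_par_pow: "gd x ((par ^^ n) x) = n"
proof -
  have "(E ^^ n) x ((par ^^ n) x)" by (induction n) (auto intro: relpowp_Suc_I par)
  then have "gd x ((par ^^ n) x) \<le> n" by (rule graph_dist_le)
  moreover have "\<bar>horo y - horo x\<bar> \<le> int m" if "(E ^^ m) x y" for m y
    using that
  proof (induction m arbitrary: y)
    case (Suc m)
    then obtain z where z: "(E ^^ m) x z" "E z y" by (meson relpowp_Suc_E)
    then show ?case using Suc.IH[of z] horo_adj[OF z(2)] by auto
  qed auto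
  from this[OF gd_walk, of "(par ^^ n) x"] have "n \<le> gd x ((par ^^ n) x)" by (simp add: horo_par_pow)
  ultimately show ?thesis by simp
qed

lemma par_ray: "par (f n) = f (Suc n)"
  by (intro parI ray_adj) (simp add: horo_ray)

lemma par_pow_ray: "(par ^^ k) (f n) = f (n + k)"
  by (induction k) (auto simp: par_ray)

text \<open>Induction on the distance to a late point of the ray: a neighbour closer to that point
  has the smaller value of \<open>horo\<close> and is therefore the predecessor.\<close>

lemma reaches_ray: "\<exists>k n. (par ^^ k) x = f n"
proof -
  have "\<exists>k n. (par ^^ k) x = f n" if "\<And>n. n \<ge> N \<Longrightarrow> int (gd x (f n)) = int n + horo x" "gd x (f N) = j" for N j
    using that
  proof (induction j arbitrary: x)
    case 0
    then show ?case by (metis funpow_0 gd_eq_0)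
  next
    case (Suc j)
    obtain y where y: "E x y" "gd y (f N) = j" using closer_neighbour Suc.prems(2) by blast
    note c = closer_on_ray[OF Suc.prems(1) y(1)]
    have hy: "horo y = horo x - 1" using Suc.prems y by (intro horoI[OF c]) auto
    then have "\<exists>k n. (par ^^ k) y = f n"
      using c Suc.prems y by (intro Suc.IH) auto
    moreover have "par x = y" using y hy by (intro parI)
    ultimately show ?case by (metis comp_apply funpow_Suc_right)
  qed
  then show ?thesis using horo by metis
qed

lemma merge: "\<exists>m n. (par ^^ m) x = (par ^^ n) y"
proof -
  obtain k n l m where "(par ^^ k) x = f n" "(par ^^ l) y = f m" using reaches_ray by metis
  then have "(par ^^ (m + k)) x = (par ^^ (n + l)) y"
    unfolding funpow_add comp_apply by (simp add: par_pow_ray add.commute)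
  then show ?thesis by blast
qed

lemma par_geodesic: "geodesic_ray E (\<lambda>n. (par ^^ n) x)"
  unfolding geodesic_ray_def
proof safe
  fix m n :: nat assume "m \<le> n"
  then have "(par ^^ n) x = (par ^^ (n - m)) ((par ^^ m) x)" by (metis comp_apply funpow_add le_add_diff_inverse2)
  then show "gd ((par ^^ m) x) ((par ^^ n) x) = n - m" by (simp add: gd_par_pow)
qed

lemma par_equiv: "(f, \<lambda>n. (par ^^ n) x) \<in> ray_equiv E"
proof -
  obtain k m where km: "(par ^^ k) x = f m" using reaches_ray by blast
  have eq: "(par ^^ (k + i)) x = f (m + i)" for i
    using km by (metis add.commute comp_apply funpow_add par_pow_ray)
  have f1: "range f - range (\<lambda>n. (par ^^ n) x) \<subseteq> f ` {..<m}"
  proof safe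
    fix n assume "f n \<notin> range (\<lambda>n. (par ^^ n) x)"
    then have "\<not> m \<le> n" using eq by (metis le_add_diff_inverse rangeI)
    then show "f n \<in> f ` {..<m}" by auto
  qed
  have f2: "range (\<lambda>n. (par ^^ n) x) - range f \<subseteq> (\<lambda>n. (par ^^ n) x) ` {..<k}"
  proof safe
    fix n assume "(par ^^ n) x \<notin> range f"
    then have "\<not> k \<le> n" using eq by (metis le_add_diff_inverse rangeI)
    then show "(par ^^ n) x \<in> (\<lambda>n. (par ^^ n) x) ` {..<k}" by auto
  qed
  have "finite (range f - range (\<lambda>n. (par ^^ n) x))" "finite (range (\<lambda>n. (par ^^ n) x) - range f)"
    by (rule finite_subset[OF f1] finite_subset[OF f2], simp)+
  then show ?thesis
    using ray par_geodesic by (simp add: ray_equiv_def)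
qed

text \<open>A geodesic ray that once moves from a vertex to one of its successors cannot turn back,
  so it moves to successors forever and its \<open>horo\<close> values grow without bound. But
  \<open>horo\<close> is at most \<open>0\<close> on \<open>f\<close>, hence infinitely many of its
  vertices would miss \<open>f\<close>. So every ray of the class follows predecessors, and its
  starting point determines it.\<close>

lemma equiv_unique:
  assumes "(f, g) \<in> ray_equiv E"
  shows "g = (\<lambda>n. (par ^^ n) (g 0))"
proof -
  have g: "geodesic_ray E g" and fin: "finite (range g - range f)" using assms by (auto simp: ray_equiv_def)
  have "tree_ray E g" by unfold_locales (rule g)
  note g_adj = tree_ray.ray_adj[OF this]
  have inj: "inj g" 
  proof (rule injI)
    fix i j assume "g i = g j"
    then have "gd (g (min i j)) (g (max i j)) = 0" by (auto simp: min_def max_def)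
    moreover have "gd (g (min i j)) (g (max i j)) = max i j - min i j" using g unfolding geodesic_ray_def by auto
    ultimately show "i = j" by (simp add: min_def max_def split: if_splits)
  qed
  have step: "par (g n) = g (Suc n)" for n
  proof (rule ccontr)
    assume n: "par (g n) \<noteq> g (Suc n)"
    have up: "par (g (Suc (n + i))) = g (n + i)" for i
    proof (induction i)
      case 0
      show ?case using n adj_iff[THEN iffD1, OF g_adj[of n]] by auto
    next
      case (Suc i)
      have "g (Suc (Suc (n + i))) \<noteq> g (n + i)" using inj by (auto dest: injD)
      then show ?case using Suc adj_iff[THEN iffD1, OF g_adj[of "Suc (n + i)"]] by auto
    qed
    have h: "horo (g (n + i)) = horo (g n) + int i" for i
    proof (induction i)
      case (Suc i)
      have "horo (g (n + i)) = horo (g (Suc (n + i))) - 1" by (metis up par(2))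
      with Suc show ?case by simp
    qed simp
    have "g (n + i) \<in> range g - range f" if "i > nat (- horo (g n))" for i
      using h[of i] that horo_ray by force
    then have "(\<lambda>i. g (n + i)) ` {nat (- horo (g n))<..} \<subseteq> range g - range f" by auto
    then have "finite ((\<lambda>i. g (n + i)) ` {nat (- horo (g n))<..})" using fin finite_subset by blast
    moreover have "inj_on (\<lambda>i. g (n + i)) {nat (- horo (g n))<..}" using inj by (auto intro!: inj_onI dest: injD)
    ultimately show False using finite_imageD infinite_Ioi by blast
  qed
  have "g n = (par ^^ n) (g 0)" for n by (induction n) (auto simp flip: step)
  then show ?thesis by (rule ext)
qed

end

section \<open>Confluents in terms of the predecessor map\<close>

locale end_tree = tree_ray "adj T" f for T :: "'a pointed_tree" and f :: "nat \<Rightarrow> 'a" +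
  fixes p :: nat
  assumes ref_end: "ref_end T = ray_equiv (adj T) `` {f}"
    and degree: "card {y. adj T x y} = p + 1"
    and p2: "2 \<le> p"
begin

abbreviation anc :: "nat \<Rightarrow> 'a \<Rightarrow> 'a" where "anc n x \<equiv> (par ^^ n) x"

lemma anc_anc: "anc m (anc n x) = anc (m + n) x"
  by (simp add: funpow_add)

lemma anc_par: "anc n (par x) = anc (Suc n) x"
  by (simp add: funpow_swap1)

lemma ray_to_end_eq: "ray_to_end T x = (\<lambda>n. anc n x)"
  unfolding ray_to_end_def
proof (rule the_equality)
  show "(\<lambda>n. anc n x) \<in> ref_end T \<and> anc 0 x = x"
    using par_equiv[of x] by (simp add: ref_end)
  fix g assume "g \<in> ref_end T \<and> g 0 = x"
  then have "(f, g) \<in> ray_equiv (adj T)" and g0: "g 0 = x" by (auto simp: ref_end)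
  from equiv_unique[OF this(1)] show "g = (\<lambda>n. anc n x)" unfolding g0 .
qed

text \<open>A local characterization of the confluent: it lies \<open>u\<close> steps above \<open>x\<close> and \<open>d\<close> steps above \<open>y\<close>.\<close>

definition meets :: "'a \<Rightarrow> 'a \<Rightarrow> nat \<Rightarrow> nat \<Rightarrow> bool" where
  "meets x y u d \<longleftrightarrow> anc u x = anc d y \<and> (0 < u \<longrightarrow> 0 < d \<longrightarrow> anc (u - 1) x \<noteq> anc (d - 1) y)"

lemma anc_eq_horo: "anc u x = anc d y \<Longrightarrow> horo x - int u = horo y - int d"
  using horo_par_pow[of u x] horo_par_pow[of d y] by simp

text \<open>By \<open>horo\<close>, any two pairs of exponents with a common ancestor differ by the
  same amount in both entries. From a smaller pair, further predecessors lead to the pair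
  \<open>u - 1\<close>, \<open>d - 1\<close>, which \<open>meets\<close> excludes.\<close>

lemma meets_least:
  assumes "meets x y u d" "anc u' x = anc d' y"
  shows "u \<le> u'"
proof (rule ccontr)
  assume "\<not> u \<le> u'"
  moreover have "anc u x = anc d y" using assms(1) by (simp add: meets_def)
  ultimately have "u' < u" "d' < d" "u - 1 - u' = d - 1 - d'"
    using anc_eq_horo[of u x d y] anc_eq_horo[OF assms(2)] by auto
  moreover have "anc (u - 1) x = anc (u - 1 - u') (anc u' x)"
    unfolding anc_anc using \<open>u' < u\<close> by simp
  moreover have "anc (d - 1) y = anc (d - 1 - d') (anc d' y)"
    unfolding anc_anc using \<open>d' < d\<close> by simp
  ultimately show False using assms by (simp add: meets_def)
qed

lemma meets_exists: "\<exists>u d. meets x y u d"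
proof -
  define u where "u = (LEAST u. \<exists>d. anc u x = anc d y)"
  obtain d where d: "anc u x = anc d y"
    unfolding u_def using LeastI_ex[of "\<lambda>u. \<exists>d. anc u x = anc d y"] merge[of x y] by blast
  have "anc (u - 1) x \<noteq> anc (d - 1) y" if "0 < u"
    using not_less_Least[of "u - 1" "\<lambda>u. \<exists>d. anc u x = anc d y"] that by (auto simp: u_def)
  with d have "meets x y u d" by (simp add: meets_def)
  then show ?thesis by blast
qed

lemma anc_range_inj: "range (\<lambda>n. anc n b) = range (\<lambda>n. anc n c) \<Longrightarrow> b = c"
proof -
  assume "range (\<lambda>n. anc n b) = range (\<lambda>n. anc n c)"
  then obtain i j where "anc i b = c" "anc j c = b"
    by (metis (no_types, lifting) funpow_0 rangeE rangeI)
  then have "anc (j + i) b = anc 0 b" by (simp flip: anc_anc)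
  then have "j + i = 0" using anc_eq_horo[of "j + i" b 0 b] by simp
  then show ?thesis using \<open>anc i b = c\<close> by simp
qed

lemma confluent_eq:
  assumes "meets x y u d"
  shows "confluent T x y = anc u x"
  unfolding confluent_def ray_to_end_eq
proof (rule the_equality)
  have eq: "anc u x = anc d y" using assms by (simp add: meets_def)
  show *: "range (\<lambda>n. anc n x) \<inter> range (\<lambda>n. anc n y) = range (\<lambda>n. anc n (anc u x))"
  proof (intro equalityI subsetI)
    fix z assume "z \<in> range (\<lambda>n. anc n x) \<inter> range (\<lambda>n. anc n y)"
    then obtain i j where "z = anc i x" "anc i x = anc j y" by auto
    moreover from this have "u \<le> i" using meets_least[OF assms] by simp
    ultimately have "z = anc (i - u) (anc u x)" by (simp add: anc_anc)
    then show "z \<in> range (\<lambda>n. anc n (anc u x))" by simp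
  next
    fix z assume "z \<in> range (\<lambda>n. anc n (anc u x))"
    then obtain n where "z = anc n (anc u x)" by auto
    then have "z = anc (n + u) x" "z = anc (n + d) y" using eq by (simp_all add: funpow_add)
    then show "z \<in> range (\<lambda>n. anc n x) \<inter> range (\<lambda>n. anc n y)" by blast
  qed
  show "b = anc u x" if "range (\<lambda>n. anc n x) \<inter> range (\<lambda>n. anc n y) = range (\<lambda>n. anc n b)" for b
    using that unfolding * by (rule anc_range_inj[symmetric])
qed

lemma up_down_eq:
  assumes "meets x y u d"
  shows "up T x y = u" "down T x y = d"
proof -
  have "anc u x = anc d y" using assms by (simp add: meets_def)
  then show "up T x y = u" "down T x y = d"
    unfolding up_def down_def confluent_eq[OF assms] using gd_par_pow[of x u] gd_par_pow[of y d] by simp_all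
qed

lemma meets: "meets x y (up T x y) (down T x y)"
  using meets_exists[of x y] up_down_eq by blast

lemma anc_up: "anc (up T x y) x = anc (down T x y) y"
  using meets[of x y] by (simp add: meets_def)

lemma horo_diff: "horo y - horo x = int (down T x y) - int (up T x y)"
  using anc_eq_horo[OF anc_up[of x y]] by simp

lemma busemann_eq: "busemann T x = horo x - horo (base T)"
  by (simp add: busemann_def horo_diff)

lemma busemann_diff: "busemann T y - busemann T x = int (down T x y) - int (up T x y)"
  using horo_diff[of y x] by (simp add: busemann_eq)

lemma predecessor_eq: "predecessor T x = par x"
  unfolding predecessor_def
proof (rule the_equality)
  show "adj T x (par x) \<and> busemann T (par x) = busemann T x - 1"
    using par[of x] by (simp add: busemann_eq)
  show "y = par x" if "adj T x y \<and> busemann T y = busemann T x - 1" for y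
    using parI[of x y] that by (simp add: busemann_eq)
qed

lemma busemann_par: "busemann T (par x) = busemann T x - 1"
  by (simp add: busemann_eq par)

lemma up_down_self [simp]: "up T x x = 0" "down T x x = 0"
  using up_down_eq[of x x 0 0] by (simp_all add: meets_def)

lemma up_down_0: "up T x y = 0 \<Longrightarrow> down T x y = 0 \<Longrightarrow> x = y"
  using anc_up[of x y] by simp

text \<open>If \<open>x\<close> is not an ancestor of \<open>y\<close>, its predecessor is one step
  closer to the same confluent. If it is, the predecessor is the new confluent, one level farther
  from \<open>y\<close>; truncated subtraction keeps \<open>up\<close> at \<open>0\<close>.\<close>

lemma up_down_par:
  "up T (par x) y = up T x y - 1"
  "down T (par x) y = (if up T x y = 0 then down T x y + 1 else down T x y)"
proof -
  have "meets (par x) y (up T x y - 1) (if up T x y = 0 then down T x y + 1 else down T x y)"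
  proof (cases "up T x y")
    case 0
    have "x = anc (down T x y) y" using anc_up[of x y] 0 by simp
    then have "par x = anc (down T x y + 1) y" by simp
    then show ?thesis using 0 by (simp add: meets_def)
  next
    case (Suc k)
    have "anc k (par x) = anc (Suc k) x" by (rule anc_par)
    moreover have "anc (k - 1) (par x) = anc k x" if "0 < k" using anc_par[of "k - 1" x] that by simp
    ultimately show ?thesis using meets[of x y] by (simp add: meets_def Suc del: funpow.simps(2))
  qed
  from up_down_eq[OF this] show
    "up T (par x) y = up T x y - 1"
    "down T (par x) y = (if up T x y = 0 then down T x y + 1 else down T x y)"
    by simp_all
qed

definition children :: "'a \<Rightarrow> 'a set" where "children x = {z. par z = x}"

lemma neighbours: "{y. adj T x y} = insert (par x) (children x)"
  by (auto simp: adj_iff children_def)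

lemma par_par_neq: "par (par x) \<noteq> x"
  using par(2)[of x] par(2)[of "par x"] by auto

lemma finite_children [simp]: "finite (children x)"
proof -
  have "finite {y. adj T x y}" using degree[of x] card.infinite by fastforce
  then show ?thesis by (simp add: neighbours)
qed

lemma card_children [simp]: "card (children x) = p"
  using degree[of x] par_par_neq[of x] finite_children[of x] unfolding neighbours children_def by simp

lemma ex_child: "\<exists>z. par z = x"
  using card_children[of x] p2 by (metis (mono_tags, lifting) card.empty children_def empty_Collect_eq not_numeral_le_zero)

lemma ex_descendant: "\<exists>z. anc n z = x"
proof (induction n arbitrary: x)
  case (Suc n)
  obtain y where "par y = x" using ex_child by blast
  moreover obtain z where "anc n z = y" using Suc.IH by blast
  ultimately show ?case by auto
qed simp

lemma up_down_child:
  assumes "par z = x" "0 < up T x y \<or> down T x y = 0"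
  shows "up T z y = up T x y + 1" "down T z y = down T x y"
proof -
  have "meets z y (up T x y + 1) (down T x y)"
  proof (cases "up T x y")
    case (Suc k)
    have "anc k x = anc (Suc k) z" using assms(1) anc_par by blast
    moreover have "anc (Suc k) x = anc (Suc (Suc k)) z" using assms(1) anc_par by blast
    ultimately show ?thesis using meets[of x y] by (simp add: meets_def Suc del: funpow.simps(2))
  qed (use assms anc_up[of x y] in \<open>simp add: meets_def\<close>)
  then show "up T z y = up T x y + 1" "down T z y = down T x y"
    by (rule up_down_eq)+
qed

lemma up_down_child_towards:
  assumes "up T x y = 0" "0 < down T x y"
  shows "par (anc (down T x y - 1) y) = x"
    and "up T (anc (down T x y - 1) y) y = 0" "down T (anc (down T x y - 1) y) y = down T x y - 1"
    and "par z = x \<Longrightarrow> z \<noteq> anc (down T x y - 1) y \<Longrightarrow> up T z y = 1"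
    and "par z = x \<Longrightarrow> z \<noteq> anc (down T x y - 1) y \<Longrightarrow> down T z y = down T x y"
proof -
  have x: "x = anc (down T x y) y" using anc_up[of x y] assms by simp
  then show "par (anc (down T x y - 1) y) = x"
    using assms by (metis Suc_diff_1 comp_apply funpow.simps(2))
  have "meets (anc (down T x y - 1) y) y 0 (down T x y - 1)" by (simp add: meets_def)
  from up_down_eq[OF this]
  show "up T (anc (down T x y - 1) y) y = 0" "down T (anc (down T x y - 1) y) y = down T x y - 1" by simp_all
  have "meets z y 1 (down T x y)" if "par z = x" "z \<noteq> anc (down T x y - 1) y"
    using that x by (simp add: meets_def)
  then show "par z = x \<Longrightarrow> z \<noteq> anc (down T x y - 1) y \<Longrightarrow> up T z y = 1"
    "par z = x \<Longrightarrow> z \<noteq> anc (down T x y - 1) y \<Longrightarrow> down T z y = down T x y"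
    using up_down_eq by blast+
qed

text \<open>All successors of \<open>x\<close> are in the same position relative to
  \<open>y\<close>, unless \<open>x\<close> is a proper ancestor of \<open>y\<close>. Then one of
  them lies on the way to \<open>y\<close>, and the other \<open>p - 1\<close> have confluent
  \<open>x\<close> with \<open>y\<close>.\<close>

lemma sum_children:
  fixes g :: "nat \<Rightarrow> nat \<Rightarrow> real"
  shows "(\<Sum>z\<in>children x. g (up T z y) (down T z y)) =
    (if up T x y = 0 \<and> 0 < down T x y then g 0 (down T x y - 1) + (real p - 1) * g 1 (down T x y)
     else real p * g (up T x y + 1) (down T x y))"
proof (cases "up T x y = 0 \<and> 0 < down T x y")
  case True
  define w where "w = anc (down T x y - 1) y"
  note t = up_down_child_towards[OF conjunct1[OF True] conjunct2[OF True], folded w_def]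
  have w: "w \<in> children x" using t(1) by (simp add: children_def)
  have "(\<Sum>z\<in>children x. g (up T z y) (down T z y)) =
      g (up T w y) (down T w y) + (\<Sum>z\<in>children x - {w}. g (up T z y) (down T z y))"
    by (rule sum.remove[OF finite_children w])
  also have "(\<Sum>z\<in>children x - {w}. g (up T z y) (down T z y)) = (\<Sum>z\<in>children x - {w}. g 1 (down T x y))"
  proof (rule sum.cong[OF refl])
    fix z assume "z \<in> children x - {w}"
    then have "par z = x" "z \<noteq> w" by (simp_all add: children_def)
    from t(4)[OF this] t(5)[OF this] show "g (up T z y) (down T z y) = g 1 (down T x y)" by simp
  qed
  also have "\<dots> = (real p - 1) * g 1 (down T x y)"
    using w p2 by (simp add: card_Diff_singleton of_nat_diff)
  finally show ?thesis using t(2,3) True by simp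
next
  case False
  have "(\<Sum>z\<in>children x. g (up T z y) (down T z y)) = (\<Sum>z\<in>children x. g (up T x y + 1) (down T x y))"
  proof (rule sum.cong[OF refl])
    fix z assume "z \<in> children x"
    then have "par z = x" by (simp add: children_def)
    from up_down_child[OF this, of y] False
    show "g (up T z y) (down T z y) = g (up T x y + 1) (down T x y)" by simp
  qed
  then show ?thesis unfolding if_not_P[OF False] by simp
qed

lemma finite_descendants: "finite {x. anc n x = b}"
proof (induction n arbitrary: b)
  case (Suc n)
  have "{x. anc (Suc n) x = b} = (\<Union>c\<in>children b. {x. anc n x = c})"
    by (auto simp: children_def)
  then show ?case using Suc by simp
qed simp

text \<open>Turns decay in \<open>up\<close> and \<open>down\<close> into decay at infinity: only
  finitely many vertices lie in such a box.\<close>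

lemma finite_bounded: "finite {x. up T x y \<le> k \<and> down T x y \<le> k}"
proof (rule finite_subset)
  show "{x. up T x y \<le> k \<and> down T x y \<le> k} \<subseteq> (\<Union>u\<in>{..k}. \<Union>d\<in>{..k}. {x. anc u x = anc d y})"
    using anc_up by auto
  show "finite (\<Union>u\<in>{..k}. \<Union>d\<in>{..k}. {x. anc u x = anc d y})"
    by (intro finite_UN_I finite_descendants) auto
qed

end

lemma pointed_homogeneous_tree_end_tree:
  assumes "pointed_homogeneous_tree p T"
  obtains f where "end_tree T f p"
proof -
  from assms obtain f where "geodesic_ray (adj T) f" "ref_end T = ray_equiv (adj T) `` {f}"
    by (auto simp: pointed_homogeneous_tree_def ends_def quotient_def)
  then have "end_tree T f p"
    using assms by unfold_locales (auto simp: pointed_homogeneous_tree_def homogeneous_tree_def)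
  then show ?thesis by (rule that)
qed

subsection \<open>Green kernels of Markov chains with finite range\<close>

locale finite_range_chain =
  fixes S :: "'s set" and P :: "'s \<Rightarrow> 's \<Rightarrow> real" and Nb :: "'s \<Rightarrow> 's set"
  assumes Nb_fin: "x \<in> S \<Longrightarrow> finite (Nb x)"
    and Nb_sub: "x \<in> S \<Longrightarrow> Nb x \<subseteq> S"
    and P_zero: "x \<in> S \<Longrightarrow> z \<in> S \<Longrightarrow> z \<notin> Nb x \<Longrightarrow> P x z = 0"
    and P_nonneg: "x \<in> S \<Longrightarrow> z \<in> Nb x \<Longrightarrow> 0 \<le> P x z"
    and P_sum: "x \<in> S \<Longrightarrow> (\<Sum>z\<in>Nb x. P x z) = 1"
begin

text \<open>This is \<open>P ^ n\<close> applied to \<open>f\<close>, written with the finite sums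
  over \<open>Nb\<close>, so that questions of summability do not arise.\<close>

primrec expect :: "nat \<Rightarrow> ('s \<Rightarrow> real) \<Rightarrow> 's \<Rightarrow> real" where
  "expect 0 f x = f x"
| "expect (Suc n) f x = (\<Sum>z\<in>Nb x. P x z * expect n f z)"

lemma nstep_eq: "x \<in> S \<Longrightarrow> nstep S P n x y = expect n (\<lambda>z. if z = y then 1 else 0) x"
proof (induction n arbitrary: x)
  case (Suc n)
  have "nstep S P (Suc n) x y = (\<Sum>\<^sub>\<infinity>z\<in>Nb x. P x z * nstep S P n z y)"
    unfolding nstep.simps
    by (rule infsum_cong_neutral) (use Suc.prems P_zero Nb_sub in auto)
  also have "\<dots> = (\<Sum>z\<in>Nb x. P x z * nstep S P n z y)"
    using Suc.prems by (intro infsum_finite Nb_fin)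
  also have "\<dots> = expect (Suc n) (\<lambda>z. if z = y then 1 else 0) x"
    unfolding expect.simps using Suc.IH Nb_sub[OF Suc.prems] by (intro sum.cong refl) (simp add: subset_iff)
  finally show ?case .
qed simp

lemma expect_mono:
  assumes "\<And>z. z \<in> S \<Longrightarrow> f z \<le> g z" "x \<in> S"
  shows "expect n f x \<le> expect n g x"
  using \<open>x \<in> S\<close>
proof (induction n arbitrary: x)
  case (Suc n)
  show ?case unfolding expect.simps
    using Suc.IH Nb_sub[OF Suc.prems] P_nonneg[OF Suc.prems] by (intro sum_mono mult_left_mono) auto
qed (use assms in simp)

lemma expect_cong: "(\<And>z. z \<in> S \<Longrightarrow> f z = g z) \<Longrightarrow> x \<in> S \<Longrightarrow> expect n f x = expect n g x"
  by (intro antisym expect_mono) simp_all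

lemma expect_const: "x \<in> S \<Longrightarrow> expect n (\<lambda>_. c) x = c"
proof (induction n arbitrary: x)
  case (Suc n)
  have "expect (Suc n) (\<lambda>_. c) x = (\<Sum>z\<in>Nb x. P x z * c)"
    unfolding expect.simps using Suc.IH Nb_sub[OF Suc.prems] by (intro sum.cong refl) (simp add: subset_iff)
  then show ?case using P_sum[OF Suc.prems] by (simp flip: sum_distrib_right)
qed simp

lemma expect_add: "expect n (\<lambda>z. f z + g z) x = expect n f x + expect n g x"
  by (induction n arbitrary: x) (simp_all add: distrib_left sum.distrib)

lemma expect_cmult: "expect n (\<lambda>z. c * f z) x = c * expect n f x"
  by (induction n arbitrary: x) (simp_all add: sum_distrib_left mult.left_commute)

lemma expect_sum: "finite K \<Longrightarrow> expect n (\<lambda>z. \<Sum>k\<in>K. f k z) x = (\<Sum>k\<in>K. expect n (f k) x)"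
proof (induction K rule: finite_induct)
  case empty
  have "expect n (\<lambda>z. 0) x = 0" by (induction n arbitrary: x) simp_all
  then show ?case by simp
next
  case (insert k K)
  then show ?case by (simp add: expect_add)
qed

text \<open>The recursion splits off the first step; here the last step is split off, as is needed
  to insert the equation for \<open>F\<close> behind \<open>P ^ n\<close>.\<close>

lemma expect_Suc': "x \<in> S \<Longrightarrow> expect (Suc n) f x = expect n (\<lambda>z. \<Sum>w\<in>Nb z. P z w * f w) x"
proof (induction n arbitrary: x)
  case (Suc n)
  have "P x z * expect (Suc n) f z = P x z * expect n (\<lambda>z. \<Sum>w\<in>Nb z. P z w * f w) z" if "z \<in> Nb x" for z
    using Suc.IH[of z] Nb_sub[OF Suc.prems] that by auto
  then show ?case
    by (simp only: expect.simps(2)[of "Suc n" f] expect.simps(2)[of n "\<lambda>z. \<Sum>w\<in>Nb z. P z w * f w"] cong: sum.cong)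
qed simp

lemma nstep_nonneg: "x \<in> S \<Longrightarrow> 0 \<le> nstep S P n x y"
  using expect_mono[of "\<lambda>_. 0" "\<lambda>z. if z = y then 1 else 0" x n] by (simp add: nstep_eq expect_const)

text \<open>The equation \<open>F = delta + t P F\<close>, iterated \<open>n\<close> times. What
  remains in each application is to show that the remainder vanishes.\<close>

lemma partial_sums:
  assumes F: "\<And>x. x \<in> S \<Longrightarrow> F x = (if x = y then 1 else 0) + t * (\<Sum>z\<in>Nb x. P x z * F z)"
    and "x \<in> S"
  shows "F x = (\<Sum>k<n. t ^ k * nstep S P k x y) + t ^ n * expect n F x"
proof (induction n)
  case (Suc n)
  have "expect n F x = expect n (\<lambda>x. (if x = y then 1 else 0) + t * (\<Sum>z\<in>Nb x. P x z * F z)) x"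
    by (rule expect_cong[OF F \<open>x \<in> S\<close>])
  also have "\<dots> = nstep S P n x y + t * expect (Suc n) F x"
    by (simp only: expect_add expect_cmult nstep_eq[OF \<open>x \<in> S\<close>] expect_Suc'[OF \<open>x \<in> S\<close>])
  finally have "t ^ n * expect n F x = t ^ n * nstep S P n x y + t ^ Suc n * expect (Suc n) F x"
    by (simp only: distrib_left power_Suc2 mult.assoc)
  then show ?case using Suc.IH by (simp only: sum.lessThan_Suc)
qed simp

text \<open>For \<open>t < 1\<close> boundedness of \<open>F\<close> is enough to remove the
  remainder, as \<open>P ^ n\<close> preserves bounds.\<close>

lemma discounted_sums:
  assumes F: "\<And>x. x \<in> S \<Longrightarrow> F x = (if x = y then 1 else 0) + t * (\<Sum>z\<in>Nb x. P x z * F z)"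
    and bd: "\<And>x. x \<in> S \<Longrightarrow> \<bar>F x\<bar> \<le> C" and t: "0 \<le> t" "t < 1" and "x \<in> S"
  shows "(\<lambda>k. t ^ k * nstep S P k x y) sums F x"
proof -
  have bound: "\<bar>expect n F x\<bar> \<le> C" for n
  proof (rule abs_leI)
    show "expect n F x \<le> C"
      using expect_mono[of F "\<lambda>_. C", OF abs_le_D1[OF bd] \<open>x \<in> S\<close>, of n] by (simp only: expect_const[OF \<open>x \<in> S\<close>])
    have "- C \<le> F z" if "z \<in> S" for z using abs_le_D2[OF bd[OF that]] by linarith
    then have "expect n (\<lambda>_. - C) x \<le> expect n F x" using \<open>x \<in> S\<close> by (rule expect_mono)
    then show "- expect n F x \<le> C" unfolding expect_const[OF \<open>x \<in> S\<close>] by linarith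
  qed
  have "(\<lambda>n. t ^ n * expect n F x) \<longlonglongrightarrow> 0"
  proof (rule Lim_null_comparison)
    show "\<forall>\<^sub>F n in sequentially. norm (t ^ n * expect n F x) \<le> t ^ n * C"
      using bound t by (intro always_eventually allI) (simp add: abs_mult mult_left_mono)
    show "(\<lambda>n. t ^ n * C) \<longlonglongrightarrow> 0"
      using t by (intro tendsto_mult_left_zero LIMSEQ_realpow_zero)
  qed
  then have "(\<lambda>n. F x - t ^ n * expect n F x) \<longlonglongrightarrow> F x - 0" by (intro tendsto_diff tendsto_const)
  moreover have "F x - t ^ n * expect n F x = (\<Sum>k<n. t ^ k * nstep S P k x y)" for n
    using partial_sums[OF F \<open>x \<in> S\<close>, of n] by linarith
  ultimately show ?thesis by (simp add: sums_def)
qed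

text \<open>Nonnegative terms make this exchange of limits safe. Each finite partial sum is a limit
  of discounted ones, hence at most \<open>L\<close>; conversely each \<open>F j\<close> is at most
  the full series.\<close>

lemma green_from_discounted:
  assumes F: "\<And>j. (\<lambda>k. t j ^ k * nstep S P k x y) sums F j"
    and t: "\<And>j. 0 \<le> t j" "\<And>j. t j \<le> 1" "t \<longlonglongrightarrow> 1" and lim: "F \<longlonglongrightarrow> L" and "x \<in> S"
  shows "green S P x y = ennreal L"
proof -
  note nn = nstep_nonneg[OF \<open>x \<in> S\<close>]
  have term_nn: "0 \<le> t j ^ k * nstep S P k x y" for j k using nn t by simp
  have part: "(\<Sum>k<n. nstep S P k x y) \<le> L" for n
  proof (rule LIMSEQ_le)
    show "(\<lambda>j. \<Sum>k<n. t j ^ k * nstep S P k x y) \<longlonglongrightarrow> (\<Sum>k<n. nstep S P k x y)"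
    proof -
      have "(\<lambda>j. \<Sum>k<n. t j ^ k * nstep S P k x y) \<longlonglongrightarrow> (\<Sum>k<n. 1 ^ k * nstep S P k x y)"
        by (intro tendsto_intros t(3))
      then show ?thesis by simp
    qed
    show "\<exists>N. \<forall>j\<ge>N. (\<Sum>k<n. t j ^ k * nstep S P k x y) \<le> F j"
    proof (intro exI allI impI)
      fix j
      show "(\<Sum>k<n. t j ^ k * nstep S P k x y) \<le> F j"
        unfolding sums_unique[OF F[of j]]
        by (rule sum_le_suminf[OF sums_summable[OF F]]) (use term_nn in auto)
    qed
  qed (rule lim)
  have s: "summable (\<lambda>k. nstep S P k x y)"
    by (rule summableI_nonneg_bounded[OF nn part])
  have "F j \<le> (\<Sum>k. nstep S P k x y)" for j
    unfolding sums_unique[OF F]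
    by (rule suminf_le[OF _ sums_summable[OF F] s]) (use nn t in \<open>simp add: mult_left_le_one_le power_le_one\<close>)
  then have "L \<le> (\<Sum>k. nstep S P k x y)" using lim by (intro LIMSEQ_le_const2[of F]) auto
  moreover have "(\<Sum>k. nstep S P k x y) \<le> L" by (rule suminf_le_const[OF s part])
  ultimately show ?thesis using s nn by (simp add: green_def suminf_ennreal2)
qed

text \<open>The mass that \<open>P\<^sup>n\<close> puts on a finite set tends to \<open>0\<close> since all Green kernels are finite, so
  only the part of \<open>F\<close> near infinity survives in the remainder \<open>P\<^sup>n F\<close>.\<close>

lemma green_eqI:
  assumes F: "\<And>x y. x \<in> S \<Longrightarrow> y \<in> S \<Longrightarrow> F x y = (if x = y then 1 else 0) + (\<Sum>z\<in>Nb x. P x z * F z y)"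
    and bd: "\<And>x y. x \<in> S \<Longrightarrow> y \<in> S \<Longrightarrow> 0 \<le> F x y \<and> F x y \<le> C"
    and fin: "\<And>y e. y \<in> S \<Longrightarrow> 0 < e \<Longrightarrow> finite {x \<in> S. e < F x y}"
    and xy: "x \<in> S" "y \<in> S"
  shows "green S P x y = ennreal (F x y)"
proof -
  have sol: "F x y = (\<Sum>k<n. nstep S P k x y) + expect n (\<lambda>z. F z y) x" if "x \<in> S" "y \<in> S" for x y n
  proof -
    have "F x y = (\<Sum>k<n. 1 ^ k * nstep S P k x y) + 1 ^ n * expect n (\<lambda>z. F z y) x"
      by (rule partial_sums[OF _ that(1)]) (simp only: F[OF _ that(2), symmetric] mult_1)
    then show ?thesis by simp
  qed
  have exp_nn: "0 \<le> expect n (\<lambda>z. F z y) x" if "x \<in> S" "y \<in> S" for x y n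
    using expect_mono[of "\<lambda>_. 0" "\<lambda>z. F z y", OF conjunct1[OF bd[OF _ that(2)]] that(1), of n]
    by (simp only: expect_const[OF that(1)])
  have s: "summable (\<lambda>k. nstep S P k x y)" if "x \<in> S" "y \<in> S" for x y
  proof (rule summableI_nonneg_bounded[of _ "F x y"])
    show "(\<Sum>k<n. nstep S P k x y) \<le> F x y" for n using sol[OF that, of n] exp_nn[OF that, of n] by linarith
  qed (rule nstep_nonneg[OF that(1)])
  have "(\<lambda>n. expect n (\<lambda>z. F z y) x) \<longlonglongrightarrow> 0"
  proof (rule LIMSEQ_I)
    fix e :: real assume e: "0 < e"
    define K where "K = {x \<in> S. e / 2 < F x y}"
    have K: "finite K" "K \<subseteq> S" using fin[OF xy(2), of "e / 2"] e by (auto simp: K_def)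
    have ub: "expect n (\<lambda>z. F z y) x \<le> C * (\<Sum>k\<in>K. nstep S P n x k) + e / 2" for n
    proof -
      have "expect n (\<lambda>z. F z y) x \<le> expect n (\<lambda>z. C * (\<Sum>k\<in>K. if z = k then 1 else 0) + e / 2) x"
      proof (rule expect_mono[OF _ xy(1)])
        fix z assume z: "z \<in> S"
        show "F z y \<le> C * (\<Sum>k\<in>K. if z = k then 1 else 0) + e / 2"
        proof (cases "z \<in> K")
          case True
          then have one: "(\<Sum>k\<in>K. if z = k then 1 else 0) = (1::real)" using K(1) by simp
          show ?thesis unfolding one using conjunct2[OF bd[OF z xy(2)]] e by simp
        next
          case False
          then have "F z y \<le> e / 2" using z by (simp add: K_def)
          moreover have "(\<Sum>k\<in>K. if z = k then 1 else 0) = (0::real)" using False K(1) by simp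
          ultimately show ?thesis by (simp only:)
        qed
      qed
      also have "\<dots> = C * (\<Sum>k\<in>K. expect n (\<lambda>z. if z = k then 1 else 0) x) + e / 2"
        by (simp only: expect_add expect_cmult expect_const[OF xy(1)] expect_sum[OF K(1)])
      finally show ?thesis by (simp add: nstep_eq[OF xy(1)])
    qed
    have "(\<lambda>n. C * (\<Sum>k\<in>K. nstep S P n x k) + e / 2) \<longlonglongrightarrow> C * (\<Sum>k\<in>K. 0) + e / 2"
      using K(2) s[OF xy(1)] by (intro tendsto_intros summable_LIMSEQ_zero) auto
    then have "\<forall>\<^sub>F n in sequentially. C * (\<Sum>k\<in>K. nstep S P n x k) + e / 2 < e"
      by (rule order_tendstoD(2)) (use e in simp)
    then obtain N where N: "\<And>n. n \<ge> N \<Longrightarrow> C * (\<Sum>k\<in>K. nstep S P n x k) + e / 2 < e"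
      by (auto simp: eventually_sequentially)
    have "norm (expect n (\<lambda>z. F z y) x - 0) < e" if "n \<ge> N" for n
      using order_le_less_trans[OF ub N[OF that]] exp_nn[OF xy, of n] by simp
    then show "\<exists>N. \<forall>n\<ge>N. norm (expect n (\<lambda>z. F z y) x - 0) < e" by blast
  qed
  then have "(\<lambda>n. F x y - expect n (\<lambda>z. F z y) x) \<longlonglongrightarrow> F x y - 0" by (intro tendsto_diff tendsto_const)
  moreover have "F x y - expect n (\<lambda>z. F z y) x = (\<Sum>k<n. nstep S P k x y)" for n
    using sol[OF xy, of n] by linarith
  ultimately have "(\<lambda>k. nstep S P k x y) sums F x y" by (simp add: sums_def)
  then show ?thesis
    using nstep_nonneg[OF xy(1)] by (simp add: green_def suminf_ennreal2 sums_iff)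
qed

end

subsection \<open>Walks on trees and on the integers\<close>

text \<open>The discounted Green function of a nearest neighbour walk on a tree (on the integers, if \<open>p = 1\<close>)
  is a multiple of \<open>\<phi>\<^sup>u \<theta>\<^sup>d\<close>, with \<open>\<phi>\<close> and \<open>\<theta>\<close> the generating functions of the first passage to the predecessor
  and from it. Parametrizing the discount \<open>t\<close> by \<open>\<phi>\<close> avoids square roots.\<close>

locale first_passage =
  fixes a p phi :: real
  assumes a: "0 < a" "a < 1" and p: "1 \<le> p" and phi: "0 < phi" "phi < 1" "a * phi < 1 - a"
begin

text \<open>The equation \<open>phi = t * ((1 - a) + a * phi\<^sup>2)\<close> of the first passage
  to the predecessor, solved for the discount.\<close>

definition "t = phi / ((1 - a) + a * phi\<^sup>2)"
text \<open>Reversibility gives this value: the reversing measure is multiplied by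
  \<open>a / (p * (1 - a))\<close> from a vertex to its successor, and the Green function is
  constant on the diagonal.\<close>

definition "theta = a * phi / (p * (1 - a))"
definition "Co = ((1 - a) + a * phi\<^sup>2) / ((1 - a) - a * phi\<^sup>2 / p)"

lemma denom_pos: "0 < (1 - a) + a * phi\<^sup>2"
  using a by (simp add: add_pos_nonneg)

lemma t_eq: "t * ((1 - a) + a * phi\<^sup>2) = phi"
  using denom_pos by (simp add: t_def)

lemma t: "0 \<le> t" "t < 1"
proof -
  show "0 \<le> t" using denom_pos phi by (simp add: t_def)
  \<comment> \<open>For \<open>t = 1\<close> the passage equation has the roots \<open>1\<close> and
    \<open>(1 - a) / a\<close>; the assumptions place \<open>phi\<close> below both of them.\<close>
  have "0 < (1 - phi) * ((1 - a) - a * phi)" using phi by simp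
  also have "\<dots> = (1 - a) + a * phi\<^sup>2 - phi" by (simp add: algebra_simps power2_eq_square)
  finally show "t < 1" using denom_pos by (simp add: t_def)
qed

lemma theta: "0 \<le> theta" "theta \<le> 1"
proof -
  show "0 \<le> theta" using a p phi by (simp add: theta_def)
  have "a * phi \<le> 1 * (1 - a)" using phi by simp
  also have "\<dots> \<le> p * (1 - a)" using a p by (intro mult_right_mono) auto
  finally show "theta \<le> 1" using a p by (simp add: theta_def)
qed

lemma theta_eq: "p * (1 - a) * theta = a * phi"
  using a p by (simp add: theta_def)

text \<open>First-step decomposition of the passage from a vertex to a given successor: directly, by
  way of one of the \<open>p - 1\<close> other successors and back, or by way of the predecessor,
  from which two passages are needed.\<close>

lemma theta_passage: "theta = t * (a / p + a * (p - 1) / p * (phi * theta) + (1 - a) * theta\<^sup>2)"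
proof -
  have "p * (a / p + a * (p - 1) / p * (phi * theta) + (1 - a) * theta\<^sup>2) * ((1 - a)) 
     = a * (1 - a) + a * phi * (p * (1 - a) * theta - (1 - a) * theta) + (p * (1 - a) * theta) * ((1 - a) * theta)"
    using p by (simp add: field_simps power2_eq_square)
  also have "\<dots> = a * ((1 - a) + a * phi\<^sup>2)"
    unfolding theta_eq by (simp add: algebra_simps power2_eq_square)
  finally have "t * (p * (a / p + a * (p - 1) / p * (phi * theta) + (1 - a) * theta\<^sup>2) * (1 - a)) = a * (t * ((1 - a) + a * phi\<^sup>2))"
    by simp
  also have "\<dots> = p * (1 - a) * theta" unfolding t_eq theta_eq ..
  finally have "(p * (1 - a)) * (t * (a / p + a * (p - 1) / p * (phi * theta) + (1 - a) * theta\<^sup>2)) = (p * (1 - a)) * theta"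
    by (simp add: mult_ac)
  then show ?thesis using a p by simp
qed

lemma Co_denom: "0 < (1 - a) - a * phi\<^sup>2 / p"
proof -
  have "a * phi\<^sup>2 / p \<le> a * phi\<^sup>2" using a p mult_right_mono[OF p, of "phi\<^sup>2"] by (simp add: field_simps)
  also have "\<dots> = a * phi * phi" by (simp add: power2_eq_square)
  also have "\<dots> \<le> a * phi * 1" using a phi by (intro mult_left_mono) auto
  finally show ?thesis using phi by simp
qed

lemma Co_pos: "0 < Co"
  using denom_pos Co_denom by (simp add: Co_def)

lemma Co_eq: "Co = 1 + t * (a * phi + (1 - a) * theta) * Co"
proof -
  define D where "D = (1 - a) + a * phi\<^sup>2"
  define E where "E = (1 - a) - a * phi\<^sup>2 / p"
  have DE: "D \<noteq> 0" "E \<noteq> 0" using denom_pos Co_denom by (simp_all add: D_def E_def)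
  have "(1 - a) * theta = a * phi / p" using a p by (simp add: theta_def)
  then have "t * (a * phi + (1 - a) * theta) = (a * phi\<^sup>2 + a * phi\<^sup>2 / p) / D"
    by (simp add: t_def D_def power2_eq_square distrib_left add_divide_distrib mult_ac)
  also have "a * phi\<^sup>2 + a * phi\<^sup>2 / p = D - E" by (simp add: D_def E_def)
  finally have w: "t * (a * phi + (1 - a) * theta) = (D - E) / D" .
  have "Co = D / E" by (simp add: Co_def D_def E_def)
  then show ?thesis unfolding w using DE by (simp add: field_simps)
qed

text \<open>\<open>S\<close> is the mean of \<open>phi ^ u * theta ^ d\<close> over the next step.
  Keeping it abstract lets trees and integers share the proof; for \<open>p = 1\<close> the
  coefficient of the other successors is \<open>0\<close>.\<close>

lemma passage_equation:
  assumes "0 < u \<Longrightarrow> S = a * (phi ^ (u + 1) * theta ^ d) + (1 - a) * (phi ^ (u - 1) * theta ^ d)"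
    and "u = 0 \<Longrightarrow> 0 < d \<Longrightarrow> S = a / p * theta ^ (d - 1) + a * (p - 1) / p * (phi * theta ^ d) + (1 - a) * theta ^ (d + 1)"
    and "u = 0 \<Longrightarrow> d = 0 \<Longrightarrow> S = a * phi + (1 - a) * theta"
  shows "Co * (phi ^ u * theta ^ d) = (if u = 0 \<and> d = 0 then 1 else 0) + t * (Co * S)"
proof -
  consider k where "u = Suc k" | k where "u = 0" "d = Suc k" | "u = 0" "d = 0" by (metis not0_implies_Suc)
  then show ?thesis
  proof cases
    case 1
    have "S = ((1 - a) + a * phi\<^sup>2) * (phi ^ k * theta ^ d)"
      using assms(1) 1 by (simp add: algebra_simps power2_eq_square)
    then have "t * S = phi * (phi ^ k * theta ^ d)" by (simp flip: mult.assoc add: t_eq)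
    then show ?thesis using 1 by simp
  next
    case 2
    have "S = (a / p + a * (p - 1) / p * (phi * theta) + (1 - a) * theta\<^sup>2) * theta ^ k"
      using assms(2) 2 by (simp add: algebra_simps power2_eq_square)
    then have "t * S = theta * theta ^ k" using theta_passage by (simp flip: mult.assoc)
    then show ?thesis using 2 by simp
  next
    case 3
    then show ?thesis using assms(3) Co_eq by (simp add: mult_ac)
  qed
qed

lemma passage_bounded: "\<bar>Co * (phi ^ u * theta ^ d)\<bar> \<le> Co"
proof -
  have "phi ^ u * theta ^ d \<le> 1 * 1" using phi theta by (intro mult_mono power_le_one) auto
  moreover have "0 \<le> phi ^ u * theta ^ d" using phi theta by simp
  ultimately show ?thesis using Co_pos by (simp add: abs_mult mult_left_le)
qed

end

text \<open>\<open>max\<close> and \<open>min\<close> cover both directions of the drift with one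
  formula. The last assumption is transience: it keeps the denominator of the limit
  positive.\<close>

lemma first_passage_limit:
  assumes "0 < a" "a < 1" "1 \<le> p" "p > 1 \<or> a \<noteq> 1 / 2"
  obtains phi where "\<And>j. first_passage a p (phi j)"
    and "(\<lambda>j. first_passage.t a (phi j)) \<longlonglongrightarrow> 1"
    and "(\<lambda>j. first_passage.Co a p (phi j)) \<longlonglongrightarrow> p / (p * max a (1 - a) - min a (1 - a))"
proof -
  \<comment> \<open>The probability of ever reaching the predecessor, that is, the smaller root of
    the passage equation for \<open>t = 1\<close>. The sequence \<open>psi\<close> approaches it
    strictly from below.\<close>
  define m where "m = min 1 ((1 - a) / a)"
  define psi where "psi j = m * (real (Suc j) / real (Suc (Suc j)))" for j
  have m: "0 < m" "m \<le> 1" "a * m \<le> 1 - a" using assms by (auto simp: m_def min_def field_simps)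
  have lim: "psi \<longlonglongrightarrow> m"
  proof -
    have "psi \<longlonglongrightarrow> m * 1"
      unfolding psi_def[abs_def] by (intro tendsto_mult tendsto_const LIMSEQ_Suc[OF LIMSEQ_n_over_Suc_n])
    then show ?thesis by simp
  qed
  have psi: "0 < psi j" "psi j < m" for j
    using m by (auto simp: psi_def divide_less_eq)
  have fp: "first_passage a p (psi j)" for j
  proof
    show "a * psi j < 1 - a"
      using mult_strict_left_mono[OF psi(2) assms(1), of j] m by linarith
  qed (use assms psi[of j] m in auto)
  have am: "(1 - a) + a * m\<^sup>2 = m"
    using assms by (auto simp: m_def min_def field_simps power2_eq_square)
  have mp: "((1 - a) - a * m\<^sup>2 / p) * p = m * (p * max a (1 - a) - min a (1 - a))"
  proof (cases "a \<le> 1 / 2")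
    case True
    then have "m = 1" "max a (1 - a) = 1 - a" "min a (1 - a) = a" using assms by (auto simp: m_def min_def max_def field_simps)
    then show ?thesis using assms by (simp add: field_simps)
  next
    case False
    then have *: "m = (1 - a) / a" "max a (1 - a) = a" "min a (1 - a) = 1 - a" using assms by (auto simp: m_def min_def max_def field_simps)
    then have am: "a * m = 1 - a" using assms by simp
    have "((1 - a) - a * m\<^sup>2 / p) * p = (1 - a) * p - (a * m) * m" using assms by (simp add: field_simps power2_eq_square)
    also have "\<dots> = (a * m) * p - (a * m) * m" by (simp add: am)
    also have "\<dots> = m * (p * a - a * m)" by (simp add: algebra_simps)
    finally show ?thesis unfolding *(2,3) am .
  qed
  have "min a (1 - a) < p * max a (1 - a)"
  proof -
    have "max a (1 - a) \<le> p * max a (1 - a)" using mult_right_mono[OF assms(3), of "max a (1 - a)"] assms by (simp add: le_max_iff_disj)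
    moreover have "max a (1 - a) < p * max a (1 - a)" if "p > 1"
      using mult_strict_right_mono[OF that, of "max a (1 - a)"] assms by (simp add: less_max_iff_disj)
    moreover have "min a (1 - a) < max a (1 - a)" if "a \<noteq> 1 / 2" using that by (auto simp: min_def max_def)
    moreover have "min a (1 - a) \<le> max a (1 - a)" by simp
    ultimately show ?thesis using assms(4) by linarith
  qed
  then have den: "0 < m * (p * max a (1 - a) - min a (1 - a))" using m by simp
  then have nz: "(1 - a) - a * m\<^sup>2 / p \<noteq> 0" using mp by auto
  have "(\<lambda>j. first_passage.t a (psi j)) \<longlonglongrightarrow> m / ((1 - a) + a * m\<^sup>2)"
    unfolding first_passage.t_def[OF fp] using am m by (intro tendsto_intros lim) auto
  then have 1: "(\<lambda>j. first_passage.t a (psi j)) \<longlonglongrightarrow> 1" using am m by simp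
  have "(\<lambda>j. first_passage.Co a p (psi j)) \<longlonglongrightarrow> ((1 - a) + a * m\<^sup>2) / ((1 - a) - a * m\<^sup>2 / p)"
    unfolding first_passage.Co_def[OF fp] using nz assms by (intro tendsto_intros lim) auto
  moreover have "((1 - a) + a * m\<^sup>2) / ((1 - a) - a * m\<^sup>2 / p) = p / (p * max a (1 - a) - min a (1 - a))"
  proof -
    have "m / ((1 - a) - a * m\<^sup>2 / p) = m * p / (((1 - a) - a * m\<^sup>2 / p) * p)" using assms by simp
    also have "\<dots> = p / (p * max a (1 - a) - min a (1 - a))" unfolding mp using m by simp
    finally show ?thesis unfolding am .
  qed
  ultimately have 2: "(\<lambda>j. first_passage.Co a p (psi j)) \<longlonglongrightarrow> p / (p * max a (1 - a) - min a (1 - a))" by simp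
  show ?thesis by (rule that[OF fp 1 2])
qed

section \<open>Green kernels of the tree walks on the diagonal\<close>

context end_tree
begin

lemma tree_walk_par: "tree_walk p T a x (par x) = 1 - a"
  using par_par_neq[of x] by (simp add: tree_walk_def predecessor_eq)

lemma tree_walk_child: "z \<in> children x \<Longrightarrow> tree_walk p T a x z = a / real p"
  by (simp add: tree_walk_def predecessor_eq children_def)

lemma par_notin_children: "par x \<notin> children x"
  using par_par_neq[of x] by (simp add: children_def)

lemma sum_tree_walk:
  "(\<Sum>z\<in>insert (par x) (children x). tree_walk p T a x z * F z) = (1 - a) * F (par x) + a / real p * (\<Sum>z\<in>children x. F z)"
  using par_notin_children[of x] by (simp add: tree_walk_par tree_walk_child sum_distrib_left)

lemma tree_walk_chain:
  assumes "0 < a" "a < 1"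
  shows "finite_range_chain UNIV (tree_walk p T a) (\<lambda>x. insert (par x) (children x))"
proof
  fix x
  show "(\<Sum>z\<in>insert (par x) (children x). tree_walk p T a x z) = 1"
    using sum_tree_walk[of a x "\<lambda>_. 1"] p2 by simp
qed (use assms finite_children in \<open>auto simp: tree_walk_def predecessor_eq children_def\<close>)

lemma tree_walk_discounted:
  assumes a: "0 < a" "a < 1" and fp: "first_passage a (real p) phi"
  shows "(\<lambda>k. first_passage.t a phi ^ k * nstep UNIV (tree_walk p T a) k y y) sums first_passage.Co a (real p) phi"
proof -
  define t theta Co where "t = first_passage.t a phi" and "theta = first_passage.theta a (real p) phi"
    and "Co = first_passage.Co a (real p) phi"
  note defs = t_def theta_def Co_def
  define g where "g u d = phi ^ u * theta ^ d" for u d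
  define F where "F x = Co * g (up T x y) (down T x y)" for x
  have "(\<lambda>k. t ^ k * nstep UNIV (tree_walk p T a) k y y) sums F y"
  proof (rule finite_range_chain.discounted_sums[OF tree_walk_chain[OF a]])
    show "0 \<le> t" "t < 1" unfolding defs by (rule first_passage.t[OF fp])+
    fix x
    show "\<bar>F x\<bar> \<le> Co" unfolding F_def g_def defs by (rule first_passage.passage_bounded[OF fp])
    let ?u = "up T x y" and ?d = "down T x y"
    define S where "S = (1 - a) * g (up T (par x) y) (down T (par x) y) + a / real p * (\<Sum>z\<in>children x. g (up T z y) (down T z y))"
    have "F x = (if ?u = 0 \<and> ?d = 0 then 1 else 0) + t * (Co * S)"
      unfolding F_def g_def t_def Co_def theta_def
    proof (rule first_passage.passage_equation[OF fp], fold theta_def)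
      show "S = a * (phi ^ (?u + 1) * theta ^ ?d) + (1 - a) * (phi ^ (?u - 1) * theta ^ ?d)" if "0 < ?u"
        unfolding S_def sum_children up_down_par using that p2 by (simp add: g_def)
      show "S = a / real p * theta ^ (?d - 1) + a * (real p - 1) / real p * (phi * theta ^ ?d) + (1 - a) * theta ^ (?d + 1)"
        if "?u = 0" "0 < ?d"
        unfolding S_def sum_children up_down_par using that p2 by (simp add: g_def field_simps)
      show "S = a * phi + (1 - a) * theta" if "?u = 0" "?d = 0"
        unfolding S_def sum_children up_down_par using that p2 by (simp add: g_def)
    qed
    moreover have "(?u = 0 \<and> ?d = 0) = (x = y)" using up_down_0[of x y] by auto
    moreover have "Co * S = (\<Sum>z\<in>insert (par x) (children x). tree_walk p T a x z * F z)"
      unfolding sum_tree_walk S_def F_def by (simp add: sum_distrib_left algebra_simps)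
    ultimately show "F x = (if x = y then 1 else 0) + t * (\<Sum>z\<in>insert (par x) (children x). tree_walk p T a x z * F z)"
      by simp
  qed simp
  then show ?thesis by (simp add: F_def g_def defs)
qed

lemma tree_green_diag:
  assumes a: "0 < a" "a < 1"
  shows "green UNIV (tree_walk p T a) y y = ennreal (real p / (real p * max a (1 - a) - min a (1 - a)))"
proof -
  have p: "1 \<le> real p" "1 < real p" using p2 by simp_all
  obtain phi where fp: "\<And>j. first_passage a (real p) (phi j)"
    and t: "(\<lambda>j. first_passage.t a (phi j)) \<longlonglongrightarrow> 1"
    and Co: "(\<lambda>j. first_passage.Co a (real p) (phi j)) \<longlonglongrightarrow> real p / (real p * max a (1 - a) - min a (1 - a))"
    using first_passage_limit[OF a p(1) disjI1[OF p(2)]] by blast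
  show ?thesis
    by (rule finite_range_chain.green_from_discounted[OF tree_walk_chain[OF a] tree_walk_discounted[OF a fp]
          first_passage.t(1)[OF fp] less_imp_le[OF first_passage.t(2)[OF fp]] t Co UNIV_I])
qed

end

section \<open>The Green kernel of the integer walk on the diagonal\<close>

lemma sum_int_walk: "(\<Sum>z\<in>{x + 1, x - 1}. int_walk a x z * F z) = a * F (x + 1) + (1 - a) * F (x - 1)"
  by (simp add: int_walk_def)

lemma int_walk_chain:
  assumes "0 < a" "a < 1"
  shows "finite_range_chain UNIV (int_walk a) (\<lambda>x. {x + 1, x - 1})"
proof
  fix x
  show "(\<Sum>z\<in>{x + 1, x - 1}. int_walk a x z) = 1" using sum_int_walk[of a x "\<lambda>_. 1"] by simp
qed (use assms in \<open>auto simp: int_walk_def\<close>)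

lemma int_walk_discounted:
  assumes a: "0 < a" "a < 1" and fp: "first_passage a 1 phi"
  shows "(\<lambda>k. first_passage.t a phi ^ k * nstep UNIV (int_walk a) k y y) sums first_passage.Co a 1 phi"
proof -
  define t theta Co where "t = first_passage.t a phi" and "theta = first_passage.theta a 1 phi"
    and "Co = first_passage.Co a 1 phi"
  note defs = t_def theta_def Co_def
  \<comment> \<open>The integers are treated as the tree with \<open>p = 1\<close> in which
    \<open>k - 1\<close> is the predecessor of \<open>k\<close>: the surplus of \<open>x\<close>
    over \<open>y\<close> plays the role of \<open>u\<close>, its deficit that of
    \<open>d\<close>.\<close>
  define g where "g k = phi ^ nat k * theta ^ nat (- k)" for k
  define F where "F x = Co * g (x - y)" for x
  have "(\<lambda>k. t ^ k * nstep UNIV (int_walk a) k y y) sums F y"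
  proof (rule finite_range_chain.discounted_sums[OF int_walk_chain[OF a]])
    show "0 \<le> t" "t < 1" unfolding defs by (rule first_passage.t[OF fp])+
    fix x
    show "\<bar>F x\<bar> \<le> Co" unfolding F_def g_def defs by (rule first_passage.passage_bounded[OF fp])
    let ?u = "nat (x - y)" and ?d = "nat (- (x - y))"
    define S where "S = a * g (x + 1 - y) + (1 - a) * g (x - 1 - y)"
    have "F x = (if ?u = 0 \<and> ?d = 0 then 1 else 0) + t * (Co * S)"
      unfolding F_def g_def t_def Co_def theta_def
    proof (rule first_passage.passage_equation[OF fp], fold theta_def)
      show "S = a * (phi ^ (?u + 1) * theta ^ ?d) + (1 - a) * (phi ^ (?u - 1) * theta ^ ?d)" if "0 < ?u"
      proof -
        have "nat (x + 1 - y) = ?u + 1" "nat (x - 1 - y) = ?u - 1" "nat (- (x + 1 - y)) = 0" "nat (- (x - 1 - y)) = 0" "?d = 0"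
          using that by auto
        then show ?thesis unfolding S_def g_def by simp
      qed
      show "S = a / 1 * theta ^ (?d - 1) + a * (1 - 1) / 1 * (phi * theta ^ ?d) + (1 - a) * theta ^ (?d + 1)"
        if "?u = 0" "0 < ?d"
      proof -
        have "nat (- (x + 1 - y)) = ?d - 1" "nat (- (x - 1 - y)) = ?d + 1" "nat (x + 1 - y) = 0" "nat (x - 1 - y) = 0"
          using that by auto
        then show ?thesis unfolding S_def g_def by simp
      qed
      show "S = a * phi + (1 - a) * theta" if "?u = 0" "?d = 0"
      proof -
        have "x = y" using that by simp
        then show ?thesis by (simp add: S_def g_def)
      qed
    qed
    moreover have "(?u = 0 \<and> ?d = 0) = (x = y)" by auto
    moreover have "Co * S = (\<Sum>z\<in>{x + 1, x - 1}. int_walk a x z * F z)"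
      unfolding sum_int_walk S_def F_def by (simp add: algebra_simps)
    ultimately show "F x = (if x = y then 1 else 0) + t * (\<Sum>z\<in>{x + 1, x - 1}. int_walk a x z * F z)"
      by simp
  qed simp
  then show ?thesis by (simp add: F_def g_def defs)
qed

lemma int_green_diag:
  assumes a: "0 < a" "a < 1" "a \<noteq> 1 / 2"
  shows "green UNIV (int_walk a) y y = ennreal (1 / (max a (1 - a) - min a (1 - a)))"
proof -
  obtain phi where fp: "\<And>j. first_passage a 1 (phi j)"
    and t: "(\<lambda>j. first_passage.t a (phi j)) \<longlonglongrightarrow> 1"
    and Co: "(\<lambda>j. first_passage.Co a 1 (phi j)) \<longlonglongrightarrow> 1 / (1 * max a (1 - a) - min a (1 - a))"
    using first_passage_limit[OF a(1,2) order_refl disjI2[OF a(3)]] by blast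
  have "green UNIV (int_walk a) y y = ennreal (1 / (1 * max a (1 - a) - min a (1 - a)))"
    by (rule finite_range_chain.green_from_discounted[OF int_walk_chain[OF a(1,2)] int_walk_discounted[OF a(1,2) fp]
          first_passage.t(1)[OF fp] less_imp_le[OF first_passage.t(2)[OF fp]] t Co UNIV_I])
  then show ?thesis by simp
qed

subsection \<open>Visits with prescribed extrema\<close>

text \<open>The q-integers with base \<open>b\<close>. With \<open>al = 1 / (1 + b)\<close> they are
  harmonic, \<open>al * [n + 1] + (1 - al) * [n - 1] = [n]\<close>, and in contrast to
  \<open>b ^ n\<close> they do not degenerate to a constant at \<open>b = 1\<close>.\<close>

definition qint :: "real \<Rightarrow> nat \<Rightarrow> real" where
  "qint b n = (\<Sum>k<n. b ^ k)"

lemma qint_0 [simp]: "qint b 0 = 0"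
  by (simp add: qint_def)

lemma qint_Suc: "qint b (Suc n) = 1 + b * qint b n"
  unfolding qint_def by (subst sum.lessThan_Suc_shift) (simp add: sum_distrib_left)

lemma power_qint: "(b::real) ^ n = 1 + (b - 1) * qint b n"
proof (induction n)
  case (Suc n)
  then have "b ^ Suc n = b * (1 + (b - 1) * qint b n)" by simp
  then show ?case by (simp add: qint_Suc algebra_simps)
qed simp

lemma qint_add: "qint b (m + n) = qint b m + b ^ m * qint b n"
  by (induction m) (simp_all add: qint_Suc algebra_simps)

lemma qint_diff: "m \<le> n \<Longrightarrow> qint b n - qint b m = b ^ m * qint b (n - m)"
  using qint_add[of b m "n - m"] by simp

lemma qint_nonneg: "0 \<le> b \<Longrightarrow> 0 \<le> qint b n"
  by (simp add: qint_def sum_nonneg)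

lemma qint_pos: "0 \<le> b \<Longrightarrow> 0 < n \<Longrightarrow> 0 < qint b n"
  by (cases n) (auto simp: qint_Suc qint_nonneg add_pos_nonneg)

lemma qint_mono: "0 \<le> b \<Longrightarrow> m \<le> n \<Longrightarrow> qint b m \<le> qint b n"
proof -
  assume "0 \<le> b" "m \<le> n"
  moreover from this have "0 \<le> b ^ m * qint b (n - m)" by (simp add: qint_nonneg)
  ultimately show ?thesis using qint_diff[of m n b] by linarith
qed

text \<open>The expected number of visits to \<open>c - a\<close> of the walk on the integers started at \<open>0\<close>, counted along
  those paths only whose minimum is \<open>- a\<close> and whose maximum is \<open>t - a\<close>. The formula is the mixed second
  difference of the Green function of the walk killed outside an interval; here \<open>b\<close> is \<open>\<beta>\<close>. For \<open>t = 0\<close> it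
  would read \<open>0 / 0\<close>.\<close>

definition confinement :: "real \<Rightarrow> nat \<Rightarrow> nat \<Rightarrow> nat \<Rightarrow> real" where
  "confinement b a c t = (if t = 0 then 1 else
     (b + 1) * b ^ (t - c)
       * (qint b t * (1 + b * (qint b a + qint b c)) - (b + 1) * qint b a * qint b c)
       / (qint b t * qint b (t + 1) * qint b (t + 2)))"

context
  fixes b :: real
  assumes b: "0 < b"
begin

text \<open>At the bottom the factor \<open>qint b t\<close> cancels. What is left makes sense for
  \<open>t = 0\<close> too and equals \<open>1\<close> there, so the separate value in the
  definition is the natural continuation.\<close>

lemma confinement_bottom_eq:
  "confinement b 0 c t = (b + 1) * b ^ (t - c) * (1 + b * qint b c) / (qint b (t + 1) * qint b (t + 2))"
  if "c \<le> t"
proof (cases "t = 0")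
  case False
  define z where "z = qint b t"
  define D where "D = qint b (t + 1) * qint b (t + 2)"
  have "z > 0" "D > 0" using False b by (auto simp: z_def D_def qint_pos)
  then show ?thesis
    using False by (simp add: confinement_def z_def[symmetric] D_def[symmetric] mult.assoc)
qed (use that b in \<open>simp add: confinement_def qint_Suc numeral_2_eq_2 add.commute\<close>)

lemma confinement_top_eq:
  "confinement b t c t = (b + 1) * b ^ (t - c) * (1 + b * qint b t - qint b c) / (qint b (t + 1) * qint b (t + 2))"
  if "c \<le> t"
proof (cases "t = 0")
  case False
  define z where "z = qint b t"
  define y where "y = qint b c"
  have "z * (1 + b * (z + y)) - (b + 1) * z * y = z * (1 + b * z - y)" by algebra
  then show ?thesis
    using False b qint_pos[of b t] by (auto simp: confinement_def z_def[symmetric] y_def[symmetric] mult.assoc)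
qed (use that b in \<open>simp add: confinement_def qint_Suc numeral_2_eq_2 add.commute\<close>)

end

section \<open>First-step equations for the visits with prescribed extrema\<close>

context
  fixes b al :: real
  assumes b: "0 < b" and al: "al = 1 / (1 + b)"
begin

lemma one_minus_al: "1 - al = b / (1 + b)"
  using b al by (simp add: field_simps)

text \<open>A start strictly between the extrema influences neither of them, so the first step only
  moves the start.\<close>

lemma confinement_interior:
  assumes "0 < a" "a < t" "c \<le> t"
  shows "confinement b a c t = al * confinement b (a + 1) c t + (1 - al) * confinement b (a - 1) c t"
proof -
  obtain a' where a: "a = Suc a'" using assms by (cases a) auto
  define D where "D = (b + 1) * b ^ (t - c) / (qint b t * qint b (t + 1) * qint b (t + 2))"
  define K where "K x = qint b t * (1 + b * (x + qint b c)) - (b + 1) * x * qint b c" for x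
  have N: "confinement b k c t = D * K (qint b k)" for k
    using assms by (simp add: confinement_def D_def K_def)
  \<comment> \<open>Here \<open>x\<close> stands for \<open>qint b (a - 1)\<close>. The formula is
    affine in \<open>qint b a\<close>, and \<open>qint b\<close> is harmonic.\<close>
  have "K (1 + b * x) = al * K (1 + b * (1 + b * x)) + (1 - al) * K x" for x
    unfolding one_minus_al using b unfolding al K_def by (simp add: divide_simps) algebra
  then have "D * K (1 + b * x) = al * (D * K (1 + b * (1 + b * x))) + (1 - al) * (D * K x)" for x
    by (metis (no_types, opaque_lifting) distrib_left mult.left_commute)
  from this[of "qint b a'"] show ?thesis
    unfolding N a by (simp only: qint_Suc Suc_eq_plus1[symmetric] diff_Suc_1)
qed

text \<open>From the minimum the first step goes up. Then either the path comes back to this level,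
  or the minimum of the rest is one higher, which shortens the range. The second possibility
  disappears if the target is itself at the bottom.\<close>

lemma confinement_bottom:
  assumes "0 < c" "c \<le> t"
  shows "confinement b 0 c t = al * confinement b 1 c t + al * confinement b 0 (c - 1) (t - 1)"
proof -
  obtain c' where c: "c = Suc c'" using assms by (cases c) auto
  obtain t' where t: "t = Suc t'" using assms by (cases t) auto
  define y where "y = qint b c"
  define z where "z = qint b t"
  define z1 where "z1 = qint b (t + 1)"
  define z2 where "z2 = qint b (t + 2)"
  define P where "P = b ^ (t - c)"
  have pos: "z > 0" "z1 > 0" "z2 > 0" using b t by (auto simp: z_def z1_def z2_def qint_pos)
  have z2: "z2 = 1 + b * (1 + b * z)" by (simp add: z2_def z_def qint_Suc)
  have N0: "confinement b 0 c t = (b + 1) * P * (1 + b * y) / (z1 * z2)"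
    using confinement_bottom_eq[OF b assms(2)] by (simp add: P_def y_def z1_def z2_def)
  have N1: "confinement b 1 c t = (b + 1) * P * (z * (1 + b + b * y) - (b + 1) * y) / (z * z1 * z2)"
  proof -
    have "qint b 1 = 1" by (simp add: qint_Suc)
    then have "confinement b 1 c t = (b + 1) * P * (z * (1 + b * (1 + y)) - (b + 1) * 1 * y) / (z * z1 * z2)"
      using t by (simp only: confinement_def P_def y_def z_def z1_def z2_def) simp
    then show ?thesis by (simp add: distrib_left add.assoc)
  qed
  have N2: "confinement b 0 (c - 1) (t - 1) = (b + 1) * P * y / (z * z1)"
    using confinement_bottom_eq[OF b, of "c - 1" "t - 1"] assms
    by (simp add: P_def y_def z_def z1_def c t qint_Suc)
  have id: "(1 + b) * (1 + b * y) * z = (z * (1 + b + b * y) - (b + 1) * y) + y * z2"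
    unfolding z2 by algebra
  have "al * confinement b 1 c t + al * confinement b 0 (c - 1) (t - 1)
      = P * ((z * (1 + b + b * y) - (b + 1) * y) + y * z2) / (z * z1 * z2)"
    using pos b unfolding N1 N2 al by (simp add: divide_simps) algebra
  also have "\<dots> = confinement b 0 c t"
    unfolding id[symmetric] N0 using pos by (simp add: field_simps)
  finally show ?thesis by simp
qed

lemma confinement_bottom_0: "0 < t \<Longrightarrow> confinement b 0 0 t = al * confinement b 1 0 t"
proof -
  assume t: "0 < t"
  define z where "z = qint b t"
  define D where "D = qint b (t + 1) * qint b (t + 2)"
  have pos: "z > 0" "D > 0" "b + 1 > 0" using t b by (auto simp: z_def D_def qint_pos)
  have "qint b 1 = 1" by (simp add: qint_Suc)
  then have "confinement b 1 0 t = (b + 1) * b ^ t * (z * (1 + b)) / (z * D)"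
    using t by (simp add: confinement_def z_def D_def mult.assoc)
  then show ?thesis
    using pos confinement_bottom_eq[OF b, of 0 t] unfolding al D_def[symmetric] by (simp add: add.commute)
qed

text \<open>From the maximum the first step goes down. Either the rest reaches this level again, or
  its maximum is one lower; with the target at the top only the former can happen.\<close>

lemma confinement_top:
  assumes "c < t"
  shows "confinement b t c t = (1 - al) * (confinement b (t - 1) c t + confinement b (t - 1) c (t - 1))"
proof -
  obtain t' where t: "t = Suc t'" using assms by (cases t) auto
  define y where "y = qint b c"
  define w where "w = qint b t'"
  define z where "z = qint b t"
  define z1 where "z1 = qint b (t + 1)"
  define z2 where "z2 = qint b (t + 2)"
  define P where "P = b ^ (t' - c)"
  have pos: "z > 0" "z1 > 0" "z2 > 0" using b t by (auto simp: z_def z1_def z2_def qint_pos)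
  have zw: "z = 1 + b * w" by (simp add: z_def w_def t qint_Suc)
  have z2: "z2 = 1 + b * (1 + b * z)" by (simp add: z2_def z_def qint_Suc)
  have Pb: "b ^ (t - c) = b * P" using assms by (simp add: P_def t Suc_diff_le)
  have N0: "confinement b t c t = (b + 1) * (b * P) * (1 + b * z - y) / (z1 * z2)"
    using confinement_top_eq[OF b, of c t] assms by (simp add: Pb y_def z_def z1_def z2_def)
  have N1: "confinement b (t - 1) c t = (b + 1) * (b * P) * (z * (1 + b * (w + y)) - (b + 1) * w * y) / (z * z1 * z2)"
    unfolding confinement_def Pb y_def z_def w_def z1_def z2_def using t by simp
  have N2: "confinement b (t - 1) c (t - 1) = (b + 1) * P * (z - y) / (z * z1)"
    using confinement_top_eq[OF b, of c "t - 1"] assms zw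
    by (simp add: P_def y_def z_def w_def z1_def t)
  have id: "(1 + b) * (1 + b * z - y) * z = b * (z * (1 + b * (w + y)) - (b + 1) * w * y) + (z - y) * z2"
    unfolding z2 zw by algebra
  have "(1 - al) * (confinement b (t - 1) c t + confinement b (t - 1) c (t - 1))
      = b * P * (b * (z * (1 + b * (w + y)) - (b + 1) * w * y) + (z - y) * z2) / (z * z1 * z2)"
    using pos b unfolding N1 N2 one_minus_al by (simp add: divide_simps) algebra
  also have "\<dots> = confinement b t c t"
    unfolding id[symmetric] N0 using pos by (simp add: field_simps)
  finally show ?thesis by simp
qed

lemma confinement_top_diag:
  assumes "0 < t"
  shows "confinement b t t t = (1 - al) * confinement b (t - 1) t t"
proof -
  obtain t' where t: "t = Suc t'" using assms by (cases t) auto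
  define w where "w = qint b t'"
  define z where "z = qint b t"
  have zw: "z = 1 + b * w" by (simp add: z_def w_def t qint_Suc)
  have "z > 0" using b t by (simp add: z_def qint_pos)
  then have id: "b * ((z * (1 + b * (w + z)) - (b + 1) * w * z) / z) = (1 + b) * (1 + b * z - z)"
    by (simp add: divide_simps) (simp add: zw algebra_simps)
  define D where "D = qint b (t + 1) * qint b (t + 2)"
  have "confinement b (t - 1) t t = (b + 1) * ((z * (1 + b * (w + z)) - (b + 1) * w * z) / z) / D"
    unfolding confinement_def D_def z_def w_def using t by simp
  then have "(1 - al) * confinement b (t - 1) t t = b * ((z * (1 + b * (w + z)) - (b + 1) * w * z) / z) / D"
    unfolding one_minus_al using b by (simp add: add.commute)
  then show ?thesis
    unfolding confinement_top_eq[OF b order_refl] id[unfolded z_def] D_def z_def diff_self_eq_0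
    by (simp only: add.commute[of b 1] power_0 mult_1_right)
qed

end

lemma confinement_nonneg:
  assumes "a \<le> t" "c \<le> t" "1 \<le> b"
  shows "0 \<le> confinement b a c t"
proof (cases "t = 0")
  case False
  define x where "x = qint b a"
  define y where "y = qint b c"
  define z where "z = qint b t"
  have xy: "0 \<le> x" "x \<le> z" "0 \<le> y" "y \<le> z"
    using assms by (auto simp: x_def y_def z_def qint_nonneg qint_mono)
  \<comment> \<open>The numerator of \<open>confinement\<close>, rearranged into terms that are
    visibly nonnegative for \<open>b\<close> at least \<open>1\<close>.\<close>
  have "0 \<le> z + b * ((z - x) * y) + b * (x * (z - y)) + (b - 1) * (x * y)"
    using xy assms by (intro add_nonneg_nonneg mult_nonneg_nonneg) auto
  also have "\<dots> = z * (1 + b * (x + y)) - (b + 1) * x * y"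
    by (simp add: algebra_simps)
  finally have "0 \<le> z * (1 + b * (x + y)) - (b + 1) * x * y" .
  then show ?thesis using False assms(3)
    unfolding confinement_def x_def y_def z_def
    by (simp add: qint_nonneg divide_nonneg_nonneg mult_nonneg_nonneg)
qed (simp add: confinement_def)

text \<open>Only the uniformity in \<open>a\<close>, \<open>c\<close> and \<open>t\<close> matters:
  with it, \<open>q > 1\<close> and \<open>r > 1\<close> make both overshoot series converge
  geometrically.\<close>

lemma confinement_bound:
  assumes "a \<le> t" "c \<le> t" "1 \<le> b"
  shows "confinement b a c t \<le> 3 * (b + 1)"
proof (cases "t = 0")
  case False
  define x where "x = qint b a"
  define y where "y = qint b c"
  define z where "z = qint b t"
  define z1 where "z1 = qint b (t + 1)"
  define z2 where "z2 = qint b (t + 2)"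
  define K where "K = z * (1 + b * (x + y)) - (b + 1) * x * y"
  have xy: "0 \<le> x" "x \<le> z" "0 \<le> y" "y \<le> z"
    using assms by (auto simp: x_def y_def z_def qint_nonneg qint_mono)
  have z: "0 < z" "0 < z1" using False assms by (auto simp: z_def z1_def intro!: qint_pos)
  have z12: "z1 = 1 + b * z" "z2 = 1 + b * z1" by (simp_all add: z_def z1_def z2_def qint_Suc)
  have "z1 \<le> b * z1" using assms z by simp
  moreover have "z \<le> b * z" using assms z by simp
  ultimately have z2: "z1 \<le> z2" "0 < z2" "1 \<le> z2" using z z12 by linarith+
  have "b ^ (t - c) \<le> b ^ t" using assms by (intro power_increasing) auto
  also have "b ^ t = z1 - z" using qint_add[of b t 1] by (simp add: z1_def z_def qint_Suc)
  finally have p: "b ^ (t - c) \<le> z1" using z by linarith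
  have "0 \<le> (b + 1) * x * y" using xy assms by auto
  have "K \<le> z * (1 + b * (z + z))"
  proof -
    have "z * (1 + b * (x + y)) \<le> z * (1 + b * (z + z))"
      using xy assms z by (intro mult_left_mono add_left_mono add_mono) auto
    then show ?thesis unfolding K_def using \<open>0 \<le> (b + 1) * x * y\<close> by linarith
  qed
  also have "\<dots> \<le> z * (3 * z2)"
    using z z12 z2 by (intro mult_left_mono) (auto simp: algebra_simps)
  finally have K: "K \<le> z * (3 * z2)" .
  have "b ^ (t - c) * K \<le> b ^ (t - c) * (z * (3 * z2))"
    using K assms by (intro mult_left_mono) auto
  also have "\<dots> \<le> z1 * (z * (3 * z2))"
    using p z z2 by (intro mult_right_mono) auto
  finally have "(b + 1) * (b ^ (t - c) * K) \<le> (b + 1) * (z1 * (z * (3 * z2)))"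
    using assms by (intro mult_left_mono) auto
  then have "(b + 1) * b ^ (t - c) * K / (z * z1 * z2) \<le> 3 * (b + 1)"
    using z z2 by (subst pos_divide_le_eq) (auto simp: mult_ac)
  then show ?thesis
    using False by (simp add: confinement_def K_def x_def y_def z_def z1_def z2_def)
qed (use assms in \<open>auto simp: confinement_def\<close>)

section \<open>The double series over the overshoots and its equations\<close>

definition upper_sum :: "real \<Rightarrow> real \<Rightarrow> nat \<Rightarrow> nat \<Rightarrow> nat \<Rightarrow> real" where
  "upper_sum b r a c t = (\<Sum>j. confinement b a c (t + j) / r ^ j)"

text \<open>An overshoot \<open>j\<close> of the maximum only lengthens the range, whereas an
  overshoot \<open>i\<close> of the minimum raises the heights \<open>a\<close> and
  \<open>c\<close>, measured from the minimum, as well. Multiplied by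
  \<open>q ^ (- d1) r ^ (- d2)\<close> this becomes the Green kernel.\<close>

definition green_factor :: "real \<Rightarrow> real \<Rightarrow> real \<Rightarrow> nat \<Rightarrow> nat \<Rightarrow> nat \<Rightarrow> real" where
  "green_factor b q r a c t = (\<Sum>i. upper_sum b r (a + i) (c + i) (t + i) / q ^ i)"

lemma summable_bounded_div_power:
  fixes f :: "nat \<Rightarrow> real"
  assumes "\<And>n. 0 \<le> f n" "\<And>n. f n \<le> C" "1 < q"
  shows "summable (\<lambda>n. f n / q ^ n)" "0 \<le> (\<Sum>n. f n / q ^ n)" "(\<Sum>n. f n / q ^ n) \<le> C * (q / (q - 1))"
proof -
  have g: "(\<lambda>n. (1 / q) ^ n) sums (1 / (1 - 1 / q))" using assms by (intro geometric_sums) auto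
  have gC: "(\<lambda>n. C * (1 / q) ^ n) sums (C * (1 / (1 - 1 / q)))" by (rule sums_mult[OF g])
  have le: "f n / q ^ n \<le> C * (1 / q) ^ n" for n
    using assms by (simp add: power_divide divide_right_mono)
  show s: "summable (\<lambda>n. f n / q ^ n)"
    by (rule summable_comparison_test'[OF sums_summable[OF gC], of 0]) (use assms le in auto)
  show "0 \<le> (\<Sum>n. f n / q ^ n)" using assms by (intro suminf_nonneg s) auto
  have "(\<Sum>n. f n / q ^ n) \<le> C * (1 / (1 - 1 / q))"
    unfolding sums_unique[OF gC] by (intro suminf_le s sums_summable[OF gC] le)
  also have "1 / (1 - 1 / q) = q / (q - 1)" using assms by (simp add: field_simps)
  finally show "(\<Sum>n. f n / q ^ n) \<le> C * (q / (q - 1))" .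
qed

lemma suminf_div_power_split:
  fixes f :: "nat \<Rightarrow> real"
  assumes "summable (\<lambda>n. f n / q ^ n)" 
  shows "(\<Sum>n. f n / q ^ n) = f 0 + (\<Sum>n. f (Suc n) / q ^ n) / q"
proof -
  have "(\<Sum>n. f n / q ^ n) = f 0 + (\<Sum>n. f (Suc n) / q ^ Suc n)"
    using suminf_split_head[OF assms] by simp
  also have "(\<Sum>n. f (Suc n) / q ^ Suc n) = (\<Sum>n. f (Suc n) / q ^ n / q)" by (simp add: mult.commute)
  also have "\<dots> = (\<Sum>n. f (Suc n) / q ^ n) / q"
  proof (rule suminf_divide)
    show "summable (\<lambda>n. f (Suc n) / q ^ n)"
    proof (cases "q = 0")
      case True
      show ?thesis by (rule summable_finite[of "{0}"]) (use True in auto)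
    next
      case False
      have "summable (\<lambda>n. f (Suc n) / q ^ Suc n * q)"
        using assms by (intro summable_mult2) (simp only: summable_Suc_iff[of "\<lambda>n. f n / q ^ n"])
      then show ?thesis using False by (simp add: field_simps)
    qed
  qed
  finally show ?thesis .
qed

lemma suminf_div_power_linear:
  fixes f :: "nat \<Rightarrow> real"
  assumes "summable (\<lambda>n. g n / q ^ n)" "summable (\<lambda>n. h n / q ^ n)"
    and "\<And>n. f n = u * g n + v * h n"
  shows "(\<Sum>n. f n / q ^ n) = u * (\<Sum>n. g n / q ^ n) + v * (\<Sum>n. h n / q ^ n)"
proof -
  have "(\<Sum>n. f n / q ^ n) = (\<Sum>n. u * (g n / q ^ n) + v * (h n / q ^ n))"
    by (simp add: assms(3) add_divide_distrib)
  also have "\<dots> = (\<Sum>n. u * (g n / q ^ n)) + (\<Sum>n. v * (h n / q ^ n))"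
    by (intro suminf_add[symmetric] summable_mult assms)
  finally show ?thesis by (simp only: suminf_mult assms)
qed

locale dl_kernel =
  fixes b al q r :: real
  assumes b: "1 \<le> b" and al: "al = 1 / (1 + b)" and q: "1 < q" and r: "1 < r"
begin

lemma b0: "0 < b" using b by simp

lemmas interior = confinement_interior[OF b0 al]
lemmas bottom = confinement_bottom[OF b0 al] confinement_bottom_0[OF b0 al]
lemmas top = confinement_top[OF b0 al] confinement_top_diag[OF b0 al]

abbreviation "N \<equiv> confinement b"
abbreviation "M \<equiv> upper_sum b r"
abbreviation "Phi \<equiv> green_factor b q r"

definition "M_bound = 3 * (b + 1) * (r / (r - 1))"
definition "Phi_bound = M_bound * (q / (q - 1))"

lemma M_props:
  assumes "a \<le> t" "c \<le> t"
  shows "summable (\<lambda>j. N a c (t + j) / r ^ j)" "0 \<le> M a c t" "M a c t \<le> M_bound"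
proof -
  have *: "0 \<le> N a c (t + j)" "N a c (t + j) \<le> 3 * (b + 1)" for j
    using confinement_nonneg[of a "t + j" c b] confinement_bound[of a "t + j" c b] assms b by auto
  show "summable (\<lambda>j. N a c (t + j) / r ^ j)" "0 \<le> M a c t" "M a c t \<le> M_bound"
    using summable_bounded_div_power[OF * r] by (simp_all add: upper_sum_def M_bound_def)
qed

lemma Phi_props:
  assumes "a \<le> t" "c \<le> t"
  shows "summable (\<lambda>i. M (a + i) (c + i) (t + i) / q ^ i)" "0 \<le> Phi a c t" "Phi a c t \<le> Phi_bound"
proof -
  have *: "0 \<le> M (a + i) (c + i) (t + i)" "M (a + i) (c + i) (t + i) \<le> M_bound" for i
    using assms by (auto intro!: M_props)
  show "summable (\<lambda>i. M (a + i) (c + i) (t + i) / q ^ i)" "0 \<le> Phi a c t" "Phi a c t \<le> Phi_bound"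
    using summable_bounded_div_power[OF * q] by (simp_all add: green_factor_def Phi_bound_def)
qed

lemma M_split: "a \<le> t \<Longrightarrow> c \<le> t \<Longrightarrow> M a c t = N a c t + M a c (t + 1) / r"
  using suminf_div_power_split[OF M_props(1), of a t c] by (simp add: upper_sum_def)

lemma Phi_split: "a \<le> t \<Longrightarrow> c \<le> t \<Longrightarrow> Phi a c t = M a c t + Phi (a + 1) (c + 1) (t + 1) / q"
  using suminf_div_power_split[OF Phi_props(1), of a t c] by (simp add: green_factor_def)

lemma M_interior:
  assumes "0 < a" "a < t" "c \<le> t"
  shows "M a c t = al * M (a + 1) c t + (1 - al) * M (a - 1) c t"
  unfolding upper_sum_def using assms interior
  by (intro suminf_div_power_linear M_props) auto

lemma M_bottom:
  assumes "0 < c" "c \<le> t"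
  shows "M 0 c t = al * M 1 c t + al * M 0 (c - 1) (t - 1)"
proof -
  have "N 0 c (t + j) = al * N 1 c (t + j) + al * N 0 (c - 1) (t - 1 + j)" for j
    using bottom(1)[of c "t + j"] assms by simp
  then show ?thesis
    unfolding upper_sum_def using assms
    by (intro suminf_div_power_linear M_props) auto
qed

lemma M_bottom_0: "0 < t \<Longrightarrow> M 0 0 t = al * M 1 0 t"
  unfolding upper_sum_def 
  using suminf_div_power_linear[of "\<lambda>j. N 1 0 (t + j)" r "\<lambda>j. N 1 0 (t + j)" "\<lambda>j. N 0 0 (t + j)" al 0]
    M_props(1)[of 1 t 0] bottom(2) by simp

text \<open>Only the summand without overshoot starts at its maximum; all the others obey the
  interior equation. After resumming, \<open>1 - 1 / r\<close> is the share of those successors in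
  the second tree that do not lead to the target.\<close>

lemma M_top:
  assumes "c < t"
  shows "M t c t = (1 - al) * (M (t - 1) c (t - 1) + (1 - 1 / r) * M (t - 1) c t) + al * M (t + 1) c (t + 1) / r"
proof -
  have "M t c t = N t c t + (al * M (t + 1) c (t + 1) + (1 - al) * M (t - 1) c (t + 1)) / r"
    using M_split[of t t c] M_interior[of t "t + 1" c] assms by simp
  moreover have "M (t - 1) c (t + 1) / r = M (t - 1) c t - N (t - 1) c t"
    using M_split[of "t - 1" t c] assms by simp
  moreover have "N (t - 1) c (t - 1) = M (t - 1) c (t - 1) - M (t - 1) c t / r"
    using M_split[of "t - 1" "t - 1" c] assms by simp
  ultimately show ?thesis
    using top(1)[OF assms] unfolding divide_inverse by algebra
qed

lemma M_top_diag:
  assumes "0 < t"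
  shows "M t t t = (1 - al) * M (t - 1) t t + al * M (t + 1) t (t + 1) / r"
proof -
  have "M t t t = N t t t + (al * M (t + 1) t (t + 1) + (1 - al) * M (t - 1) t (t + 1)) / r"
    using M_split[of t t t] M_interior[of t "t + 1" t] assms by simp
  moreover have "M (t - 1) t (t + 1) / r = M (t - 1) t t - N (t - 1) t t"
    using M_split[of "t - 1" t t] assms by simp
  ultimately show ?thesis
    using top(2)[OF assms] unfolding divide_inverse by algebra
qed

lemma Phi_interior:
  assumes "0 < u" "u < s" "d \<le> s"
  shows "Phi u d s = al * Phi (u + 1) d s + (1 - al) * Phi (u - 1) d s"
proof -
  have "M (u + i) (d + i) (s + i) = al * M (u + 1 + i) (d + i) (s + i) + (1 - al) * M (u - 1 + i) (d + i) (s + i)" for i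
    using M_interior[of "u + i" "s + i" "d + i"] assms by simp
  then show ?thesis
    unfolding green_factor_def using assms
    by (intro suminf_div_power_linear Phi_props) auto
qed

lemma Phi_shift_interior:
  assumes "0 < s" "d \<le> s"
  shows "Phi 1 (d + 1) (s + 1) = al * Phi 2 (d + 1) (s + 1) + (1 - al) * Phi 0 (d + 1) (s + 1)"
  using Phi_interior[of 1 "s + 1" "d + 1"] assms by (simp add: numeral_2_eq_2)

text \<open>The counterpart at the minimum: without overshoot the start is at the bottom, with
  overshoot it is inside. The factor \<open>1 - 1 / q\<close> is again the share of successors
  leading away, and the last term is the step to the predecessor, which costs one more factor
  \<open>1 / q\<close>.\<close>

lemma Phi_bottom:
  assumes "0 < d" "d \<le> s"
  shows "Phi 0 d s = al * (Phi 0 (d - 1) (s - 1) + (1 - 1 / q) * Phi 1 d s) + (1 - al) * Phi 0 (d + 1) (s + 1) / q"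
proof -
  have "Phi 0 d s = M 0 d s + Phi 1 (d + 1) (s + 1) / q"
    using Phi_split[of 0 s d] assms by simp
  moreover have "Phi 1 d s = M 1 d s + Phi 2 (d + 1) (s + 1) / q"
    using Phi_split[of 1 s d] assms by (simp add: numeral_2_eq_2)
  moreover have "Phi 0 (d - 1) (s - 1) = M 0 (d - 1) (s - 1) + Phi 1 d s / q"
    using Phi_split[of 0 "s - 1" "d - 1"] assms by simp
  ultimately show ?thesis
    using M_bottom[OF assms] Phi_shift_interior[OF less_le_trans[OF assms] assms(2)]
    unfolding divide_inverse by algebra
qed

lemma Phi_bottom_0:
  assumes "0 < s"
  shows "Phi 0 0 s = al * Phi 1 0 s + (1 - al) * Phi 0 1 (s + 1) / q"
proof -
  have "Phi 0 0 s = M 0 0 s + Phi 1 1 (s + 1) / q"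
    using Phi_split[of 0 s 0] assms by simp
  moreover have "Phi 1 0 s = M 1 0 s + Phi 2 1 (s + 1) / q"
    using Phi_split[of 1 s 0] assms by (simp add: numeral_2_eq_2)
  ultimately show ?thesis
    using M_bottom_0[OF assms] Phi_shift_interior[of s 0, OF assms le0]
    unfolding divide_inverse add_0 by algebra
qed

lemma Phi_top:
  assumes "d < s"
  shows "Phi s d s = (1 - al) * (Phi (s - 1) d (s - 1) + (1 - 1 / r) * Phi (s - 1) d s) + al * Phi (s + 1) d (s + 1) / r"
proof -
  have M: "M (s + i) (d + i) (s + i)
      = 1 * ((1 - al) * M (s - 1 + i) (d + i) (s - 1 + i) + ((1 - al) * (1 - 1 / r)) * M (s - 1 + i) (d + i) (s + i))
        + (al / r) * M (s + 1 + i) (d + i) (s + 1 + i)" for i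
    using M_top[of "d + i" "s + i"] assms by (simp add: distrib_left)
  have s: "summable (\<lambda>i. M (s - 1 + i) (d + i) (s - 1 + i) / q ^ i)" "summable (\<lambda>i. M (s - 1 + i) (d + i) (s + i) / q ^ i)"
    "summable (\<lambda>i. M (s + 1 + i) (d + i) (s + 1 + i) / q ^ i)"
    using Phi_props(1)[of "s - 1" "s - 1" d] Phi_props(1)[of "s - 1" s d] Phi_props(1)[of "s + 1" "s + 1" d] assms by simp_all
  have "(\<Sum>i. M (s + i) (d + i) (s + i) / q ^ i)
      = 1 * (\<Sum>i. ((1 - al) * M (s - 1 + i) (d + i) (s - 1 + i) + ((1 - al) * (1 - 1 / r)) * M (s - 1 + i) (d + i) (s + i)) / q ^ i)
        + (al / r) * (\<Sum>i. M (s + 1 + i) (d + i) (s + 1 + i) / q ^ i)"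
  proof (intro suminf_div_power_linear M s)
    show "summable (\<lambda>i. ((1 - al) * M (s - 1 + i) (d + i) (s - 1 + i) + ((1 - al) * (1 - 1 / r)) * M (s - 1 + i) (d + i) (s + i)) / q ^ i)"
      using summable_add[OF summable_mult[OF s(1), of "1 - al"] summable_mult[OF s(2), of "(1 - al) * (1 - 1 / r)"]]
      by (simp add: add_divide_distrib)
  qed
  also have "(\<Sum>i. ((1 - al) * M (s - 1 + i) (d + i) (s - 1 + i) + ((1 - al) * (1 - 1 / r)) * M (s - 1 + i) (d + i) (s + i)) / q ^ i)
     = (1 - al) * (\<Sum>i. M (s - 1 + i) (d + i) (s - 1 + i) / q ^ i) + ((1 - al) * (1 - 1 / r)) * (\<Sum>i. M (s - 1 + i) (d + i) (s + i) / q ^ i)"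
    by (intro suminf_div_power_linear s) auto
  finally show ?thesis
    unfolding green_factor_def by (simp add: distrib_left mult.assoc)
qed

lemma Phi_top_diag:
  assumes "0 < s"
  shows "Phi s s s = (1 - al) * Phi (s - 1) s s + al * Phi (s + 1) s (s + 1) / r"
proof -
  have "M (s + i) (s + i) (s + i) = (1 - al) * M (s - 1 + i) (s + i) (s + i) + (al / r) * M (s + 1 + i) (s + i) (s + 1 + i)" for i
    using M_top_diag[of "s + i"] assms by simp
  then have "Phi s s s = (1 - al) * Phi (s - 1) s s + (al / r) * Phi (s + 1) s (s + 1)"
    unfolding green_factor_def using assms
    by (intro suminf_div_power_linear Phi_props) auto
  then show ?thesis by simp
qed

text \<open>The range is a single point if there are no overshoots, and the value \<open>1\<close>
  of \<open>confinement\<close> for \<open>t = 0\<close> yields the delta in the equation of the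
  Green kernel.\<close>

lemma Phi_0: "Phi 0 0 0 = 1 + al * Phi 1 0 1 / r + (1 - al) * Phi 0 1 1 / q"
proof -
  have N0: "N 0 0 0 = 1" by (simp add: confinement_def)
  have "Phi 0 0 0 = M 0 0 0 + Phi 1 1 1 / q" using Phi_split[of 0 0 0] by simp
  moreover have "M 0 0 0 = 1 + al * M 1 0 1 / r"
    using M_split[of 0 0 0] M_bottom_0[of 1] by (simp add: N0)
  moreover have "Phi 1 1 1 = (1 - al) * Phi 0 1 1 + al * Phi 2 1 2 / r"
    using Phi_top_diag[of 1] by (simp add: numeral_2_eq_2)
  moreover have "Phi 1 0 1 = M 1 0 1 + Phi 2 1 2 / q"
    using Phi_split[of 1 1 0] by (simp add: numeral_2_eq_2)
  ultimately show ?thesis unfolding divide_inverse by algebra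
qed

end

subsection \<open>Corner asymptotics\<close>

lemma summable_Suc_div_power:
  assumes "1 < (q::real)"
  shows "summable (\<lambda>n. real (Suc n) / q ^ n)"
proof -
  have "summable (\<lambda>n. real (Suc n) * (1 / q) ^ n)"
    using assms geometric_deriv_sums[of "1 / q"] by (auto simp: sums_iff)
  then show ?thesis by (simp add: power_one_over)
qed

lemma one_div_power_sums:
  assumes "1 < (p::real)"
  shows "(\<lambda>i. 1 / p ^ i) sums (p / (p - 1))"
proof -
  have "1 - 1 / p = (p - 1) / p" using assms by (simp add: diff_divide_distrib)
  then show ?thesis using geometric_sums[of "1 / p"] assms by (simp add: power_one_over)
qed

lemma eventually_prod_positive:
  assumes "\<And>i s. 0 < s \<Longrightarrow> Q i s"
  shows "eventually (\<lambda>(i, s::nat). Q i s) (at_top \<times>\<^sub>F sequentially)"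
  unfolding eventually_prod_filter
proof (intro exI conjI allI impI)
  show "eventually (\<lambda>_. True) (at_top :: 'a filter)" by simp
  show "eventually (\<lambda>s. 0 < s) (sequentially :: nat filter)" by (rule eventually_gt_at_top)
  show "case (i, s) of (i, s) \<Rightarrow> Q i s" if "0 < s" for i s using assms[OF that] by simp
qed

text \<open>Dominated convergence, applied to the inner and then to the outer series. The linear
  factors in the bound reflect that q-integers at \<open>b = 1\<close> grow linearly.\<close>

lemma double_tannery:
  fixes g :: "nat \<Rightarrow> nat \<Rightarrow> nat \<Rightarrow> real"
  assumes lim: "\<And>i j. (\<lambda>s. g i j s) \<longlonglongrightarrow> L i j"
    and bound: "\<And>i j s. 0 < s \<Longrightarrow> 0 \<le> g i j s \<and> g i j s \<le> C * real (Suc i) * real (Suc j)"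
    and q: "1 < q" and r: "1 < r"
  shows "(\<lambda>s. \<Sum>i. (\<Sum>j. g i j s / r ^ j) / q ^ i) \<longlonglongrightarrow> (\<Sum>i. (\<Sum>j. L i j / r ^ j) / q ^ i)"
proof -
  define R where "R = (\<Sum>j. real (Suc j) / r ^ j)"
  note sr = summable_Suc_div_power[OF r] and sq = summable_Suc_div_power[OF q]
  have srC: "summable (\<lambda>j. C * real (Suc i) * (real (Suc j) / r ^ j))" for i
    by (intro summable_mult sr)
  have nn: "0 \<le> g i j s / r ^ j" if "0 < s" for i j s using bound[OF that] r by simp
  have le: "g i j s / r ^ j \<le> C * real (Suc i) * (real (Suc j) / r ^ j)" if "0 < s" for i j s
    using divide_right_mono[OF conjunct2[OF bound[OF that, of i j]], of "r ^ j"] r by simp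
  have inner: "(\<lambda>s. \<Sum>j. g i j s / r ^ j) \<longlonglongrightarrow> (\<Sum>j. L i j / r ^ j)" for i
  proof -
    have "\<forall>\<^sub>F (j, s) in at_top \<times>\<^sub>F sequentially. norm (g i j s / r ^ j) \<le> C * real (Suc i) * (real (Suc j) / r ^ j)"
    proof (rule eventually_prod_positive)
      fix j s :: nat assume "0 < s"
      from nn[OF this, of i j] le[OF this, of i j]
      show "norm (g i j s / r ^ j) \<le> C * real (Suc i) * (real (Suc j) / r ^ j)" by (simp only: real_norm_def abs_of_nonneg)
    qed
    note ev = this
    have "(\<lambda>s. g i j s / r ^ j) \<longlonglongrightarrow> L i j / r ^ j" for j
      using r by (intro tendsto_intros lim) auto
    from tannerys_theorem[where a = "\<lambda>j s. g i j s / r ^ j", OF this ev srC[of i] sequentially_bot]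
    show ?thesis by (elim conjE)
  qed
  have out_nn: "0 \<le> (\<Sum>j. g i j s / r ^ j)" and out_le: "(\<Sum>j. g i j s / r ^ j) \<le> C * real (Suc i) * R" if "0 < s" for i s
  proof -
    have s: "summable (\<lambda>j. g i j s / r ^ j)"
      by (rule summable_comparison_test'[OF srC[of i], of 0]) (use nn[OF that, of i] le[OF that, of i] in \<open>simp only: real_norm_def abs_of_nonneg\<close>)
    show "0 \<le> (\<Sum>j. g i j s / r ^ j)" by (rule suminf_nonneg[OF s nn[OF that]])
    have "(\<Sum>j. g i j s / r ^ j) \<le> (\<Sum>j. C * real (Suc i) * (real (Suc j) / r ^ j))"
      by (rule suminf_le[OF le[OF that] s srC])
    also have "\<dots> = C * real (Suc i) * R" unfolding R_def by (rule suminf_mult[OF sr])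
    finally show "(\<Sum>j. g i j s / r ^ j) \<le> C * real (Suc i) * R" .
  qed
  have le': "norm ((\<Sum>j. g i j s / r ^ j) / q ^ i) \<le> C * R * (real (Suc i) / q ^ i)" if "0 < s" for i s
  proof -
    have "0 \<le> (\<Sum>j. g i j s / r ^ j) / q ^ i" using out_nn[OF that, of i] q by simp
    moreover have "(\<Sum>j. g i j s / r ^ j) / q ^ i \<le> C * real (Suc i) * R / q ^ i"
      using out_le[OF that, of i] q by (intro divide_right_mono) auto
    moreover have "C * real (Suc i) * R / q ^ i = C * R * (real (Suc i) / q ^ i)" by (simp add: mult_ac)
    ultimately show ?thesis by (simp only: real_norm_def abs_of_nonneg)
  qed
  have "\<forall>\<^sub>F (i, s) in at_top \<times>\<^sub>F sequentially. norm ((\<Sum>j. g i j s / r ^ j) / q ^ i) \<le> C * R * (real (Suc i) / q ^ i)"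
    by (rule eventually_prod_positive) (rule le')
  note ev = this
  have "(\<lambda>s. (\<Sum>j. g i j s / r ^ j) / q ^ i) \<longlonglongrightarrow> (\<Sum>j. L i j / r ^ j) / q ^ i" for i
    using q by (intro tendsto_intros inner) auto
  from tannerys_theorem[where a = "\<lambda>i s. (\<Sum>j. g i j s / r ^ j) / q ^ i", OF this ev summable_mult[OF sq, of "C * R"] sequentially_bot]
  show ?thesis by (elim conjE)
qed

lemma weighted_mean_pos:
  fixes w v :: "'k \<Rightarrow> real"
  assumes fin: "finite K" and w: "\<And>k. k \<in> K \<Longrightarrow> 0 \<le> w k" "(\<Sum>k\<in>K. w k) = 1"
    and v: "\<And>k. k \<in> K \<Longrightarrow> 0 < v k"
  shows "0 < (\<Sum>k\<in>K. w k * v k)"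
proof -
  obtain k where k: "k \<in> K" "w k \<noteq> 0"
    using w(2) by (metis sum.neutral zero_neq_one)
  show ?thesis
  proof (rule sum_pos2[OF fin k(1)])
    show "0 < w k * v k" using w(1)[OF k(1)] k v[OF k(1)] by simp
  qed (use w v in \<open>simp add: less_imp_le\<close>)
qed

text \<open>For positive \<open>v\<close> the relative error of a weighted mean is at most the
  largest relative error of its terms, whatever the weights are at that \<open>n\<close>; the sum of
  the errors stands in for the largest one.\<close>

lemma interpolation_ratio:
  fixes w a v :: "nat \<Rightarrow> nat \<Rightarrow> real"
  assumes fin: "finite K" and w: "\<And>n k. k \<in> K \<Longrightarrow> 0 \<le> w k n" "\<And>n. (\<Sum>k\<in>K. w k n) = 1"
    and v: "\<forall>\<^sub>F n in sequentially. \<forall>k\<in>K. 0 < v k n"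
    and lim: "\<And>k. k \<in> K \<Longrightarrow> (\<lambda>n. a k n / v k n) \<longlonglongrightarrow> 1"
  shows "(\<lambda>n. (\<Sum>k\<in>K. w k n * a k n) / (\<Sum>k\<in>K. w k n * v k n)) \<longlonglongrightarrow> 1"
proof -
  define m where "m n = (\<Sum>k\<in>K. \<bar>a k n / v k n - 1\<bar>)" for n
  have "m \<longlonglongrightarrow> (\<Sum>k\<in>K. \<bar>1 - 1\<bar>)" unfolding m_def[abs_def] by (intro tendsto_intros lim)
  then have m0: "m \<longlonglongrightarrow> 0" by simp
  have "\<forall>\<^sub>F n in sequentially. norm ((\<Sum>k\<in>K. w k n * a k n) / (\<Sum>k\<in>K. w k n * v k n) - 1) \<le> m n"
    using v
  proof eventually_elim
    case (elim n)
    define V where "V = (\<Sum>k\<in>K. w k n * v k n)"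
    have V: "0 < V"
      unfolding V_def by (rule weighted_mean_pos[OF fin w]) (use elim in auto)
    have "\<bar>(\<Sum>k\<in>K. w k n * a k n) - V\<bar> = \<bar>\<Sum>k\<in>K. w k n * v k n * (a k n / v k n - 1)\<bar>"
      unfolding V_def sum_subtractf[symmetric] using elim
      by (intro arg_cong[of _ _ abs] sum.cong refl) (auto simp: field_simps)
    also have "\<dots> \<le> (\<Sum>k\<in>K. \<bar>w k n * v k n * (a k n / v k n - 1)\<bar>)" by (rule sum_abs)
    also have "\<dots> \<le> (\<Sum>k\<in>K. w k n * v k n * m n)"
    proof (rule sum_mono)
      fix k assume k: "k \<in> K"
      have "\<bar>a k n / v k n - 1\<bar> \<le> m n" unfolding m_def
        by (rule member_le_sum[OF k _ fin]) simp
      moreover have "0 \<le> w k n * v k n" using w(1)[OF k, of n] elim k by (simp add: less_imp_le)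
      ultimately show "\<bar>w k n * v k n * (a k n / v k n - 1)\<bar> \<le> w k n * v k n * m n"
        unfolding abs_mult[of "w k n * v k n"] by (simp only: abs_of_nonneg mult_left_mono)
    qed
    also have "\<dots> = V * m n" unfolding V_def by (simp add: sum_distrib_right)
    finally have "\<bar>(\<Sum>k\<in>K. w k n * a k n) - V\<bar> / V \<le> m n"
      using V by (simp add: pos_divide_le_eq mult.commute)
    moreover have "(\<Sum>k\<in>K. w k n * a k n) / V - 1 = ((\<Sum>k\<in>K. w k n * a k n) - V) / V"
      using V by (simp add: diff_divide_distrib)
    ultimately show ?case using V unfolding V_def[symmetric] by (simp add: abs_divide)
  qed
  from Lim_null_comparison[OF this m0] show ?thesis by (simp add: LIM_zero_iff)
qed

section \<open>Growth and generating function of the q-integers\<close>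

context
  fixes b :: real
  assumes b: "1 \<le> b"
begin

lemma qint_ge: "real n \<le> qint b n"
proof (induction n)
  case (Suc n)
  have "real n \<le> b * qint b n" using Suc b mult_right_mono[of 1 b "qint b n"] by simp
  then show ?case by (simp add: qint_Suc)
qed simp

lemma qint_le: "qint b n \<le> real n * b ^ n"
proof (induction n)
  case (Suc n)
  have "b * qint b n \<le> b * (real n * b ^ n)" using Suc b by (intro mult_left_mono) auto
  moreover have "1 \<le> b ^ Suc n" using b by (rule one_le_power)
  ultimately show ?case by (simp add: qint_Suc algebra_simps)
qed simp

lemma qint_at_top: "filterlim (qint b) at_top sequentially"
  by (rule filterlim_at_top_mono[OF filterlim_real_sequentially]) (simp add: qint_ge)

lemma inverse_qint: "(\<lambda>s. 1 / qint b s) \<longlonglongrightarrow> 0"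
  using qint_at_top by (intro tendsto_divide_0[OF tendsto_const] filterlim_at_top_imp_at_infinity)

lemma qint_shift_ratio: "(\<lambda>s. qint b (s + n) / qint b s) \<longlonglongrightarrow> b ^ n"
proof -
  have "(\<lambda>s. qint b n * (1 / qint b s) + b ^ n) \<longlonglongrightarrow> qint b n * 0 + b ^ n"
    by (intro tendsto_intros inverse_qint)
  moreover have "\<forall>\<^sub>F s in sequentially. qint b n * (1 / qint b s) + b ^ n = qint b (s + n) / qint b s"
    using eventually_gt_at_top[of 0]
  proof eventually_elim
    case (elim s)
    then have "0 < qint b s" using b by (simp add: qint_pos)
    moreover have "qint b (s + n) = qint b n + b ^ n * qint b s" using qint_add[of b n s] by (simp add: add.commute)
    ultimately show ?case by (simp add: add_divide_distrib)
  qed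
  ultimately show ?thesis by (auto intro: Lim_transform_eventually)
qed

lemma qint_ratio: "(\<lambda>s. qint b s / qint b (s + n)) \<longlonglongrightarrow> 1 / b ^ n"
proof -
  have "(\<lambda>s. 1 / (qint b (s + n) / qint b s)) \<longlonglongrightarrow> 1 / b ^ n"
    using b by (intro tendsto_intros qint_shift_ratio) auto
  then show ?thesis by simp
qed

lemma qint_ratio_bounds: "0 < s \<Longrightarrow> 0 \<le> qint b s / qint b (s + n) \<and> qint b s / qint b (s + n) \<le> 1 / b ^ n"
proof -
  assume "0 < s"
  then have "0 < qint b s" "0 < qint b (s + n)" using b by (simp_all add: qint_pos)
  moreover have "b ^ n * qint b s \<le> qint b (s + n)"
    using qint_add[of b n s] qint_nonneg[of b n] b by (simp add: add.commute)
  ultimately show ?thesis using b by (simp add: pos_divide_le_eq pos_le_divide_eq mult.commute)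
qed

text \<open>The recursion of \<open>qint\<close> gives a linear equation for its generating function
  \<open>S\<close>. The sum is used with \<open>p = q * b\<^sup>2\<close> and
  \<open>p = r * b\<^sup>2\<close>, where it produces the constants \<open>Cq\<close> and
  \<open>Cr\<close>.\<close>

lemma qint_sum:
  assumes "b < p"
  shows "summable (\<lambda>i. qint b i / p ^ i)" "(\<Sum>i. (1 + 2 * b * qint b i) / p ^ i) = p * (p + b) / ((p - 1) * (p - b))"
proof -
  have p: "1 < p" "0 < p" using assms b by auto
  have z: "1 < p / b" using assms b by simp
  show s: "summable (\<lambda>i. qint b i / p ^ i)"
  proof (rule summable_comparison_test'[OF summable_Suc_div_power[OF z], of 0])
    fix i
    note qint_le[of i]
    also have "real i * b ^ i \<le> real (Suc i) * b ^ i" using b by (intro mult_right_mono) auto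
    finally have "qint b i / p ^ i \<le> real (Suc i) * b ^ i / p ^ i" using p by (intro divide_right_mono) auto
    then show "norm (qint b i / p ^ i) \<le> real (Suc i) / (p / b) ^ i"
      using p b qint_nonneg[of b i] by (simp add: power_divide)
  qed
  define S where "S = (\<Sum>i. qint b i / p ^ i)"
  define O1 where "O1 = (\<Sum>i. 1 / p ^ i)"
  note g = one_div_power_sums[OF p(1)]
  have O1: "O1 = p / (p - 1)"
    unfolding O1_def by (rule sums_unique[OF g, symmetric])
  have "S = qint b 0 + (\<Sum>i. qint b (Suc i) / p ^ i) / p"
    unfolding S_def by (rule suminf_div_power_split[OF s])
  also have "(\<Sum>i. qint b (Suc i) / p ^ i) = 1 * O1 + b * S"
    unfolding S_def O1_def by (rule suminf_div_power_linear[OF sums_summable[OF g] s]) (simp add: qint_Suc)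
  finally have "S * p = (qint b 0 + (1 * O1 + b * S) / p) * p" by (rule arg_cong)
  then have "S * (p - b) = O1" using p by (simp add: right_diff_distrib)
  then have S: "S = O1 / (p - b)" using assms by (simp add: eq_divide_eq)
  have "(\<Sum>i. (1 + 2 * b * qint b i) / p ^ i) = 1 * O1 + (2 * b) * S"
    unfolding S_def O1_def by (rule suminf_div_power_linear[OF sums_summable[OF g] s]) simp
  also have "\<dots> = O1 * (p + b) / (p - b)"
    unfolding S using assms by (simp add: field_simps)
  also have "\<dots> = p * (p + b) / ((p - 1) * (p - b))"
    by (simp add: O1)
  finally show "(\<Sum>i. (1 + 2 * b * qint b i) / p ^ i) = p * (p + b) / ((p - 1) * (p - b))" .
qed

end

section \<open>Affine dependence on the start and on the target\<close>

context dl_kernel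
begin

lemma kernel_pos: "0 < s \<Longrightarrow> 0 < qint b s"
  using b by (simp add: qint_pos)

lemma N_eq: "0 < t \<Longrightarrow> N a c t = (b + 1) * b ^ (t - c) *
    (1 + b * (qint b a + qint b c) - (b + 1) * qint b a * qint b c / qint b t) / (qint b (t + 1) * qint b (t + 2))"
proof -
  assume t: "0 < t"
  have "(qint b t * (1 + b * (qint b a + qint b c)) - (b + 1) * qint b a * qint b c) / qint b t
      = 1 + b * (qint b a + qint b c) - (b + 1) * qint b a * qint b c / qint b t"
    using kernel_pos[OF t] by (simp add: diff_divide_distrib)
  then show ?thesis
    unfolding confinement_def using t by (simp only: if_False times_divide_eq_right[symmetric] flip: divide_divide_eq_left) simp
qed

text \<open>The numerator is affine in the q-integer of the start, and \<open>qint b (u + i)\<close>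
  is affine in \<open>qint b u\<close>. Hence the value at \<open>u\<close> interpolates those at
  \<open>0\<close> and \<open>s\<close>, with weights that do not depend on the overshoots and so
  pass through both series.\<close>

lemma N_affine_left:
  assumes "0 < s"
  shows "N (u + i) c (s + i + j) = (qint b s - qint b u) / qint b s * N i c (s + i + j) + qint b u / qint b s * N (s + i) c (s + i + j)"
proof -
  define t where "t = s + i + j"
  define D where "D = (b + 1) * b ^ (t - c) / (qint b t * qint b (t + 1) * qint b (t + 2))"
  define A where "A = qint b t * (1 + b * qint b c)"
  define B where "B = qint b t * b - (b + 1) * qint b c"
  have "qint b t * (1 + b * (qint b k + qint b c)) - (b + 1) * qint b k * qint b c = A + B * qint b k" for k
    unfolding A_def B_def by algebra
  then have N: "N k c t = D * (A + B * qint b k)" for k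
    unfolding confinement_def D_def using assms by (simp add: t_def)
  have sh: "qint b (k + i) = qint b i + b ^ i * qint b k" for k
    using qint_add[of b i k] by (simp add: add.commute)
  have "qint b s \<noteq> 0" using kernel_pos[OF assms] by simp
  then show ?thesis
    unfolding t_def[symmetric] N sh by (simp add: field_simps)
qed

text \<open>As for the start, except that the power \<open>b ^ (t - c)\<close> contains the target;
  the factor \<open>b ^ d\<close> compensates for it and leaves \<open>b ^ (s + j)\<close>.\<close>

lemma N_affine_right:
  assumes "0 < s" "d \<le> s"
  shows "b ^ d * N a (d + i) (s + i + j)
    = (qint b s - qint b d) / qint b s * N a i (s + i + j) + qint b d / qint b s * (b ^ s * N a (s + i) (s + i + j))"
proof -
  define t where "t = s + i + j"
  define D where "D = (b + 1) * b ^ (s + j) / (qint b t * qint b (t + 1) * qint b (t + 2))"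
  define A where "A = qint b t * (1 + b * qint b a)"
  define B where "B = qint b t * b - (b + 1) * qint b a"
  have K: "qint b t * (1 + b * (qint b a + qint b k)) - (b + 1) * qint b a * qint b k = A + B * qint b k" for k
    unfolding A_def B_def by algebra
  have N: "b ^ k * N a (k + i) t = D * (A + B * qint b (k + i))" if "k \<le> s" for k
  proof -
    have "b ^ k * b ^ (t - (k + i)) = b ^ (s + j)"
      using that by (simp add: t_def flip: power_add)
    then have "b ^ k * ((b + 1) * b ^ (t - (k + i))) = (b + 1) * b ^ (s + j)" by (simp add: mult.left_commute)
    moreover have "t \<noteq> 0" "b + 1 \<noteq> 0" using assms b0 by (simp_all add: t_def)
    ultimately show ?thesis
      unfolding confinement_def D_def K by simp
  qed
  have sh: "qint b (k + i) = qint b i + b ^ i * qint b k" for k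
    using qint_add[of b i k] by (simp add: add.commute)
  have "qint b s \<noteq> 0" using kernel_pos[OF assms(1)] by simp
  then have "D * (A + B * qint b (d + i)) = (qint b s - qint b d) / qint b s * (D * (A + B * qint b (0 + i))) + qint b d / qint b s * (D * (A + B * qint b (s + i)))"
    unfolding sh by (simp add: field_simps)
  also have "D * (A + B * qint b (d + i)) = b ^ d * N a (d + i) t" using N[OF assms(2)] by simp
  also have "D * (A + B * qint b (0 + i)) = N a i t" using N[of 0] by simp
  also have "D * (A + B * qint b (s + i)) = b ^ s * N a (s + i) t" using N[OF order_refl] by simp
  finally show ?thesis by (simp only: t_def)
qed

lemma Phi_affine_left:
  assumes "0 < s" "u \<le> s" "d \<le> s"
  shows "Phi u d s = (qint b s - qint b u) / qint b s * Phi 0 d s + qint b u / qint b s * Phi s d s"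
proof -
  have "M (u + i) (d + i) (s + i) = (qint b s - qint b u) / qint b s * M (0 + i) (d + i) (s + i) + qint b u / qint b s * M (s + i) (d + i) (s + i)" for i
    unfolding upper_sum_def
  proof (intro suminf_div_power_linear M_props(1))
    fix j
    show "N (u + i) (d + i) (s + i + j) = (qint b s - qint b u) / qint b s * N (0 + i) (d + i) (s + i + j)
        + qint b u / qint b s * N (s + i) (d + i) (s + i + j)"
      using N_affine_left[OF assms(1), of u i "d + i" j] by simp
  qed (use assms in auto)
  then show ?thesis
    unfolding green_factor_def using assms
    by (intro suminf_div_power_linear Phi_props(1)) auto
qed

lemma Phi_affine_right:
  assumes "0 < s" "u \<le> s" "d \<le> s"
  shows "b ^ d * Phi u d s = (qint b s - qint b d) / qint b s * Phi u 0 s + qint b d / qint b s * (b ^ s * Phi u s s)"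
proof -
  have b: "b ^ d \<noteq> 0" using b by simp
  define la where "la = (qint b s - qint b d) / qint b s"
  define mu where "mu = qint b d / qint b s"
  define x where "x = la / b ^ d"
  define y where "y = mu * b ^ s / b ^ d"
  have N: "N a (d + i) (s + i + j) = x * N a i (s + i + j) + y * N a (s + i) (s + i + j)" for a i j
  proof -
    have "N a (d + i) (s + i + j) = (la * N a i (s + i + j) + mu * (b ^ s * N a (s + i) (s + i + j))) / b ^ d"
      unfolding la_def mu_def N_affine_right[OF assms(1,3), of a i j, symmetric] using b by simp
    then show ?thesis by (simp add: x_def y_def add_divide_distrib)
  qed
  have "M (u + i) (d + i) (s + i) = x * M (u + i) (0 + i) (s + i) + y * M (u + i) (s + i) (s + i)" for i
    unfolding upper_sum_def
  proof (intro suminf_div_power_linear M_props(1))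
    fix j
    show "N (u + i) (d + i) (s + i + j) = x * N (u + i) (0 + i) (s + i + j) + y * N (u + i) (s + i) (s + i + j)"
      using N[of "u + i" i j] by simp
  qed (use assms in auto)
  then have "Phi u d s = x * Phi u 0 s + y * Phi u s s"
    unfolding green_factor_def using assms
    by (intro suminf_div_power_linear Phi_props(1)) auto
  then show ?thesis using b unfolding la_def[symmetric] mu_def[symmetric] by (simp add: x_def y_def distrib_left)
qed

end

lemma suminf_product:
  fixes L :: "nat \<Rightarrow> nat \<Rightarrow> real"
  assumes "\<And>i j. L i j / r ^ j = x * P i * Q j" "(\<lambda>i. P i / q ^ i) sums A" "Q sums B"
  shows "(\<Sum>i. (\<Sum>j. L i j / r ^ j) / q ^ i) = x * A * B"
proof -
  have "(\<Sum>j. L i j / r ^ j) = x * P i * B" for i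
    using sums_mult[OF assms(3), of "x * P i"] by (simp add: assms(1) sums_iff)
  then have "(\<lambda>i. (\<Sum>j. L i j / r ^ j) / q ^ i) = (\<lambda>i. (x * B) * (P i / q ^ i))" by (simp add: mult_ac)
  then show ?thesis using sums_mult[OF assms(2), of "x * B"] by (simp add: sums_iff mult_ac)
qed

section \<open>Limits of the corner values\<close>

context dl_kernel
begin

lemma Phi_scale:
  assumes "a \<le> t" "c \<le> t"
  shows "(\<Sum>i. (\<Sum>j. (w * N (a + i) (c + i) (t + i + j)) / r ^ j) / q ^ i) = w * Phi a c t"
proof -
  have "(\<Sum>j. (w * N (a + i) (c + i) (t + i + j)) / r ^ j) = w * M (a + i) (c + i) (t + i)" for i
  proof -
    have "(\<Sum>j. w * (N (a + i) (c + i) (t + i + j) / r ^ j)) = w * (\<Sum>j. N (a + i) (c + i) (t + i + j) / r ^ j)"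
      using assms by (intro suminf_mult M_props) auto
    then show ?thesis by (simp add: upper_sum_def)
  qed
  moreover have "(\<Sum>i. w * (M (a + i) (c + i) (t + i) / q ^ i)) = w * (\<Sum>i. M (a + i) (c + i) (t + i) / q ^ i)"
    using assms by (intro suminf_mult Phi_props)
  ultimately show ?thesis by (simp add: green_factor_def)
qed

text \<open>The frame of the three corners: \<open>w\<close> is the normalization and
  \<open>h\<close> what is left besides two ratios of q-integers. These ratios tend to
  \<open>b ^ (- (i + j + 1))\<close> and \<open>b ^ (- (i + j + 2))\<close>, whence the exponent
  \<open>2 * i + 2 * j + 3\<close>, and they are bounded by their limits, which leaves room for
  \<open>h\<close> to grow like \<open>b ^ (2 * i + 2 * j)\<close>.\<close>

lemma corner_limit:
  assumes ac: "\<And>s. a s \<le> s" "\<And>s. c s \<le> s" and w: "\<And>s. 0 \<le> w s"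
    and eq: "\<And>i j s. 0 < s \<Longrightarrow> w s * N (a s + i) (c s + i) (s + i + j)
      = (b + 1) * h i j s * (qint b s / qint b (s + (i + j + 1))) * (qint b s / qint b (s + (i + j + 2)))"
    and lim: "\<And>i j. (\<lambda>s. h i j s) \<longlonglongrightarrow> H i j"
    and bound: "\<And>i j s. 0 < s \<Longrightarrow> h i j s \<le> C * real (Suc i) * real (Suc j) * b ^ (2 * i + 2 * j)"
    and C: "0 \<le> C"
  shows "(\<lambda>s. w s * Phi (a s) (c s) s) \<longlonglongrightarrow> (\<Sum>i. (\<Sum>j. (b + 1) * H i j / b ^ (2 * i + 2 * j + 3) / r ^ j) / q ^ i)"
proof -
  have "(\<lambda>s. \<Sum>i. (\<Sum>j. (w s * N (a s + i) (c s + i) (s + i + j)) / r ^ j) / q ^ i)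
      \<longlonglongrightarrow> (\<Sum>i. (\<Sum>j. (b + 1) * H i j / b ^ (2 * i + 2 * j + 3) / r ^ j) / q ^ i)"
  proof (rule double_tannery[OF _ _ q r])
    fix i j
    have "(\<lambda>s. (b + 1) * h i j s * (qint b s / qint b (s + (i + j + 1))) * (qint b s / qint b (s + (i + j + 2))))
      \<longlonglongrightarrow> (b + 1) * H i j * (1 / b ^ (i + j + 1)) * (1 / b ^ (i + j + 2))"
      by (intro tendsto_mult tendsto_const lim qint_ratio b)
    moreover have "(b + 1) * H i j * (1 / b ^ (i + j + 1)) * (1 / b ^ (i + j + 2)) = (b + 1) * H i j / b ^ (2 * i + 2 * j + 3)"
    proof -
      have "2 * i + 2 * j + 3 = (i + j + 1) + (i + j + 2)" by simp
      then show ?thesis by (simp only: power_add) simp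
    qed
    moreover have "\<forall>\<^sub>F s in sequentially. (b + 1) * h i j s * (qint b s / qint b (s + (i + j + 1))) * (qint b s / qint b (s + (i + j + 2)))
      = w s * N (a s + i) (c s + i) (s + i + j)"
      using eventually_gt_at_top[of 0] by eventually_elim (rule eq[symmetric])
    ultimately show "(\<lambda>s. w s * N (a s + i) (c s + i) (s + i + j)) \<longlonglongrightarrow> (b + 1) * H i j / b ^ (2 * i + 2 * j + 3)"
      by (auto intro: Lim_transform_eventually)
  next
    fix i j s :: nat assume s: "0 < s"
    define B where "B = C * real (Suc i) * real (Suc j)"
    define r1 where "r1 = qint b s / qint b (s + (i + j + 1))"
    define r2 where "r2 = qint b s / qint b (s + (i + j + 2))"
    have B: "0 \<le> B" using C by (simp add: B_def)
    have r1: "0 \<le> r1" "r1 \<le> 1 / b ^ (i + j + 1)" unfolding r1_def by (rule conjunct1 conjunct2, rule qint_ratio_bounds[OF b s])+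
    have r2: "0 \<le> r2" "r2 \<le> 1 / b ^ (i + j + 2)" unfolding r2_def by (rule conjunct1 conjunct2, rule qint_ratio_bounds[OF b s])+
    have "1 / b ^ (i + j + 1) \<le> 1 / b ^ (i + j)" "1 / b ^ (i + j + 2) \<le> 1 / b ^ (i + j)"
      using b by (intro divide_left_mono power_increasing; simp)+
    then have r12: "r1 * r2 \<le> 1 / b ^ (i + j) * (1 / b ^ (i + j))"
      using r1 r2 b by (intro mult_mono) auto
    have "h i j s * (r1 * r2) \<le> B * b ^ (2 * i + 2 * j) * (r1 * r2)"
      using bound[OF s, of i j] r1 r2 by (intro mult_right_mono) (auto simp: B_def)
    also have "\<dots> \<le> B * b ^ (2 * i + 2 * j) * (1 / b ^ (i + j) * (1 / b ^ (i + j)))"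
      using B b by (intro mult_left_mono r12) auto
    also have "\<dots> = B"
    proof -
      have "2 * i + 2 * j = (i + j) + (i + j)" by simp
      then have "b ^ (2 * i + 2 * j) = b ^ (i + j) * b ^ (i + j)" by (simp only: power_add)
      then show ?thesis using b by simp
    qed
    finally have "(b + 1) * (h i j s * (r1 * r2)) \<le> (b + 1) * B" using b by (intro mult_left_mono) auto
    moreover have "w s * N (a s + i) (c s + i) (s + i + j) = (b + 1) * (h i j s * (r1 * r2))"
      unfolding eq[OF s] r1_def r2_def by (simp only: mult.assoc)
    moreover have "0 \<le> w s * N (a s + i) (c s + i) (s + i + j)"
      using w ac[of s] b by (intro mult_nonneg_nonneg confinement_nonneg) (auto intro: le_SucI add_right_mono trans_le_add1)
    ultimately show "0 \<le> w s * N (a s + i) (c s + i) (s + i + j) \<and>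
        w s * N (a s + i) (c s + i) (s + i + j) \<le> (b + 1) * C * real (Suc i) * real (Suc j)"
      by (simp only: B_def mult.assoc)
  qed
  then show ?thesis by (simp only: Phi_scale[OF ac])
qed

text \<open>Multiplied by \<open>b - 1\<close>, the numbers \<open>A0\<close>, \<open>Cq\<close> and
  \<open>Cr\<close> are the constants of the case with drift; for \<open>b = 1\<close> they are
  themselves the constants of the critical case. Without this factor one set of limits serves both
  cases.\<close>

definition "A0 = (b + 1) * q * r / ((q * b - 1) * (r * b - 1))"
definition "Cq = (q * b + 1) / (q * b\<^sup>2 - 1)"
definition "Cr = (r * b + 1) / (r * b\<^sup>2 - 1)"

lemma qb: "1 < q * b" "1 < r * b" "b < q * b\<^sup>2" "b < r * b\<^sup>2" "1 < q * b\<^sup>2" "1 < r * b\<^sup>2"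
proof -
  have *: "1 < x * b" "b < x * b\<^sup>2" "1 < x * b\<^sup>2" if "1 < x" for x :: real
  proof -
    have "1 * 1 < x * b" using that b by (intro mult_less_le_imp_less) auto
    then show xb: "1 < x * b" by simp
    then have "1 * b < x * b * b" using b by (intro mult_strict_right_mono) auto
    then show "b < x * b\<^sup>2" by (simp add: power2_eq_square mult.assoc)
    then show "1 < x * b\<^sup>2" using b by simp
  qed
  show "1 < q * b" "1 < r * b" "b < q * b\<^sup>2" "b < r * b\<^sup>2" "1 < q * b\<^sup>2" "1 < r * b\<^sup>2"
    using *[OF q] *[OF r] by auto
qed

lemma one_plus_qint_sums:
  assumes "b < p"
  shows "(\<lambda>i. (1 + 2 * b * qint b i) / p ^ i) sums (p * (p + b) / ((p - 1) * (p - b)))"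
proof -
  have p: "1 < p" using assms b by simp
  have "summable (\<lambda>i. 1 / p ^ i + 2 * b * (qint b i / p ^ i))"
    by (intro summable_add summable_mult qint_sum(1)[OF b assms] sums_summable[OF one_div_power_sums[OF p]])
  then have "summable (\<lambda>i. (1 + 2 * b * qint b i) / p ^ i)" by (simp add: add_divide_distrib)
  then show ?thesis using qint_sum(2)[OF b assms] by (simp add: sums_iff)
qed

lemma qint_scaled_bound: "qint b n \<le> real n * b ^ n" "1 \<le> b ^ n"
  using qint_le[OF b] b by (auto intro: one_le_power)

lemma corner_value:
  "(b + 1) / b ^ 3 * (q * b\<^sup>2 * (q * b\<^sup>2 + b) / ((q * b\<^sup>2 - 1) * (q * b\<^sup>2 - b))) * (r * b / (r * b - 1)) = A0 * Cq"
  "(b + 1) / b ^ 3 * (r * b\<^sup>2 * (r * b\<^sup>2 + b) / ((r * b\<^sup>2 - 1) * (r * b\<^sup>2 - b))) * (q * b / (q * b - 1)) = A0 * Cr"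
proof -
  have *: "(b + 1) / b ^ 3 * (x * b\<^sup>2 * (x * b\<^sup>2 + b) / ((x * b\<^sup>2 - 1) * (x * b\<^sup>2 - b))) * (y * b / (y * b - 1))
      = (b + 1) * x * y / ((x * b - 1) * (y * b - 1)) * ((x * b + 1) / (x * b\<^sup>2 - 1))" for x y
  proof -
    have "x * b\<^sup>2 + b = b * (x * b + 1)" "x * b\<^sup>2 - b = b * (x * b - 1)" by (simp_all add: algebra_simps power2_eq_square)
    then show ?thesis using b0 by (simp only:) (simp add: power2_eq_square power3_eq_cube mult_ac)
  qed
  show "(b + 1) / b ^ 3 * (q * b\<^sup>2 * (q * b\<^sup>2 + b) / ((q * b\<^sup>2 - 1) * (q * b\<^sup>2 - b))) * (r * b / (r * b - 1)) = A0 * Cq"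
    unfolding A0_def Cq_def by (rule *)
  show "(b + 1) / b ^ 3 * (r * b\<^sup>2 * (r * b\<^sup>2 + b) / ((r * b\<^sup>2 - 1) * (r * b\<^sup>2 - b))) * (q * b / (q * b - 1)) = A0 * Cr"
    unfolding A0_def Cr_def * by (simp only: mult_ac)
qed

text \<open>Start and target are both within \<open>i\<close> of the bottom of a long range. The
  product of their q-integers is divided by that of the range and disappears, so
  \<open>1 + 2 * b * qint b i\<close> remains.\<close>

lemma corner_00: "(\<lambda>s. (qint b s)\<^sup>2 / b ^ s * Phi 0 0 s) \<longlonglongrightarrow> A0 * Cq"
proof -
  have "(\<lambda>s. (qint b s)\<^sup>2 / b ^ s * Phi 0 0 s)
     \<longlonglongrightarrow> (\<Sum>i. (\<Sum>j. (b + 1) * (b ^ j * (1 + 2 * b * qint b i)) / b ^ (2 * i + 2 * j + 3) / r ^ j) / q ^ i)"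
  proof (rule corner_limit[where C = "1 + 2 * b"
      and h = "\<lambda>i j s. b ^ j * (1 + 2 * b * qint b i - (b + 1) * qint b i * qint b i * (1 / qint b (s + (i + j))))"])
    fix i j s :: nat assume s: "0 < s"
    have "b ^ (s + i + j - (0 + i)) = b ^ s * b ^ j" by (simp flip: power_add)
    then show "(qint b s)\<^sup>2 / b ^ s * N (0 + i) (0 + i) (s + i + j) =
      (b + 1) * (b ^ j * (1 + 2 * b * qint b i - (b + 1) * qint b i * qint b i * (1 / qint b (s + (i + j)))))
      * (qint b s / qint b (s + (i + j + 1))) * (qint b s / qint b (s + (i + j + 2)))"
      using s b0 by (subst N_eq) (simp_all add: power2_eq_square add.assoc)
  next
    fix i j
    have "(\<lambda>s. 1 / qint b (s + (i + j))) \<longlonglongrightarrow> 0"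
      using LIMSEQ_ignore_initial_segment[OF inverse_qint[OF b], of "i + j"] .
    then have "(\<lambda>s. b ^ j * (1 + 2 * b * qint b i - (b + 1) * qint b i * qint b i * (1 / qint b (s + (i + j)))))
      \<longlonglongrightarrow> b ^ j * (1 + 2 * b * qint b i - (b + 1) * qint b i * qint b i * 0)"
      by (intro tendsto_mult tendsto_diff tendsto_const)
    then show "(\<lambda>s. b ^ j * (1 + 2 * b * qint b i - (b + 1) * qint b i * qint b i * (1 / qint b (s + (i + j)))))
      \<longlonglongrightarrow> b ^ j * (1 + 2 * b * qint b i)" by simp
  next
    fix i j s :: nat assume s: "0 < s"
    have "0 \<le> (b + 1) * qint b i * qint b i * (1 / qint b (s + (i + j)))"
      using b by (simp add: qint_nonneg)
    then have "1 + 2 * b * qint b i - (b + 1) * qint b i * qint b i * (1 / qint b (s + (i + j))) \<le> 1 + 2 * b * qint b i" by simp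
    also have "\<dots> \<le> b ^ i + 2 * b * (real i * b ^ i)"
      using b qint_scaled_bound[of i] by (intro add_mono mult_left_mono) auto
    also have "\<dots> = (1 + 2 * b * real i) * b ^ i" by (simp add: algebra_simps)
    also have "\<dots> \<le> ((1 + 2 * b) * real (Suc i) * real (Suc j)) * b ^ (2 * i + j)"
    proof (intro mult_mono power_increasing)
      have "1 + 2 * b * real i \<le> (1 + 2 * b) * real (Suc i) * 1" using b by (simp add: algebra_simps)
      also have "\<dots> \<le> (1 + 2 * b) * real (Suc i) * real (Suc j)" using b by (intro mult_left_mono) auto
      finally show "1 + 2 * b * real i \<le> (1 + 2 * b) * real (Suc i) * real (Suc j)" .
    qed (use b in auto)
    finally have "b ^ j * (1 + 2 * b * qint b i - (b + 1) * qint b i * qint b i * (1 / qint b (s + (i + j))))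
      \<le> b ^ j * (((1 + 2 * b) * real (Suc i) * real (Suc j)) * b ^ (2 * i + j))" using b by (intro mult_left_mono) auto
    also have "\<dots> = (1 + 2 * b) * real (Suc i) * real (Suc j) * b ^ (2 * i + 2 * j)"
    proof -
      have "2 * i + 2 * j = j + (2 * i + j)" by simp
      then show ?thesis by (simp only: power_add) (simp only: mult_ac)
    qed
    finally show "b ^ j * (1 + 2 * b * qint b i - (b + 1) * qint b i * qint b i * (1 / qint b (s + (i + j))))
      \<le> (1 + 2 * b) * real (Suc i) * real (Suc j) * b ^ (2 * i + 2 * j)" .
  qed (use b in auto)
  also have "(\<Sum>i. (\<Sum>j. (b + 1) * (b ^ j * (1 + 2 * b * qint b i)) / b ^ (2 * i + 2 * j + 3) / r ^ j) / q ^ i)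
      = (b + 1) / b ^ 3 * (q * b\<^sup>2 * (q * b\<^sup>2 + b) / ((q * b\<^sup>2 - 1) * (q * b\<^sup>2 - b))) * (r * b / (r * b - 1))"
  proof (rule suminf_product)
    fix i j :: nat
    have "2 * i + 2 * j + 3 = 2 * i + (j + (j + 3))" by simp
    then have "b ^ (2 * i + 2 * j + 3) = (b\<^sup>2) ^ i * (b ^ j * (b ^ j * b ^ 3))" by (simp only: power_add power_mult)
    then show "(b + 1) * (b ^ j * (1 + 2 * b * qint b i)) / b ^ (2 * i + 2 * j + 3) / r ^ j
      = (b + 1) / b ^ 3 * ((1 + 2 * b * qint b i) / (b\<^sup>2) ^ i) * (1 / (r * b) ^ j)"
      using b0 r by (simp add: power_mult_distrib)
  next
    show "(\<lambda>i. (1 + 2 * b * qint b i) / (b\<^sup>2) ^ i / q ^ i) sums (q * b\<^sup>2 * (q * b\<^sup>2 + b) / ((q * b\<^sup>2 - 1) * (q * b\<^sup>2 - b)))"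
      using one_plus_qint_sums[OF qb(3)] by (simp add: power_mult_distrib mult.commute)
  qed (rule one_div_power_sums[OF qb(2)])
  also have "\<dots> = A0 * Cq" by (rule corner_value)
  finally show ?thesis .
qed

text \<open>With start and target at opposite extremes, the q-integer of the target dominates the
  numerator. The limit splits into two geometric series, which is why neither \<open>Cq\<close> nor
  \<open>Cr\<close> enters.\<close>

lemma corner_0s: "(\<lambda>s. qint b s * Phi 0 s s) \<longlonglongrightarrow> A0"
proof -
  have "(\<lambda>s. qint b s * Phi 0 s s)
     \<longlonglongrightarrow> (\<Sum>i. (\<Sum>j. (b + 1) * (b ^ j * (b * b ^ i)) / b ^ (2 * i + 2 * j + 3) / r ^ j) / q ^ i)"
  proof (rule corner_limit[where C = "1 + 2 * b"
      and h = "\<lambda>i j s. b ^ j * (1 / qint b s + b * (qint b i * (1 / qint b s) + qint b (s + i) / qint b s)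
        - (b + 1) * qint b i * (qint b (s + i) / qint b s) * (1 / qint b (s + (i + j))))"])
    fix i j s :: nat assume s: "0 < s"
    have "b ^ (s + i + j - (s + i)) = b ^ j" by simp
    moreover have "1 / z + b * (x * (1 / z) + y / z) - (b + 1) * x * (y / z) * (1 / v)
        = (1 + b * (x + y) - (b + 1) * x * y / v) / z" for x y z v :: real
      by (simp add: add_divide_distrib diff_divide_distrib distrib_left)
    ultimately show "qint b s * N (0 + i) (s + i) (s + i + j) =
      (b + 1) * (b ^ j * (1 / qint b s + b * (qint b i * (1 / qint b s) + qint b (s + i) / qint b s)
        - (b + 1) * qint b i * (qint b (s + i) / qint b s) * (1 / qint b (s + (i + j)))))
      * (qint b s / qint b (s + (i + j + 1))) * (qint b s / qint b (s + (i + j + 2)))"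
      using s b0 kernel_pos[OF s] by (subst N_eq) (simp_all add: add.assoc)
  next
    fix i j
    have "(\<lambda>s. 1 / qint b (s + (i + j))) \<longlonglongrightarrow> 0"
      using LIMSEQ_ignore_initial_segment[OF inverse_qint[OF b], of "i + j"] .
    then have "(\<lambda>s. b ^ j * (1 / qint b s + b * (qint b i * (1 / qint b s) + qint b (s + i) / qint b s)
        - (b + 1) * qint b i * (qint b (s + i) / qint b s) * (1 / qint b (s + (i + j)))))
      \<longlonglongrightarrow> b ^ j * (0 + b * (qint b i * 0 + b ^ i) - (b + 1) * qint b i * b ^ i * 0)"
      by (intro tendsto_mult tendsto_diff tendsto_add tendsto_const inverse_qint[OF b] qint_shift_ratio[OF b])
    then show "(\<lambda>s. b ^ j * (1 / qint b s + b * (qint b i * (1 / qint b s) + qint b (s + i) / qint b s)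
        - (b + 1) * qint b i * (qint b (s + i) / qint b s) * (1 / qint b (s + (i + j)))))
      \<longlonglongrightarrow> b ^ j * (b * b ^ i)" by simp
  next
    fix i j s :: nat assume s: "0 < s"
    define z where "z = 1 / qint b s"
    define y where "y = qint b (s + i) / qint b s"
    have "1 \<le> qint b s" using qint_ge[OF b, of s] s by linarith
    then have z: "0 \<le> z" "z \<le> 1" by (auto simp: z_def)
    have "y = qint b i * z + b ^ i"
      using qint_add[of b i s] \<open>1 \<le> qint b s\<close> by (simp add: y_def z_def add.commute add_divide_distrib)
    moreover have "qint b i * z \<le> qint b i * 1" using z b by (intro mult_left_mono qint_nonneg) auto
    ultimately have y: "0 \<le> y" "y \<le> qint b i + b ^ i" using z b by (auto simp: qint_nonneg)
    have "0 \<le> (b + 1) * qint b i * y * (1 / qint b (s + (i + j)))"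
      using b y by (simp add: qint_nonneg)
    then have "z + b * (qint b i * z + y) - (b + 1) * qint b i * y * (1 / qint b (s + (i + j))) \<le> 1 + b * (qint b i * 1 + (qint b i + b ^ i))"
      using y z b \<open>qint b i * z \<le> qint b i * 1\<close> mult_left_mono[of "qint b i * z + y" "qint b i * 1 + (qint b i + b ^ i)" b] by linarith
    also have "\<dots> \<le> b ^ i + b * (real i * b ^ i * 1 + (real i * b ^ i + b ^ i))"
      using b qint_scaled_bound[of i] by (intro add_mono mult_left_mono) auto
    also have "\<dots> = (1 + b * (2 * real i + 1)) * b ^ i" by (simp add: algebra_simps)
    also have "\<dots> \<le> ((1 + 2 * b) * real (Suc i) * real (Suc j)) * b ^ (2 * i + j)"
    proof (intro mult_mono power_increasing)
      have "1 + b * (2 * real i + 1) \<le> (1 + 2 * b) * real (Suc i) * 1" using b by (simp add: algebra_simps)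
      also have "\<dots> \<le> (1 + 2 * b) * real (Suc i) * real (Suc j)" using b by (intro mult_left_mono) auto
      finally show "1 + b * (2 * real i + 1) \<le> (1 + 2 * b) * real (Suc i) * real (Suc j)" .
    qed (use b in auto)
    finally have "b ^ j * (z + b * (qint b i * z + y) - (b + 1) * qint b i * y * (1 / qint b (s + (i + j))))
      \<le> b ^ j * (((1 + 2 * b) * real (Suc i) * real (Suc j)) * b ^ (2 * i + j))" using b by (intro mult_left_mono) auto
    also have "\<dots> = (1 + 2 * b) * real (Suc i) * real (Suc j) * b ^ (2 * i + 2 * j)"
    proof -
      have "2 * i + 2 * j = j + (2 * i + j)" by simp
      then show ?thesis by (simp only: power_add) (simp only: mult_ac)
    qed
    finally show "b ^ j * (1 / qint b s + b * (qint b i * (1 / qint b s) + qint b (s + i) / qint b s)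
        - (b + 1) * qint b i * (qint b (s + i) / qint b s) * (1 / qint b (s + (i + j))))
      \<le> (1 + 2 * b) * real (Suc i) * real (Suc j) * b ^ (2 * i + 2 * j)" unfolding z_def y_def .
  qed (use b in \<open>auto intro: qint_nonneg\<close>)
  also have "(\<Sum>i. (\<Sum>j. (b + 1) * (b ^ j * (b * b ^ i)) / b ^ (2 * i + 2 * j + 3) / r ^ j) / q ^ i)
      = (b + 1) / b\<^sup>2 * (q * b / (q * b - 1)) * (r * b / (r * b - 1))"
  proof (rule suminf_product)
    fix i j :: nat
    have "2 * i + 2 * j + 3 = i + (i + (j + (j + (1 + 2))))" by simp
    then have "b ^ (2 * i + 2 * j + 3) = b ^ i * (b ^ i * (b ^ j * (b ^ j * (b ^ 1 * b\<^sup>2))))" by (simp only: power_add)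
    then show "(b + 1) * (b ^ j * (b * b ^ i)) / b ^ (2 * i + 2 * j + 3) / r ^ j
      = (b + 1) / b\<^sup>2 * (1 / b ^ i) * (1 / (r * b) ^ j)"
      using b0 r by (simp add: power_mult_distrib)
  next
    show "(\<lambda>i. 1 / b ^ i / q ^ i) sums (q * b / (q * b - 1))"
      using one_div_power_sums[OF qb(1)] by (simp add: power_mult_distrib mult.commute)
  qed (rule one_div_power_sums[OF qb(2)])
  also have "\<dots> = A0" using b0 by (simp add: A0_def power2_eq_square)
  finally show ?thesis .
qed

lemma corner_ss: "(\<lambda>s. (qint b s)\<^sup>2 / b ^ s * Phi s s s) \<longlonglongrightarrow> A0 * Cr"
proof -
  have "(\<lambda>s. (qint b s)\<^sup>2 / b ^ s * Phi s s s)
     \<longlonglongrightarrow> (\<Sum>i. (\<Sum>j. (b + 1) * (b ^ (i + j) * (1 / b ^ j * (1 + 2 * b * qint b j))) / b ^ (2 * i + 2 * j + 3) / r ^ j) / q ^ i)"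
  proof (rule corner_limit[where C = "1 + 2 * b"
      and h = "\<lambda>i j s. b ^ (i + j) * (qint b (s + i) / qint b (s + i + j) * (1 + 2 * b * qint b j) + qint b j * (1 / qint b (s + i + j)))"])
    fix i j s :: nat assume s: "0 < s"
    define X where "X = qint b (s + i)"
    define Z where "Z = qint b (s + i + j)"
    have Z0: "Z \<noteq> 0" using s b by (simp add: Z_def qint_pos less_imp_neq[symmetric])
    have bs: "b ^ (s + i) = 1 + (b - 1) * X" unfolding X_def by (rule power_qint)
    have Z: "Z = X + b ^ (s + i) * qint b j" unfolding X_def Z_def by (rule qint_add)
    \<comment> \<open>At the top the two products are of the same order, and for
      \<open>b = 1\<close> their leading parts cancel, so the limit cannot be taken term by term.
      After \<open>b ^ (s + i) = 1 + (b - 1) * X\<close> is inserted, the factor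
      \<open>b ^ (s + i)\<close> splits off, and its part \<open>b ^ s\<close> is absorbed by the
      weight.\<close>
    have "Z * (1 + b * (X + X)) - (b + 1) * X * X = b ^ (s + i) * (X * (1 + 2 * b * qint b j) + qint b j)"
      unfolding Z bs by algebra
    then have "(Z * (1 + b * (X + X)) - (b + 1) * X * X) / Z = b ^ (s + i) * (X * (1 + 2 * b * qint b j) + qint b j) / Z" by simp
    moreover have "(Z * (1 + b * (X + X)) - (b + 1) * X * X) / Z = 1 + b * (X + X) - (b + 1) * X * X / Z"
      using Z0 by (simp add: diff_divide_distrib)
    moreover have "X / Z * (1 + 2 * b * qint b j) + qint b j * (1 / Z) = (X * (1 + 2 * b * qint b j) + qint b j) / Z"
      by (simp add: add_divide_distrib)
    ultimately have K: "1 + b * (X + X) - (b + 1) * X * X / Z = b ^ s * (b ^ i * (X / Z * (1 + 2 * b * qint b j) + qint b j * (1 / Z)))"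
      by (simp only: power_add mult.assoc times_divide_eq_right)
    have "b ^ (s + i + j - (s + i)) = b ^ j" by simp
    with s have "N (s + i) (s + i) (s + i + j) = (b + 1) * b ^ j * (b ^ s * (b ^ i * (X / Z * (1 + 2 * b * qint b j) + qint b j * (1 / Z))))
        / (qint b (s + i + j + 1) * qint b (s + i + j + 2))"
      unfolding K[symmetric] unfolding X_def Z_def by (subst N_eq) simp_all
    then show "(qint b s)\<^sup>2 / b ^ s * N (s + i) (s + i) (s + i + j) =
      (b + 1) * (b ^ (i + j) * (qint b (s + i) / qint b (s + i + j) * (1 + 2 * b * qint b j) + qint b j * (1 / qint b (s + i + j))))
      * (qint b s / qint b (s + (i + j + 1))) * (qint b s / qint b (s + (i + j + 2)))"
      unfolding X_def[symmetric] Z_def[symmetric] using b0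
      by (simp add: power2_eq_square add.assoc power_add)
  next
    fix i j
    have "(\<lambda>s. 1 / qint b (s + i + j)) \<longlonglongrightarrow> 0"
      using LIMSEQ_ignore_initial_segment[OF inverse_qint[OF b], of "i + j"] by (simp only: add.assoc)
    moreover have "(\<lambda>s. qint b (s + i) / qint b (s + i + j)) \<longlonglongrightarrow> 1 / b ^ j"
      by (rule LIMSEQ_ignore_initial_segment[OF qint_ratio[OF b]])
    ultimately have "(\<lambda>s. b ^ (i + j) * (qint b (s + i) / qint b (s + i + j) * (1 + 2 * b * qint b j) + qint b j * (1 / qint b (s + i + j))))
      \<longlonglongrightarrow> b ^ (i + j) * (1 / b ^ j * (1 + 2 * b * qint b j) + qint b j * 0)"
      by (intro tendsto_mult tendsto_add tendsto_const)
    then show "(\<lambda>s. b ^ (i + j) * (qint b (s + i) / qint b (s + i + j) * (1 + 2 * b * qint b j) + qint b j * (1 / qint b (s + i + j))))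
      \<longlonglongrightarrow> b ^ (i + j) * (1 / b ^ j * (1 + 2 * b * qint b j))" by simp
  next
    fix i j s :: nat assume s: "0 < s"
    define x where "x = qint b (s + i) / qint b (s + i + j)"
    define z where "z = 1 / qint b (s + i + j)"
    have Z: "1 \<le> qint b (s + i + j)" using qint_ge[OF b, of "s + i + j"] s by linarith
    have "qint b (s + i) \<le> qint b (s + i + j)" using b by (intro qint_mono) auto
    then have x: "x \<le> 1" using Z by (simp add: x_def)
    have z: "z \<le> 1" using Z by (simp add: z_def)
    have nn: "0 \<le> qint b j" using b by (simp add: qint_nonneg)
    have "x * (1 + 2 * b * qint b j) + qint b j * z \<le> 1 * (1 + 2 * b * qint b j) + qint b j * 1"
      using x z nn b by (intro add_mono mult_right_mono mult_left_mono) auto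
    also have "\<dots> = 1 + (2 * b + 1) * qint b j" by (simp add: algebra_simps)
    also have "\<dots> \<le> b ^ j + (2 * b + 1) * (real j * b ^ j)"
      using b qint_scaled_bound[of j] by (intro add_mono mult_left_mono) auto
    also have "\<dots> = (1 + (2 * b + 1) * real j) * b ^ j" by (simp add: algebra_simps)
    also have "\<dots> \<le> ((1 + 2 * b) * real (Suc i) * real (Suc j)) * b ^ (i + j)"
    proof (intro mult_mono power_increasing)
      have "1 + (2 * b + 1) * real j \<le> (1 + 2 * b) * 1 * real (Suc j)" using b by (simp add: algebra_simps)
      also have "\<dots> \<le> (1 + 2 * b) * real (Suc i) * real (Suc j)" using b by (intro mult_right_mono mult_left_mono) auto
      finally show "1 + (2 * b + 1) * real j \<le> (1 + 2 * b) * real (Suc i) * real (Suc j)" .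
    qed (use b in auto)
    finally have "b ^ (i + j) * (x * (1 + 2 * b * qint b j) + qint b j * z)
      \<le> b ^ (i + j) * (((1 + 2 * b) * real (Suc i) * real (Suc j)) * b ^ (i + j))" using b by (intro mult_left_mono) auto
    also have "\<dots> = (1 + 2 * b) * real (Suc i) * real (Suc j) * b ^ (2 * i + 2 * j)"
    proof -
      have "2 * i + 2 * j = (i + j) + (i + j)" by simp
      then show ?thesis by (simp only: power_add) (simp only: mult_ac)
    qed
    finally show "b ^ (i + j) * (qint b (s + i) / qint b (s + i + j) * (1 + 2 * b * qint b j) + qint b j * (1 / qint b (s + i + j)))
      \<le> (1 + 2 * b) * real (Suc i) * real (Suc j) * b ^ (2 * i + 2 * j)" unfolding x_def z_def .
  qed (use b in auto)
  also have "(\<Sum>i. (\<Sum>j. (b + 1) * (b ^ (i + j) * (1 / b ^ j * (1 + 2 * b * qint b j))) / b ^ (2 * i + 2 * j + 3) / r ^ j) / q ^ i)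
      = (b + 1) / b ^ 3 * (q * b / (q * b - 1)) * (r * b\<^sup>2 * (r * b\<^sup>2 + b) / ((r * b\<^sup>2 - 1) * (r * b\<^sup>2 - b)))"
  proof (rule suminf_product)
    fix i j :: nat
    have "2 * i + 2 * j + 3 = i + (i + (2 * j + 3))" by simp
    then have "b ^ (2 * i + 2 * j + 3) = b ^ i * (b ^ i * ((b\<^sup>2) ^ j * b ^ 3))" by (simp only: power_add power_mult)
    moreover have "b ^ (i + j) * (1 / b ^ j * (1 + 2 * b * qint b j)) = b ^ i * (1 + 2 * b * qint b j)"
      using b0 by (simp add: power_add)
    ultimately show "(b + 1) * (b ^ (i + j) * (1 / b ^ j * (1 + 2 * b * qint b j))) / b ^ (2 * i + 2 * j + 3) / r ^ j
      = (b + 1) / b ^ 3 * (1 / b ^ i) * ((1 + 2 * b * qint b j) / (r * b\<^sup>2) ^ j)"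
      using b0 r by (simp only:) (simp add: power_mult_distrib)
  next
    show "(\<lambda>i. 1 / b ^ i / q ^ i) sums (q * b / (q * b - 1))"
      using one_div_power_sums[OF qb(1)] by (simp add: power_mult_distrib mult.commute)
  qed (rule one_plus_qint_sums[OF qb(4)])
  also have "\<dots> = A0 * Cr"
    using corner_value(2) by (simp only: mult_ac)
  finally show ?thesis .
qed

text \<open>Reversibility of the integer walk: \<open>confinement\<close> is symmetric in start and
  target up to the power \<open>b ^ (t - c)\<close>. So the two mixed corners have the same value,
  and three limits suffice.\<close>

lemma Phi_s0: 
  assumes "0 < s"
  shows "Phi s 0 s = b ^ s * Phi 0 s s"
proof -
  have "N (s + i) i (s + i + j) = b ^ s * N i (s + i) (s + i + j)" for i j
  proof -
    have "b ^ (s + i + j - i) = b ^ s * b ^ j" by (simp flip: power_add)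
    moreover have "b ^ (s + i + j - (s + i)) = b ^ j" by simp
    ultimately show ?thesis using assms
      unfolding confinement_def by (simp only: add_is_0) (simp add: mult_ac add_ac)
  qed
  then have "b ^ s * Phi 0 s s = (\<Sum>i. (\<Sum>j. (1 * N (s + i) (0 + i) (s + i + j)) / r ^ j) / q ^ i)"
    by (subst Phi_scale[symmetric]) simp_all
  also have "\<dots> = 1 * Phi s 0 s" by (rule Phi_scale) simp_all
  finally show ?thesis by simp
qed

text \<open>Uniformity in \<open>u\<close> and \<open>d\<close> of the asymptotics comes from here: the corner values depend on \<open>s\<close> only, and
  \<open>Phi\<close> is a weighted mean of them.\<close>

lemma Phi_interpolation:
  assumes "0 < s" "u \<le> s" "d \<le> s"
  defines "la \<equiv> (qint b s - qint b u) / qint b s" and "mu \<equiv> (qint b s - qint b d) / qint b s"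
  shows "b ^ d * Phi u d s = la * mu * Phi 0 0 s + (la * (1 - mu) + (1 - la) * mu) * (b ^ s * Phi 0 s s)
    + (1 - la) * (1 - mu) * (b ^ s * Phi s s s)"
proof -
  have nz: "qint b s \<noteq> 0" using kernel_pos[OF assms(1)] by simp
  have c: "qint b u / qint b s = 1 - la" "qint b d / qint b s = 1 - mu"
    using nz by (simp_all add: la_def mu_def diff_divide_distrib)
  have "b ^ d * Phi u d s = mu * Phi u 0 s + (1 - mu) * (b ^ s * Phi u s s)"
    using Phi_affine_right[OF assms(1-3)] unfolding c(2) mu_def[symmetric] .
  moreover have "Phi u 0 s = la * Phi 0 0 s + (1 - la) * (b ^ s * Phi 0 s s)"
    using Phi_affine_left[OF assms(1,2), of 0] unfolding c(1) la_def[symmetric] Phi_s0[OF assms(1)] by simp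
  moreover have "Phi u s s = la * Phi 0 s s + (1 - la) * Phi s s s"
    using Phi_affine_left[OF assms(1,2), of s] unfolding c(1) la_def[symmetric] by simp
  ultimately show ?thesis by (simp only:) (simp add: algebra_simps)
qed

text \<open>\<open>v00\<close>, \<open>v01\<close> and \<open>v11\<close> are the candidates for the
  corners, \<open>v01\<close> for both mixed ones. As \<open>g\<close> is the mean of the candidates
  with the same weights, the convergence is uniform in \<open>u\<close> and
  \<open>d\<close>.\<close>

lemma Phi_asymptotics:
  assumes s: "filterlim s at_top sequentially"
    and ud: "\<And>n. u n \<le> s n" "\<And>n. d n \<le> s n"
    and v: "\<And>n. 0 < n \<Longrightarrow> 0 < v00 n \<and> 0 < v01 n \<and> 0 < v11 n"
    and lim: "(\<lambda>n. Phi 0 0 n / v00 n) \<longlonglongrightarrow> 1" "(\<lambda>n. b ^ n * Phi 0 n n / v01 n) \<longlonglongrightarrow> 1"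
      "(\<lambda>n. b ^ n * Phi n n n / v11 n) \<longlonglongrightarrow> 1"
    and g: "\<And>n la mu. 0 < s n \<Longrightarrow> la = (qint b (s n) - qint b (u n)) / qint b (s n) \<Longrightarrow>
      mu = (qint b (s n) - qint b (d n)) / qint b (s n) \<Longrightarrow>
      b ^ d n * g n = la * mu * v00 (s n) + (la * (1 - mu) + (1 - la) * mu) * v01 (s n) + (1 - la) * (1 - mu) * v11 (s n)"
  shows "(\<lambda>n. Phi (u n) (d n) (s n) / g n) \<longlonglongrightarrow> 1" "\<forall>\<^sub>F n in sequentially. 0 < g n"
proof -
  define la where "la n = (qint b (s n) - qint b (u n)) / qint b (s n)" for n
  define mu where "mu n = (qint b (s n) - qint b (d n)) / qint b (s n)" for n
  \<comment> \<open>For the finitely many \<open>n\<close> with \<open>s n = 0\<close> all weight is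
    put on the first corner, so that the weights are nonnegative with sum \<open>1\<close> for every
    \<open>n\<close>.\<close>
  define w where "w k n = (if s n = 0 then (if k = 0 then 1 else 0)
    else [la n * mu n, la n * (1 - mu n) + (1 - la n) * mu n, (1 - la n) * (1 - mu n)] ! k)" for k n
  define a where "a k n = [Phi 0 0 n, b ^ n * Phi 0 n n, b ^ n * Phi n n n] ! k" for k n
  define v where "v k n = [v00 n, v01 n, v11 n] ! k" for k n
  have frac: "0 \<le> (qint b (s n) - qint b k) / qint b (s n)" "(qint b (s n) - qint b k) / qint b (s n) \<le> 1"
    if "0 < s n" "k \<le> s n" for n k
    using that kernel_pos[OF that(1)] qint_mono[of b k "s n"] qint_nonneg[of b k] b by (simp_all add: divide_le_eq)
  have lm: "0 \<le> la n" "la n \<le> 1" "0 \<le> mu n" "mu n \<le> 1" if "0 < s n" for n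
    unfolding la_def mu_def using frac that ud by blast+
  have three: "{..<3::nat} = {0, 1, 2}" by auto
  have pos: "\<forall>\<^sub>F n in sequentially. 0 < s n" by (rule eventually_compose_filterlim[OF eventually_gt_at_top s])
  have w_nn: "0 \<le> w k n" if "k \<in> {..<3}" for k n
    using that lm[of n] unfolding three by (auto simp: w_def numeral_2_eq_2)
  have w_sum: "(\<Sum>k<3. w k n) = 1" for n
    unfolding three by (simp add: w_def algebra_simps)
  have v_pos: "\<forall>\<^sub>F n in sequentially. \<forall>k\<in>{..<3}. 0 < v k (s n)"
    using pos by eventually_elim (use assms(4) in \<open>auto simp: three v_def\<close>)
  have lims: "(\<lambda>n. a k (s n) / v k (s n)) \<longlonglongrightarrow> 1" if "k \<in> {..<3}" for k
  proof -
    have "(\<lambda>n. a k n / v k n) \<longlonglongrightarrow> 1" using that lim unfolding three by (auto simp: a_def v_def)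
    then show ?thesis by (rule filterlim_compose[OF _ s])
  qed
  have ratio: "(\<lambda>n. (\<Sum>k<3. w k n * a k (s n)) / (\<Sum>k<3. w k n * v k (s n))) \<longlonglongrightarrow> 1"
    by (rule interpolation_ratio[OF finite_lessThan w_nn w_sum v_pos lims])
  have g': "b ^ d n * g n = (\<Sum>k<3. w k n * v k (s n))" if "0 < s n" for n
    using g[OF that la_def mu_def] that unfolding three by (simp add: w_def v_def)
  have P': "b ^ d n * Phi (u n) (d n) (s n) = (\<Sum>k<3. w k n * a k (s n))" if "0 < s n" for n
    using Phi_interpolation[OF that ud(1)[of n] ud(2)[of n], folded la_def mu_def] that unfolding three by (simp add: w_def a_def)
  have "\<forall>\<^sub>F n in sequentially. (\<Sum>k<3. w k n * a k (s n)) / (\<Sum>k<3. w k n * v k (s n)) = Phi (u n) (d n) (s n) / g n"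
    using pos
  proof eventually_elim
    case (elim n)
    show ?case unfolding g'[OF elim, symmetric] P'[OF elim, symmetric] using b0 by simp
  qed
  with ratio show "(\<lambda>n. Phi (u n) (d n) (s n) / g n) \<longlonglongrightarrow> 1" by (rule Lim_transform_eventually)
  show "\<forall>\<^sub>F n in sequentially. 0 < g n"
    using pos v_pos
  proof eventually_elim
    case (elim n)
    have "0 < (\<Sum>k<3. w k n * v k (s n))"
      by (rule weighted_mean_pos[OF finite_lessThan w_nn w_sum]) (use elim(2) in auto)
    then have "0 < b ^ d n * g n" using g'[OF elim(1)] by simp
    then show ?case using b0 by (simp add: zero_less_mult_iff)
  qed
qed

lemma A0_pos: "0 < A0" "0 < Cq" "0 < Cr"
  using qb q r b by (simp_all add: A0_def Cq_def Cr_def add_pos_pos)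

lemma corners_drift:
  assumes "1 < b"
  shows "(\<lambda>n. Phi 0 0 n / (((b - 1) * A0) * ((b - 1) * Cq) / b ^ n)) \<longlonglongrightarrow> 1"
    "(\<lambda>n. b ^ n * Phi 0 n n / ((b - 1) * A0)) \<longlonglongrightarrow> 1"
    "(\<lambda>n. b ^ n * Phi n n n / (((b - 1) * A0) * ((b - 1) * Cr))) \<longlonglongrightarrow> 1"
proof -
  define c where "c = b - 1"
  have c: "0 < c" using assms by (simp add: c_def)
  \<comment> \<open>Replaces q-integers by powers: \<open>e n\<close> tends to \<open>1\<close>
    because \<open>b ^ n = 1 + (b - 1) * qint b n\<close>. One factor \<open>e n\<close> is inserted
    for each \<open>qint b n\<close> in the corner limit.\<close>
  define e where "e n = b ^ n / (c * qint b n)" for n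
  have "(\<lambda>n. 1 + 1 / c * (1 / qint b n)) \<longlonglongrightarrow> 1 + 1 / c * 0"
    by (intro tendsto_add tendsto_mult tendsto_const inverse_qint b)
  moreover have "\<forall>\<^sub>F n in sequentially. 1 + 1 / c * (1 / qint b n) = e n"
    using eventually_gt_at_top[of 0]
  proof eventually_elim
    case (elim n)
    show ?case unfolding e_def power_qint[of b n] c_def[symmetric] using kernel_pos[OF elim] c by (simp add: add_divide_distrib)
  qed
  ultimately have e: "e \<longlonglongrightarrow> 1" by (simp add: Lim_transform_eventually)
  note z = A0_pos
  have "(\<lambda>n. (qint b n)\<^sup>2 / b ^ n * Phi 0 0 n / (A0 * Cq) * (e n * e n)) \<longlonglongrightarrow> (A0 * Cq) / (A0 * Cq) * (1 * 1)"
    using z by (intro tendsto_intros corner_00 e) auto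
  moreover have "\<forall>\<^sub>F n in sequentially. (qint b n)\<^sup>2 / b ^ n * Phi 0 0 n / (A0 * Cq) * (e n * e n)
      = Phi 0 0 n / (((b - 1) * A0) * ((b - 1) * Cq) / b ^ n)"
    using eventually_gt_at_top[of 0]
  proof eventually_elim
    case (elim n)
    then show ?case unfolding e_def c_def[symmetric] using kernel_pos[OF elim] c b0 z by (simp add: power2_eq_square mult_ac)
  qed
  ultimately show "(\<lambda>n. Phi 0 0 n / (((b - 1) * A0) * ((b - 1) * Cq) / b ^ n)) \<longlonglongrightarrow> 1"
    using z by (simp add: Lim_transform_eventually)
  have "(\<lambda>n. qint b n * Phi 0 n n / A0 * e n) \<longlonglongrightarrow> A0 / A0 * 1"
    using z by (intro tendsto_intros corner_0s e) auto
  moreover have "\<forall>\<^sub>F n in sequentially. qint b n * Phi 0 n n / A0 * e n = b ^ n * Phi 0 n n / ((b - 1) * A0)"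
    using eventually_gt_at_top[of 0]
  proof eventually_elim
    case (elim n)
    then show ?case unfolding e_def c_def[symmetric] using kernel_pos[OF elim] c b0 z by (simp add: mult_ac)
  qed
  ultimately show "(\<lambda>n. b ^ n * Phi 0 n n / ((b - 1) * A0)) \<longlonglongrightarrow> 1"
    using z by (simp add: Lim_transform_eventually)
  have "(\<lambda>n. (qint b n)\<^sup>2 / b ^ n * Phi n n n / (A0 * Cr) * (e n * e n)) \<longlonglongrightarrow> (A0 * Cr) / (A0 * Cr) * (1 * 1)"
    using z by (intro tendsto_intros corner_ss e) auto
  moreover have "\<forall>\<^sub>F n in sequentially. (qint b n)\<^sup>2 / b ^ n * Phi n n n / (A0 * Cr) * (e n * e n)
      = b ^ n * Phi n n n / (((b - 1) * A0) * ((b - 1) * Cr))"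
    using eventually_gt_at_top[of 0]
  proof eventually_elim
    case (elim n)
    then show ?case unfolding e_def c_def[symmetric] using kernel_pos[OF elim] c b0 z by (simp add: power2_eq_square mult_ac)
  qed
  ultimately show "(\<lambda>n. b ^ n * Phi n n n / (((b - 1) * A0) * ((b - 1) * Cr))) \<longlonglongrightarrow> 1"
    using z by (simp add: Lim_transform_eventually)
qed

lemma corners_critical:
  assumes "b = 1"
  shows "(\<lambda>n. Phi 0 0 n / (A0 * Cq / real n ^ 2)) \<longlonglongrightarrow> 1"
    "(\<lambda>n. b ^ n * Phi 0 n n / (A0 / real n)) \<longlonglongrightarrow> 1"
    "(\<lambda>n. b ^ n * Phi n n n / (A0 * Cr / real n ^ 2)) \<longlonglongrightarrow> 1"
proof -
  note z = A0_pos
  have n: "qint b n = real n" "b ^ n = 1" for n by (simp_all add: qint_def assms)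
  have "(\<lambda>n. (qint b n)\<^sup>2 / b ^ n * Phi 0 0 n / (A0 * Cq)) \<longlonglongrightarrow> (A0 * Cq) / (A0 * Cq)"
    using z by (intro tendsto_intros corner_00) auto
  then show "(\<lambda>n. Phi 0 0 n / (A0 * Cq / real n ^ 2)) \<longlonglongrightarrow> 1"
    using z unfolding n by (simp add: mult.commute)
  have "(\<lambda>n. qint b n * Phi 0 n n / A0) \<longlonglongrightarrow> A0 / A0"
    using z by (intro tendsto_intros corner_0s) auto
  then show "(\<lambda>n. b ^ n * Phi 0 n n / (A0 / real n)) \<longlonglongrightarrow> 1"
    using z unfolding n by (simp add: mult.commute)
  have "(\<lambda>n. (qint b n)\<^sup>2 / b ^ n * Phi n n n / (A0 * Cr)) \<longlonglongrightarrow> (A0 * Cr) / (A0 * Cr)"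
    using z by (intro tendsto_intros corner_ss) auto
  then show "(\<lambda>n. b ^ n * Phi n n n / (A0 * Cr / real n ^ 2)) \<longlonglongrightarrow> 1"
    using z unfolding n by (simp add: mult.commute)
qed

end

subsection \<open>The Diestel-Leader graph\<close>

locale dl_walk = t1: end_tree T1 f1 q + t2: end_tree T2 f2 r
  for T1 :: "'a pointed_tree" and f1 q and T2 :: "'b pointed_tree" and f2 r +
  fixes \<alpha> :: real
  assumes \<alpha>: "0 < \<alpha>" "\<alpha> < 1"
begin

abbreviation "u1 x y \<equiv> up T1 (fst x) (fst y)"
abbreviation "d1 x y \<equiv> down T1 (fst x) (fst y)"
abbreviation "u2 x y \<equiv> up T2 (snd x) (snd y)"
abbreviation "d2 x y \<equiv> down T2 (snd x) (snd y)"

definition nbs :: "'a \<times> 'b \<Rightarrow> ('a \<times> 'b) set" where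
  "nbs x = (\<lambda>z. (z, t2.par (snd x))) ` t1.children (fst x) \<union> (\<lambda>z. (t1.par (fst x), z)) ` t2.children (snd x)"

lemma sum_DL_walk:
  fixes F :: "'a \<times> 'b \<Rightarrow> real"
  shows "(\<Sum>z\<in>nbs x. DL_walk q r T1 T2 \<alpha> x z * F z) =
    \<alpha> / q * (\<Sum>z\<in>t1.children (fst x). F (z, t2.par (snd x)))
    + (1 - \<alpha>) / r * (\<Sum>z\<in>t2.children (snd x). F (t1.par (fst x), z))"
proof -
  let ?A = "(\<lambda>z. (z, t2.par (snd x))) ` t1.children (fst x)"
  let ?B = "(\<lambda>z. (t1.par (fst x), z)) ` t2.children (snd x)"
  have "?A \<inter> ?B = {}"
    using t1.par_notin_children[of "fst x"] by auto
  then have "(\<Sum>z\<in>nbs x. DL_walk q r T1 T2 \<alpha> x z * F z)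
      = (\<Sum>z\<in>?A. DL_walk q r T1 T2 \<alpha> x z * F z) + (\<Sum>z\<in>?B. DL_walk q r T1 T2 \<alpha> x z * F z)"
    unfolding nbs_def by (intro sum.union_disjoint) auto
  also have "(\<Sum>z\<in>?A. DL_walk q r T1 T2 \<alpha> x z * F z) = (\<Sum>z\<in>t1.children (fst x). \<alpha> / q * F (z, t2.par (snd x)))"
    by (subst sum.reindex)
      (auto simp: inj_on_def DL_walk_def t1.predecessor_eq t2.predecessor_eq t1.children_def intro!: sum.cong)
  also have "(\<Sum>z\<in>?B. DL_walk q r T1 T2 \<alpha> x z * F z) = (\<Sum>z\<in>t2.children (snd x). (1 - \<alpha>) / r * F (t1.par (fst x), z))"
    using t1.par_par_neq[of "fst x"] by (subst sum.reindex)
      (auto simp: inj_on_def DL_walk_def t1.predecessor_eq t2.predecessor_eq t2.children_def intro!: sum.cong)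
  finally show ?thesis by (simp only: sum_distrib_left)
qed

lemma DL_iff: "x \<in> DL T1 T2 \<longleftrightarrow> busemann T1 (fst x) + busemann T2 (snd x) = 0"
  by (cases x) (simp add: DL_def)

lemma nbs_subset: "x \<in> DL T1 T2 \<Longrightarrow> nbs x \<subseteq> DL T1 T2"
proof
  fix z assume x: "x \<in> DL T1 T2" and z: "z \<in> nbs x"
  from z consider "t1.par (fst z) = fst x" "snd z = t2.par (snd x)" | "fst z = t1.par (fst x)" "t2.par (snd z) = snd x"
    by (auto simp: nbs_def t1.children_def t2.children_def)
  then show "z \<in> DL T1 T2"
    using x t1.busemann_par[of "fst z"] t2.busemann_par[of "snd x"] t1.busemann_par[of "fst x"] t2.busemann_par[of "snd z"]
    by cases (simp_all add: DL_iff)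
qed

sublocale finite_range_chain "DL T1 T2" "DL_walk q r T1 T2 \<alpha>" nbs
proof
  fix x :: "'a \<times> 'b"
  show "finite (nbs x)" by (simp add: nbs_def)
  show "(\<Sum>z\<in>nbs x. DL_walk q r T1 T2 \<alpha> x z) = 1"
    using sum_DL_walk[of x "\<lambda>_. 1"] t1.p2 t2.p2 by simp
  show "0 \<le> DL_walk q r T1 T2 \<alpha> x z" for z
    using \<alpha> by (simp add: DL_walk_def)
  show "DL_walk q r T1 T2 \<alpha> x z = 0" if "z \<notin> nbs x" for z
    using that by (cases z) (auto simp: DL_walk_def nbs_def t1.predecessor_eq t2.predecessor_eq t1.children_def t2.children_def)
qed (rule nbs_subset)

lemma DL_balance:
  assumes "x \<in> DL T1 T2" "y \<in> DL T1 T2"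
  shows "u1 x y + u2 x y = d1 x y + d2 x y"
  using assms t1.busemann_diff[of "fst y" "fst x"] t2.busemann_diff[of "snd y" "snd x"]
  unfolding DL_iff by linarith

end

section \<open>Identification of the Green kernel\<close>

locale dl_walk_down = dl_walk +
  assumes drift: "\<alpha> \<le> 1 / 2"
begin

definition "\<beta> = (1 - \<alpha>) / \<alpha>"

sublocale k: dl_kernel \<beta> \<alpha> "real q" "real r"
  using \<alpha> drift t1.p2 t2.p2 by unfold_locales (auto simp: \<beta>_def field_simps)

definition kernel :: "nat \<Rightarrow> nat \<Rightarrow> nat \<Rightarrow> nat \<Rightarrow> real" where
  "kernel u d v e = k.Phi u d (u + v) / (real q ^ d * real r ^ e)"

definition F :: "'a \<times> 'b \<Rightarrow> 'a \<times> 'b \<Rightarrow> real" where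
  "F x y = kernel (u1 x y) (d1 x y) (u2 x y) (d2 x y)"

lemma qr: "real q > 0" "real r > 0" "real q \<noteq> 0" "real r \<noteq> 0"
  using t1.p2 t2.p2 by auto

text \<open>\<open>up1\<close> and \<open>up2\<close> are the sums over the successors of
  \<open>x1\<close> and of \<open>x2\<close>, in the form given by \<open>sum_children\<close>. The
  cases ask whether the start is inside the range from \<open>- u\<close> to \<open>v\<close>, at
  its bottom or at its top, and in the last two whether the target is at the same extreme; a single
  point is the last case.\<close>

lemma kernel_equation:
  assumes "u + v = d + e"
  defines "up1 \<equiv> (\<lambda>g. if u = 0 \<and> 0 < d then g 0 (d - 1) + (real q - 1) * g 1 d else real q * g (u + 1) d :: real)"
    and "up2 \<equiv> (\<lambda>g. if v = 0 \<and> 0 < e then g 0 (e - 1) + (real r - 1) * g 1 e else real r * g (v + 1) e :: real)"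
  shows "kernel u d v e = (if u = 0 \<and> d = 0 \<and> v = 0 \<and> e = 0 then 1 else 0)
    + \<alpha> / q * up1 (\<lambda>u' d'. kernel u' d' (v - 1) (if v = 0 then e + 1 else e))
    + (1 - \<alpha>) / r * up2 (\<lambda>v' e'. kernel (u - 1) (if u = 0 then d + 1 else d) v' e')"
proof -
  note pos = qr
  consider (interior) "0 < u" "0 < v" | (bottom) "u = 0" "0 < d" "0 < v" | (bottom_0) "u = 0" "d = 0" "0 < v"
    | (top) "0 < u" "v = 0" "0 < e" | (top_0) "0 < u" "v = 0" "e = 0" | (zero) "u = 0" "v = 0"
    by blast
  then show ?thesis
  proof cases
    case interior
    then have eq: "k.Phi u d (u + v) = \<alpha> * k.Phi (u + 1) d (u + v) + (1 - \<alpha>) * k.Phi (u - 1) d (u + v)"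
      using assms(1) by (intro k.Phi_interior) auto
    show ?thesis
      using interior pos unfolding up1_def up2_def kernel_def by (simp add: eq add_divide_distrib)
  next
    case bottom
    then have eq: "k.Phi 0 d v = \<alpha> * (k.Phi 0 (d - 1) (v - 1) + (1 - 1 / q) * k.Phi 1 d v) + (1 - \<alpha>) * k.Phi 0 (d + 1) (v + 1) / q"
      using assms(1) by (intro k.Phi_bottom) auto
    obtain d' where "d = Suc d'" using bottom by (cases d) auto
    with eq bottom pos show ?thesis
      unfolding up1_def up2_def kernel_def by (simp add: right_diff_distrib) (simp add: field_simps)
  next
    case bottom_0
    then have eq: "k.Phi 0 0 v = \<alpha> * k.Phi 1 0 v + (1 - \<alpha>) * k.Phi 0 1 (v + 1) / q"
      by (intro k.Phi_bottom_0) auto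
    show ?thesis
      using bottom_0 pos eq unfolding up1_def up2_def kernel_def by simp (simp add: field_simps)
  next
    case top
    then have eq: "k.Phi u d u = (1 - \<alpha>) * (k.Phi (u - 1) d (u - 1) + (1 - 1 / r) * k.Phi (u - 1) d u) + \<alpha> * k.Phi (u + 1) d (u + 1) / r"
      using assms(1) by (intro k.Phi_top) auto
    obtain e' where "e = Suc e'" using top by (cases e) auto
    with eq top pos show ?thesis
      unfolding up1_def up2_def kernel_def by (simp add: right_diff_distrib) (simp add: field_simps)
  next
    case top_0
    then have eq: "k.Phi u u u = (1 - \<alpha>) * k.Phi (u - 1) u u + \<alpha> * k.Phi (u + 1) u (u + 1) / r"
      by (intro k.Phi_top_diag) auto
    have "d = u" using top_0 assms(1) by simp
    with eq top_0 pos show ?thesis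
      unfolding up1_def up2_def kernel_def by simp (simp add: field_simps)
  next
    case zero
    then show ?thesis
      using assms(1) pos unfolding up1_def up2_def kernel_def by (simp add: k.Phi_0)
  qed
qed

lemma F_equation:
  assumes "x \<in> DL T1 T2" "y \<in> DL T1 T2"
  shows "F x y = (if x = y then 1 else 0) + (\<Sum>z\<in>nbs x. DL_walk q r T1 T2 \<alpha> x z * F z y)"
proof -
  have "(x = y) = (u1 x y = 0 \<and> d1 x y = 0 \<and> u2 x y = 0 \<and> d2 x y = 0)"
    using t1.up_down_0[of "fst x" "fst y"] t2.up_down_0[of "snd x" "snd y"] by (auto simp: prod_eq_iff)
  moreover have "(\<Sum>z\<in>t1.children (fst x). F (z, t2.par (snd x)) y) = 
    (if u1 x y = 0 \<and> 0 < d1 x y then kernel 0 (d1 x y - 1) (u2 x y - 1) (if u2 x y = 0 then d2 x y + 1 else d2 x y)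
        + (real q - 1) * kernel 1 (d1 x y) (u2 x y - 1) (if u2 x y = 0 then d2 x y + 1 else d2 x y)
     else real q * kernel (u1 x y + 1) (d1 x y) (u2 x y - 1) (if u2 x y = 0 then d2 x y + 1 else d2 x y))"
    unfolding F_def fst_conv snd_conv t2.up_down_par by (rule t1.sum_children)
  moreover have "(\<Sum>z\<in>t2.children (snd x). F (t1.par (fst x), z) y) = 
    (if u2 x y = 0 \<and> 0 < d2 x y then kernel (u1 x y - 1) (if u1 x y = 0 then d1 x y + 1 else d1 x y) 0 (d2 x y - 1)
        + (real r - 1) * kernel (u1 x y - 1) (if u1 x y = 0 then d1 x y + 1 else d1 x y) 1 (d2 x y)
     else real r * kernel (u1 x y - 1) (if u1 x y = 0 then d1 x y + 1 else d1 x y) (u2 x y + 1) (d2 x y))"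
    unfolding F_def fst_conv snd_conv t1.up_down_par by (rule t2.sum_children)
  ultimately show ?thesis
    using kernel_equation[OF DL_balance[OF assms]] unfolding sum_DL_walk by (simp only: F_def add.assoc)
qed

lemma F_bound:
  assumes "x \<in> DL T1 T2" "y \<in> DL T1 T2"
  shows "0 \<le> F x y" "F x y \<le> k.Phi_bound / 2 ^ (u1 x y + u2 x y)"
proof -
  have *: "0 \<le> k.Phi (u1 x y) (d1 x y) (u1 x y + u2 x y)" "k.Phi (u1 x y) (d1 x y) (u1 x y + u2 x y) \<le> k.Phi_bound"
    using DL_balance[OF assms] by (auto intro!: k.Phi_props)
  then show "0 \<le> F x y" by (simp add: F_def kernel_def)
  \<comment> \<open>The balance turns the decay in \<open>d1\<close> and \<open>d2\<close> into
    decay in \<open>s\<close>, and \<open>s\<close> bounds all four numbers.\<close>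
  have "(2::real) ^ (u1 x y + u2 x y) = 2 ^ d1 x y * 2 ^ d2 x y"
    by (simp add: DL_balance[OF assms] power_add)
  also have "\<dots> \<le> real q ^ d1 x y * real r ^ d2 x y"
    using t1.p2 t2.p2 by (intro mult_mono power_mono) auto
  finally show "F x y \<le> k.Phi_bound / 2 ^ (u1 x y + u2 x y)"
    unfolding F_def kernel_def using * by (intro frac_le) auto
qed

lemma finite_F_large:
  assumes "y \<in> DL T1 T2" "0 < e"
  shows "finite {x \<in> DL T1 T2. e < F x y}"
proof -
  obtain k where k: "k.Phi_bound / e < 2 ^ k" using real_arch_pow[of 2] by auto
  have "{x \<in> DL T1 T2. e < F x y} \<subseteq>
      {x. up T1 x (fst y) \<le> k \<and> down T1 x (fst y) \<le> k} \<times> {x. up T2 x (snd y) \<le> k \<and> down T2 x (snd y) \<le> k}"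
  proof
    fix x assume x: "x \<in> {x \<in> DL T1 T2. e < F x y}"
    then have x': "x \<in> DL T1 T2" by simp
    have "e < k.Phi_bound / 2 ^ (u1 x y + u2 x y)" using x F_bound(2)[OF x' assms(1)] by simp
    then have "2 ^ (u1 x y + u2 x y) < k.Phi_bound / e" using assms(2) by (simp add: field_simps)
    also note k
    finally have "u1 x y + u2 x y < k" by simp
    with DL_balance[OF x' assms(1)]
    show "x \<in> {x. up T1 x (fst y) \<le> k \<and> down T1 x (fst y) \<le> k} \<times> {x. up T2 x (snd y) \<le> k \<and> down T2 x (snd y) \<le> k}"
      by (simp add: mem_Times_iff)
  qed
  then show ?thesis
    by (rule finite_subset) (intro finite_cartesian_product t1.finite_bounded t2.finite_bounded)
qed

text \<open>An exact formula for every pair; the asymptotic analysis concerns only the numbers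
  \<open>k.Phi\<close>.\<close>

theorem green_DL:
  assumes "x \<in> DL T1 T2" "y \<in> DL T1 T2"
  shows "green (DL T1 T2) (DL_walk q r T1 T2 \<alpha>) x y
    = ennreal (k.Phi (u1 x y) (d1 x y) (u1 x y + u2 x y) / (real q ^ d1 x y * real r ^ d2 x y))"
proof -
  have C: "0 \<le> k.Phi_bound" using k.Phi_props(2,3)[of 0 0 0] by simp
  have "F x y \<le> k.Phi_bound" if "x \<in> DL T1 T2" "y \<in> DL T1 T2" for x y
  proof -
    have "k.Phi_bound / 2 ^ (u1 x y + u2 x y) \<le> k.Phi_bound / 1" using C by (intro divide_left_mono) auto
    then show ?thesis using F_bound(2)[OF that] by simp
  qed
  then have "green (DL T1 T2) (DL_walk q r T1 T2 \<alpha>) x y = ennreal (F x y)"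
    using F_equation F_bound(1) finite_F_large assms by (intro green_eqI[where C = k.Phi_bound]) auto
  then show ?thesis by (simp add: F_def kernel_def)
qed

end

section \<open>Graph distance and the number \<open>s\<close>\<close>

context dl_walk
begin

abbreviation "R \<equiv> DL_adj T1 T2"

lemma DL_adj_step:
  assumes "x \<in> DL T1 T2"
  shows "t2.par z = snd x \<Longrightarrow> R x (t1.par (fst x), z)" "t1.par w = fst x \<Longrightarrow> R x (w, t2.par (snd x))"
proof -
  show "R x (t1.par (fst x), z)" if "t2.par z = snd x"
    using nbs_subset[OF assms] assms that t1.par[of "fst x"] t2.par[of z] t2.sym
    by (auto simp: DL_adj_def nbs_def t2.children_def)
  show "R x (w, t2.par (snd x))" if "t1.par w = fst x"
    using nbs_subset[OF assms] assms that t2.par[of "snd x"] t1.par[of w] t1.sym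
    by (auto simp: DL_adj_def nbs_def t1.children_def)
qed

lemma walk_up1: "x \<in> DL T1 T2 \<Longrightarrow> t2.anc n z = snd x \<Longrightarrow> (R ^^ n) x (t1.anc n (fst x), z)"
proof (induction n arbitrary: x)
  case (Suc n)
  define x' where "x' = (t1.par (fst x), t2.anc n z)"
  have step: "R x x'" unfolding x'_def using Suc.prems by (intro DL_adj_step) auto
  then have "x' \<in> DL T1 T2" by (simp add: DL_adj_def)
  then have "(R ^^ n) x' (t1.anc n (fst x'), z)" by (rule Suc.IH) (simp add: x'_def)
  moreover have "t1.anc n (fst x') = t1.anc (Suc n) (fst x)" by (simp only: x'_def fst_conv t1.anc_par)
  ultimately show ?case using step by (metis relpowp_Suc_I2)
qed simp

lemma walk_up2: "x \<in> DL T1 T2 \<Longrightarrow> t1.anc n w = fst x \<Longrightarrow> (R ^^ n) x (w, t2.anc n (snd x))"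
proof (induction n arbitrary: x)
  case (Suc n)
  define x' where "x' = (t1.anc n w, t2.par (snd x))"
  have step: "R x x'" unfolding x'_def using Suc.prems by (intro DL_adj_step) auto
  then have "x' \<in> DL T1 T2" by (simp add: DL_adj_def)
  then have "(R ^^ n) x' (w, t2.anc n (snd x'))" by (rule Suc.IH) (simp add: x'_def)
  moreover have "t2.anc n (snd x') = t2.anc (Suc n) (snd x)" by (simp only: x'_def snd_conv t2.anc_par)
  ultimately show ?case using step by (metis relpowp_Suc_I2)
qed simp

lemma R_pow_DL: "(R ^^ n) x y \<Longrightarrow> x \<in> DL T1 T2 \<Longrightarrow> y \<in> DL T1 T2"
  by (cases n) (auto simp: DL_adj_def elim!: relpowp_Suc_E)

text \<open>An explicit walk. The first coordinate goes to the confluent with \<open>y1\<close> and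
  on to \<open>y1\<close>, while the second goes down to an arbitrary descendant \<open>z\<close>
  and climbs back. Then the first descends \<open>e\<close> further levels to \<open>c\<close>,
  which brings the second to the confluent with \<open>y2\<close>, and returns to \<open>y1\<close>
  while the second goes down to \<open>y2\<close>. The length is
  \<open>u + d + 2 * e\<close>.\<close>

lemma DL_dist_le:
  assumes "x \<in> DL T1 T2" "y \<in> DL T1 T2"
  shows "graph_dist R x y \<le> 3 * (u1 x y + u2 x y)"
proof -
  define u d v e where "u = u1 x y" and "d = d1 x y" and "v = u2 x y" and "e = d2 x y"
  have bal: "u + v = d + e" using DL_balance[OF assms] by (simp add: u_def d_def v_def e_def)
  have m1: "t1.anc u (fst x) = t1.anc d (fst y)" and m2: "t2.anc v (snd x) = t2.anc e (snd y)"
    by (simp_all add: u_def d_def v_def e_def t1.anc_up t2.anc_up)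
  obtain z where z: "t2.anc u z = snd x"
    using t2.ex_descendant by blast
  obtain c where c: "t1.anc e c = fst y"
    using t1.ex_descendant by blast
  define p1 where "p1 = (t1.anc u (fst x), z)"
  define p2 where "p2 = (fst y, t2.anc d z)"
  define p3 where "p3 = (c, t2.anc (e + d) z)"
  have w1: "(R ^^ u) x p1" unfolding p1_def by (rule walk_up1[OF assms(1) z])
  then have D1: "p1 \<in> DL T1 T2" using R_pow_DL assms(1) by blast
  have w2: "(R ^^ d) p1 p2"
    using walk_up2[OF D1, of d "fst y"] m1 by (simp add: p1_def p2_def)
  then have D2: "p2 \<in> DL T1 T2" using R_pow_DL D1 by blast
  have w3: "(R ^^ e) p2 p3"
    using walk_up2[OF D2, of e c] c by (simp add: p2_def p3_def funpow_add)
  then have D3: "p3 \<in> DL T1 T2" using R_pow_DL D2 by blast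
  have "t2.anc (e + d) z = t2.anc v (t2.anc u z)"
    unfolding t2.anc_anc using bal by (simp add: add.commute)
  also have "\<dots> = t2.anc e (snd y)" by (simp only: z m2)
  finally have "(R ^^ e) p3 y"
    using walk_up1[OF D3, of e "snd y"] c by (simp add: p3_def)
  with w1 w2 w3 have "(R ^^ (u + (d + (e + e)))) x y" by (meson relpowp_trans)
  then have "graph_dist R x y \<le> u + (d + (e + e))" by (rule graph_dist_le)
  also have "u + (d + (e + e)) \<le> 3 * (u + v)" using bal by presburger
  finally show ?thesis unfolding u_def v_def .
qed

lemma far_sequences_s:
  assumes "far_sequences (DL T1 T2) R X Y"
  shows "filterlim (\<lambda>n. u1 (X n) (Y n) + u2 (X n) (Y n)) at_top sequentially"
  unfolding filterlim_at_top
proof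
  fix Z
  have "\<forall>\<^sub>F n in sequentially. 3 * Z \<le> graph_dist R (X n) (Y n)"
    using assms by (auto simp: far_sequences_def filterlim_at_top)
  then show "\<forall>\<^sub>F n in sequentially. Z \<le> u1 (X n) (Y n) + u2 (X n) (Y n)"
  proof eventually_elim
    case (elim n)
    have "X n \<in> DL T1 T2" "Y n \<in> DL T1 T2" using assms by (auto simp: far_sequences_def)
    from order_trans[OF elim DL_dist_le[OF this]] show ?case by simp
  qed
qed

end

section \<open>The asymptotic statements and their constants\<close>

context dl_walk_down
begin

text \<open>Carries the corner comparison over to the Green kernel: the factor \<open>W\<close> of
  powers of \<open>q\<close> and \<open>r\<close> moves to the side of \<open>g\<close>, and the
  eventual positivity of \<open>g\<close> turns the real quotient into the one in
  \<open>ennreal\<close>.\<close>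

lemma green_asymptotics:
  assumes v: "\<And>n. 0 < n \<Longrightarrow> 0 < v00 n \<and> 0 < v01 n \<and> 0 < v11 n"
    and lim: "(\<lambda>n. k.Phi 0 0 n / v00 n) \<longlonglongrightarrow> 1" "(\<lambda>n. \<beta> ^ n * k.Phi 0 n n / v01 n) \<longlonglongrightarrow> 1"
      "(\<lambda>n. \<beta> ^ n * k.Phi n n n / v11 n) \<longlonglongrightarrow> 1"
    and g: "\<And>x y s la mu. x \<in> DL T1 T2 \<Longrightarrow> y \<in> DL T1 T2 \<Longrightarrow> s = u1 x y + u2 x y \<Longrightarrow> 0 < s \<Longrightarrow>
      la = (qint \<beta> s - qint \<beta> (u1 x y)) / qint \<beta> s \<Longrightarrow> mu = (qint \<beta> s - qint \<beta> (d1 x y)) / qint \<beta> s \<Longrightarrow>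
      g x y = (la * mu * v00 s + (la * (1 - mu) + (1 - la) * mu) * v01 s + (1 - la) * (1 - mu) * v11 s)
        / (\<beta> ^ d1 x y * (real q ^ d1 x y * real r ^ d2 x y))"
  shows "asymp_far (DL T1 T2) R (green (DL T1 T2) (DL_walk q r T1 T2 \<alpha>)) g"
  unfolding asymp_far_def
proof (intro allI impI)
  fix X Y assume far: "far_sequences (DL T1 T2) R X Y"
  then have XY: "X n \<in> DL T1 T2" "Y n \<in> DL T1 T2" for n by (auto simp: far_sequences_def)
  define u d s where "u n = u1 (X n) (Y n)" and "d n = d1 (X n) (Y n)" and "s n = u1 (X n) (Y n) + u2 (X n) (Y n)" for n
  define W where "W n = real q ^ d1 (X n) (Y n) * real r ^ d2 (X n) (Y n)" for n
  have W: "0 < W n" for n using qr by (simp add: W_def)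
  have s: "filterlim s at_top sequentially" unfolding s_def by (rule far_sequences_s[OF far])
  have ud: "u n \<le> s n" "d n \<le> s n" for n
    using DL_balance[OF XY[of n]] by (simp_all add: u_def d_def s_def)
  have eq: "\<beta> ^ d n * (W n * g (X n) (Y n)) =
      la * mu * v00 (s n) + (la * (1 - mu) + (1 - la) * mu) * v01 (s n) + (1 - la) * (1 - mu) * v11 (s n)"
    if "0 < s n" "la = (qint \<beta> (s n) - qint \<beta> (u n)) / qint \<beta> (s n)" "mu = (qint \<beta> (s n) - qint \<beta> (d n)) / qint \<beta> (s n)" for n la mu
  proof -
    have "g (X n) (Y n) = (la * mu * v00 (s n) + (la * (1 - mu) + (1 - la) * mu) * v01 (s n) + (1 - la) * (1 - mu) * v11 (s n))
        / (\<beta> ^ d n * W n)"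
      unfolding d_def W_def by (rule g[OF XY]) (use that in \<open>simp_all add: u_def d_def s_def\<close>)
    then show ?thesis using W[of n] k.b0 by simp
  qed
  have asy: "(\<lambda>n. k.Phi (u n) (d n) (s n) / (W n * g (X n) (Y n))) \<longlonglongrightarrow> 1"
    "\<forall>\<^sub>F n in sequentially. 0 < W n * g (X n) (Y n)"
    by (rule k.Phi_asymptotics[OF s ud v lim eq]; assumption)+
  have "\<forall>\<^sub>F n in sequentially. ennreal (k.Phi (u n) (d n) (s n) / (W n * g (X n) (Y n)))
      = green (DL T1 T2) (DL_walk q r T1 T2 \<alpha>) (X n) (Y n) / ennreal (g (X n) (Y n))"
    using asy(2)
  proof eventually_elim
    case (elim n)
    then have g: "0 < g (X n) (Y n)" using W[of n] by (simp add: zero_less_mult_iff)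
    have "green (DL T1 T2) (DL_walk q r T1 T2 \<alpha>) (X n) (Y n) = ennreal (k.Phi (u n) (d n) (s n) / W n)"
      using green_DL[OF XY[of n]] by (simp add: u_def d_def s_def W_def)
    moreover have "0 \<le> k.Phi (u n) (d n) (s n)" by (rule k.Phi_props(2)[OF ud])
    ultimately show ?case using g W[of n] by (simp add: divide_ennreal)
  qed
  moreover have "(\<lambda>n. ennreal (k.Phi (u n) (d n) (s n) / (W n * g (X n) (Y n)))) \<longlonglongrightarrow> ennreal 1"
    using asy(1) by (intro tendsto_ennrealI) 
  ultimately show "(\<lambda>n. green (DL T1 T2) (DL_walk q r T1 T2 \<alpha>) (X n) (Y n) / ennreal (g (X n) (Y n))) \<longlonglongrightarrow> 1"
    by (simp add: Lim_transform_eventually)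
qed

lemma tree_green_product:
  "green UNIV (tree_walk q T1 \<alpha>) (base T1) (base T1) * green UNIV (tree_walk r T2 (1 - \<alpha>)) (base T2) (base T2)
    = ennreal (real q / (real q * (1 - \<alpha>) - \<alpha>) * (real r / (real r * (1 - \<alpha>) - \<alpha>)))"
proof -
  \<comment> \<open>The parameters of the two tree walks are \<open>\<alpha>\<close> and
    \<open>1 - \<alpha>\<close>, so both have the same maximum and minimum.\<close>
  have mm: "max \<alpha> (1 - \<alpha>) = 1 - \<alpha>" "min \<alpha> (1 - \<alpha>) = \<alpha>"
    "max (1 - \<alpha>) (1 - (1 - \<alpha>)) = 1 - \<alpha>" "min (1 - \<alpha>) (1 - (1 - \<alpha>)) = \<alpha>"
    using drift by auto
  have al: "0 < 1 - \<alpha>" "1 - \<alpha> < 1" using \<alpha> by simp_all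
  have "\<alpha> \<le> x * (1 - \<alpha>)" if "1 < x" for x :: real
  proof -
    have "\<alpha> \<le> 1 * (1 - \<alpha>)" using drift by simp
    also have "\<dots> \<le> x * (1 - \<alpha>)" using that \<alpha> by (intro mult_right_mono) auto
    finally show ?thesis .
  qed
  then have "0 \<le> real q / (real q * (1 - \<alpha>) - \<alpha>)" "0 \<le> real r / (real r * (1 - \<alpha>) - \<alpha>)"
    using k.q k.r by simp_all
  then show ?thesis
    unfolding t1.tree_green_diag[OF \<alpha>] t2.tree_green_diag[OF al] mm by (rule ennreal_mult[symmetric])
qed

lemma drift_product:
  assumes lt: "\<alpha> < 1 / 2" and A: "A = q * r * (\<beta>\<^sup>2 - 1) / ((q * \<beta> - 1) * (r * \<beta> - 1))"
  shows "green UNIV (tree_walk q T1 \<alpha>) (base T1) (base T1) * green UNIV (tree_walk r T2 (1 - \<alpha>)) (base T2) (base T2)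
    / green UNIV (int_walk \<alpha>) 0 0 = ennreal A"
proof -
  have b1: "1 < \<beta>" using lt \<alpha> by (simp add: \<beta>_def field_simps)
  have al: "1 - \<alpha> = \<alpha> * \<beta>" using \<alpha> by (simp add: \<beta>_def)
  have "max \<alpha> (1 - \<alpha>) = 1 - \<alpha>" "min \<alpha> (1 - \<alpha>) = \<alpha>" using lt by auto
  then have G0: "green UNIV (int_walk \<alpha>) 0 0 = ennreal (1 / (1 - \<alpha> - \<alpha>))"
    using int_green_diag[OF \<alpha>, of 0] lt by simp
  have d: "real q * (1 - \<alpha>) - \<alpha> = \<alpha> * (q * \<beta> - 1)" "real r * (1 - \<alpha>) - \<alpha> = \<alpha> * (r * \<beta> - 1)" "1 - \<alpha> - \<alpha> = \<alpha> * (\<beta> - 1)"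
    by (simp_all add: al algebra_simps)
  \<comment> \<open>The three denominators contribute a factor \<open>\<alpha>\<close> each, of
    which one survives as \<open>1 / \<alpha> = \<beta> + 1\<close>.\<close>
  have ab: "(\<beta> - 1) * (1 / \<alpha>) = \<beta>\<^sup>2 - 1"
  proof -
    have "1 / \<alpha> = \<beta> + 1" using \<alpha> by (simp add: \<beta>_def field_simps)
    then show ?thesis by (simp add: algebra_simps power2_eq_square)
  qed
  have *: "q / (\<alpha> * Q) * (r / (\<alpha> * R)) / (1 / (\<alpha> * c)) = q * r * (c * (1 / \<alpha>)) / (Q * R)" for Q R c :: real
    using \<alpha> by (simp add: mult_ac)
  have e: "q / (\<alpha> * (q * \<beta> - 1)) * (r / (\<alpha> * (r * \<beta> - 1))) / (1 / (\<alpha> * (\<beta> - 1))) = A"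
    unfolding A * ab ..
  have "0 < \<alpha> * (q * \<beta> - 1)" "0 < \<alpha> * (r * \<beta> - 1)" "0 < \<alpha> * (\<beta> - 1)" using \<alpha> k.qb b1 by simp_all
  then show ?thesis
    unfolding tree_green_product G0 d e[symmetric] using k.q k.r by (intro divide_ennreal) auto
qed

lemma drift_asymptotics:
  assumes lt: "\<alpha> < 1 / 2" and A: "A = q * r * (\<beta>\<^sup>2 - 1) / ((q * \<beta> - 1) * (r * \<beta> - 1))"
    and B: "B = (\<beta> - 1) * (q * \<beta> + 1) / (q * \<beta>\<^sup>2 - 1)"
    and B': "B' = (\<beta> - 1) * (r * \<beta> + 1) / (r * \<beta>\<^sup>2 - 1)"
  shows "asymp_far (DL T1 T2) R (green (DL T1 T2) (DL_walk q r T1 T2 \<alpha>))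
    (\<lambda>x y. A / ((q * \<beta>) ^ d1 x y * real r ^ d2 x y) *
      (B * ((\<beta> ^ (u1 x y + u2 x y) - \<beta> ^ u1 x y) / (\<beta> ^ (u1 x y + u2 x y) - 1))
         * ((\<beta> ^ (u1 x y + u2 x y) - \<beta> ^ d1 x y) / (\<beta> ^ (u1 x y + u2 x y) - 1)) * (1 / \<beta> ^ (u1 x y + u2 x y))
       + ((\<beta> ^ (u1 x y + u2 x y) - \<beta> ^ u1 x y) / (\<beta> ^ (u1 x y + u2 x y) - 1))
         * ((\<beta> ^ d1 x y - 1) / (\<beta> ^ (u1 x y + u2 x y) - 1))
       + ((\<beta> ^ u1 x y - 1) / (\<beta> ^ (u1 x y + u2 x y) - 1))
         * ((\<beta> ^ (u1 x y + u2 x y) - \<beta> ^ d1 x y) / (\<beta> ^ (u1 x y + u2 x y) - 1))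
       + B' * ((\<beta> ^ u1 x y - 1) / (\<beta> ^ (u1 x y + u2 x y) - 1))
         * ((\<beta> ^ d1 x y - 1) / (\<beta> ^ (u1 x y + u2 x y) - 1))))"
    (is "asymp_far _ _ _ ?g")
proof -
  have b1: "1 < \<beta>" using lt \<alpha> by (simp add: \<beta>_def field_simps)
  have AA: "(\<beta> - 1) * k.A0 = A" "(\<beta> - 1) * k.Cq = B" "(\<beta> - 1) * k.Cr = B'"
  proof -
    have "\<beta>\<^sup>2 - 1 = (\<beta> - 1) * (\<beta> + 1)" by algebra
    then show "(\<beta> - 1) * k.A0 = A" unfolding k.A0_def A by simp
    show "(\<beta> - 1) * k.Cq = B" "(\<beta> - 1) * k.Cr = B'"
      unfolding k.Cq_def k.Cr_def B B' by simp_all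
  qed
  have ABpos: "0 < A" "0 < B" "0 < B'" using k.A0_pos b1 by (simp_all flip: AA)
  show ?thesis
  proof (rule green_asymptotics[OF _ k.corners_drift[OF b1, unfolded AA]])
    show "0 < A * B / \<beta> ^ n \<and> 0 < A \<and> 0 < A * B'" for n using ABpos b1 by simp
    fix x y s la mu
    assume s: "s = u1 x y + u2 x y" "0 < s"
      and la: "la = (qint \<beta> s - qint \<beta> (u1 x y)) / qint \<beta> s" and mu: "mu = (qint \<beta> s - qint \<beta> (d1 x y)) / qint \<beta> s"
    have nz: "qint \<beta> s \<noteq> 0" "\<beta> - 1 \<noteq> 0" using k.kernel_pos[OF s(2)] b1 by auto
    \<comment> \<open>The fractions in the theorem are the interpolation weights; numerator and
      denominator share the factor \<open>\<beta> - 1\<close>.\<close>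
    have fr: "(\<beta> ^ s - \<beta> ^ k) / (\<beta> ^ s - 1) = (qint \<beta> s - qint \<beta> k) / qint \<beta> s"
      "(\<beta> ^ k - 1) / (\<beta> ^ s - 1) = 1 - (qint \<beta> s - qint \<beta> k) / qint \<beta> s" for k
    proof -
      have "\<beta> ^ s - \<beta> ^ k = (\<beta> - 1) * (qint \<beta> s - qint \<beta> k)" "\<beta> ^ s - 1 = (\<beta> - 1) * qint \<beta> s" "\<beta> ^ k - 1 = (\<beta> - 1) * qint \<beta> k"
        unfolding power_qint[of \<beta> s] power_qint[of \<beta> k] by (simp_all add: algebra_simps)
      then show "(\<beta> ^ s - \<beta> ^ k) / (\<beta> ^ s - 1) = (qint \<beta> s - qint \<beta> k) / qint \<beta> s"
        "(\<beta> ^ k - 1) / (\<beta> ^ s - 1) = 1 - (qint \<beta> s - qint \<beta> k) / qint \<beta> s"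
        using nz by (simp_all add: diff_divide_distrib)
    qed
    show "?g x y
        = (la * mu * (A * B / \<beta> ^ s) + (la * (1 - mu) + (1 - la) * mu) * A + (1 - la) * (1 - mu) * (A * B'))
          / (\<beta> ^ d1 x y * (real q ^ d1 x y * real r ^ d2 x y))"
      unfolding s(1)[symmetric] fr la[symmetric] mu[symmetric] power_mult_distrib
      by (simp add: divide_inverse algebra_simps)
  qed
qed

lemma critical_product:
  assumes half: "\<alpha> = 1 / 2" and A: "A = 2 * real q * real r / ((real q - 1) * (real r - 1))"
  shows "green UNIV (tree_walk q T1 \<alpha>) (base T1) (base T1) * green UNIV (tree_walk r T2 (1 - \<alpha>)) (base T2) (base T2) / 2
    = ennreal A"
proof -
  have d: "real q / (real q * (1 - \<alpha>) - \<alpha>) = 2 * real q / (real q - 1)" "real r / (real r * (1 - \<alpha>) - \<alpha>) = 2 * real r / (real r - 1)"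
    unfolding half using k.q k.r by (simp_all add: field_simps)
  have e: "2 * real q / (real q - 1) * (2 * real r / (real r - 1)) / 2 = A" unfolding A by simp
  have "ennreal (2 * real q / (real q - 1) * (2 * real r / (real r - 1))) / 2 = ennreal A"
    unfolding e[symmetric] using k.q k.r divide_ennreal[of "2 * real q / (real q - 1) * (2 * real r / (real r - 1))" 2] by simp
  then show ?thesis unfolding tree_green_product d .
qed

lemma critical_asymptotics:
  assumes half: "\<alpha> = 1 / 2" and A: "A = 2 * real q * real r / ((real q - 1) * (real r - 1))"
  shows "asymp_far (DL T1 T2) R (green (DL T1 T2) (DL_walk q r T1 T2 \<alpha>))
    (\<lambda>x y. A / (real (u1 x y + u2 x y) ^ 4 * real q ^ d1 x y * real r ^ d2 x y) *
      ((real q + 1) / (real q - 1) * real (u2 x y) * real (d2 x y)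
       + real (u1 x y + u2 x y) * real (u2 x y) * real (d1 x y)
       + real (u1 x y + u2 x y) * real (u1 x y) * real (d2 x y)
       + (real r + 1) / (real r - 1) * real (u1 x y) * real (d1 x y)))"
    (is "asymp_far _ _ _ ?g")
proof -
  have b: "\<beta> = 1" unfolding \<beta>_def using half by simp
  have AA: "k.A0 = A" unfolding k.A0_def unfolding b A by simp
  have CC: "k.Cq = (real q + 1) / (real q - 1)" "k.Cr = (real r + 1) / (real r - 1)"
    unfolding k.Cq_def k.Cr_def unfolding b by simp_all
  note pos = k.A0_pos[unfolded AA CC]
  show ?thesis
  proof (rule green_asymptotics[OF _ k.corners_critical[OF b, unfolded AA CC]])
    show "0 < A * ((real q + 1) / (real q - 1)) / (real n)\<^sup>2 \<and> 0 < A / real n \<and> 0 < A * ((real r + 1) / (real r - 1)) / (real n)\<^sup>2"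
      if "0 < n" for n
      using pos that k.q k.r by (intro conjI divide_pos_pos mult_pos_pos) simp_all
    fix x y s la mu
    assume xy: "x \<in> DL T1 T2" "y \<in> DL T1 T2" and s: "s = u1 x y + u2 x y" "0 < s"
      and la: "la = (qint \<beta> s - qint \<beta> (u1 x y)) / qint \<beta> s" and mu: "mu = (qint \<beta> s - qint \<beta> (d1 x y)) / qint \<beta> s"
    have n: "qint \<beta> n = real n" for n by (simp add: qint_def b)
    have "s = d1 x y + d2 x y" using DL_balance[OF xy] s(1) by simp
    then have rs: "real s = real (d1 x y) + real (d2 x y)" "real s = real (u1 x y) + real (u2 x y)"
      unfolding s(1) by (simp_all flip: of_nat_add)
    have ls: "la * s = real s - real (u1 x y)" "mu * s = real s - real (d1 x y)"
      using s(2) unfolding la mu n by simp_all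
    \<comment> \<open>In the critical case the weights are \<open>la = u2 / s\<close> and
      \<open>mu = d2 / s\<close>, by the two ways of writing \<open>s\<close> as a sum.\<close>
    have u: "real (u2 x y) = la * s" "real (d2 x y) = mu * s" "real (u1 x y) = (1 - la) * s" "real (d1 x y) = (1 - mu) * s"
      unfolding left_diff_distrib ls using rs by simp_all
    define c c' W where "c = (real q + 1) / (real q - 1)" and "c' = (real r + 1) / (real r - 1)"
      and "W = real q ^ d1 x y * real r ^ d2 x y"
    define E where "E = la * mu * (c / s\<^sup>2) + (la * (1 - mu) + (1 - la) * mu) * (1 / s) + (1 - la) * (1 - mu) * (c' / s\<^sup>2)"
    have num: "c * (la * s) * (mu * s) + s * (la * s) * ((1 - mu) * s) + s * ((1 - la) * s) * (mu * s) + c' * ((1 - la) * s) * ((1 - mu) * s)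
      = real s ^ 4 * E"
      using s(2) unfolding E_def by (simp add: field_simps power2_eq_square power4_eq_xxxx)
    have "?g x y = A / (s ^ 4 * W) * (real s ^ 4 * E)"
      unfolding num[symmetric] c_def c'_def W_def s(1)[symmetric] u by (simp add: mult.assoc)
    also have "\<dots> = A * E / W" using s(2) by simp
    also have "A * E = la * mu * (A * c / s\<^sup>2) + (la * (1 - mu) + (1 - la) * mu) * (A / s) + (1 - la) * (1 - mu) * (A * c' / s\<^sup>2)"
      unfolding E_def by (simp add: distrib_left mult_ac)
    finally show "?g x y = (la * mu * (A * ((real q + 1) / (real q - 1)) / (real s)\<^sup>2) + (la * (1 - mu) + (1 - la) * mu) * (A / real s)
           + (1 - la) * (1 - mu) * (A * ((real r + 1) / (real r - 1)) / (real s)\<^sup>2))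
          / (\<beta> ^ d1 x y * (real q ^ d1 x y * real r ^ d2 x y))"
      unfolding c_def c'_def W_def b by simp
  qed
qed

end

theorem theorem4p2:
  fixes T1 :: "'a pointed_tree" and T2 :: "'b pointed_tree"
    and q r :: nat and \<alpha> :: real
  assumes "pointed_homogeneous_tree q T1" and "pointed_homogeneous_tree r T2"
    and "0 < \<alpha>" and "\<alpha> < 1"
  shows
    "let G = green (DL T1 T2) (DL_walk q r T1 T2 \<alpha>);
         G1 = green UNIV (tree_walk q T1 \<alpha>);
         G2 = green UNIV (tree_walk r T2 (1 - \<alpha>));
         Gt = green UNIV (int_walk \<alpha>);
         u1 = (\<lambda>x y. up T1 (fst x) (fst y)); d1 = (\<lambda>x y. down T1 (fst x) (fst y));
         u2 = (\<lambda>x y. up T2 (snd x) (snd y)); d2 = (\<lambda>x y. down T2 (snd x) (snd y));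
         s = (\<lambda>x y. u1 x y + u2 x y)
     in (\<forall>x\<in>DL T1 T2. \<forall>y\<in>DL T1 T2. s x y = d1 x y + d2 x y)
      \<and> (\<forall>X Y. far_sequences (DL T1 T2) (DL_adj T1 T2) X Y \<longrightarrow>
           filterlim (\<lambda>n. s (X n) (Y n)) at_top sequentially)
      \<and> (\<alpha> < 1 / 2 \<longrightarrow>
          (let \<beta> = (1 - \<alpha>) / \<alpha>;
               A = q * r * (\<beta>\<^sup>2 - 1) / ((q * \<beta> - 1) * (r * \<beta> - 1));
               B = (\<beta> - 1) * (q * \<beta> + 1) / (q * \<beta>\<^sup>2 - 1);
               B' = (\<beta> - 1) * (r * \<beta> + 1) / (r * \<beta>\<^sup>2 - 1)
           in G1 (base T1) (base T1) * G2 (base T2) (base T2) / Gt 0 0 = ennreal A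
            \<and> asymp_far (DL T1 T2) (DL_adj T1 T2) G
                (\<lambda>x y. A / ((q * \<beta>) ^ d1 x y * real r ^ d2 x y) *
                  (B * ((\<beta> ^ s x y - \<beta> ^ u1 x y) / (\<beta> ^ s x y - 1))
                     * ((\<beta> ^ s x y - \<beta> ^ d1 x y) / (\<beta> ^ s x y - 1)) * (1 / \<beta> ^ s x y)
                   + ((\<beta> ^ s x y - \<beta> ^ u1 x y) / (\<beta> ^ s x y - 1))
                     * ((\<beta> ^ d1 x y - 1) / (\<beta> ^ s x y - 1))
                   + ((\<beta> ^ u1 x y - 1) / (\<beta> ^ s x y - 1))
                     * ((\<beta> ^ s x y - \<beta> ^ d1 x y) / (\<beta> ^ s x y - 1))
                   + B' * ((\<beta> ^ u1 x y - 1) / (\<beta> ^ s x y - 1))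
                     * ((\<beta> ^ d1 x y - 1) / (\<beta> ^ s x y - 1))))))
      \<and> (\<alpha> = 1 / 2 \<longrightarrow>
          (let A = 2 * real q * real r / ((real q - 1) * (real r - 1))
           in G1 (base T1) (base T1) * G2 (base T2) (base T2) / 2 = ennreal A
            \<and> asymp_far (DL T1 T2) (DL_adj T1 T2) G
                (\<lambda>x y. A / (real (s x y) ^ 4 * real q ^ d1 x y * real r ^ d2 x y) *
                  ((real q + 1) / (real q - 1) * real (u2 x y) * real (d2 x y)
                   + real (s x y) * real (u2 x y) * real (d1 x y)
                   + real (s x y) * real (u1 x y) * real (d2 x y)
                   + (real r + 1) / (real r - 1) * real (u1 x y) * real (d1 x y)))))"
proof -
  obtain f1 where f1: "end_tree T1 f1 q" using pointed_homogeneous_tree_end_tree[OF assms(1)] by blast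
  obtain f2 where f2: "end_tree T2 f2 r" using pointed_homogeneous_tree_end_tree[OF assms(2)] by blast
  have dl: "dl_walk T1 f1 q T2 f2 r \<alpha>"
    using f1 f2 assms(3,4) by (simp add: dl_walk_def dl_walk_axioms_def)
  have down: "dl_walk_down T1 f1 q T2 f2 r \<alpha>" if "\<alpha> \<le> 1 / 2"
    using dl that by (simp add: dl_walk_down_def dl_walk_down_axioms_def)
  show ?thesis
    unfolding Let_def
  proof (intro conjI impI, goal_cases)
    case 1
    show ?case using dl_walk.DL_balance[OF dl] by blast
  next
    case 2
    show ?case using dl_walk.far_sequences_s[OF dl] by blast
  next
    case 3
    then have d: "dl_walk_down T1 f1 q T2 f2 r \<alpha>" by (intro down) simp
    show ?case
      by (rule dl_walk_down.drift_product[OF d, unfolded dl_walk_down.\<beta>_def[OF d], OF 3 refl])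
  next
    case 4
    then have d: "dl_walk_down T1 f1 q T2 f2 r \<alpha>" by (intro down) simp
    show ?case
      by (rule dl_walk_down.drift_asymptotics[OF d, unfolded dl_walk_down.\<beta>_def[OF d], OF 4 refl refl refl])
  next
    case 5
    then show ?case by (intro dl_walk_down.critical_product[OF down _ refl]) simp_all
  next
    case 6
    then show ?case by (intro dl_walk_down.critical_asymptotics[OF down _ refl]) simp_all
  qed
qed

end
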